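(* Let $v\in\wedge^4V_8$ be general, and let $D=D_{Z_6}(v)\subset Q=D_{Z_1}(v)\subset G(2,V_8)$. Then $Q$, which is a quadratic section of the Grassmannian $G(2,V_8)$, is the only quadratic section of $G(2,V_8)$ that is singular along $D$.
   Context: We work over $\mathbb{C}$; $V_8$ is a complex vector space of dimension $8$ and $G(2,V_8)$ is the Grassmannian of $2$-dimensional subspaces $U_2\subset V_8$, with Plücker line bundle $\mathcal{O}_G(1)$. A quadratic section of $G(2,V_8)$ is a hypersurface defined by a nonzero section of $\mathcal{O}_G(2)$. "General" means in a suitable nonempty Zariski open subset. For $[U_2]\in G(2,V_8)$, the image of $v$ in $\wedge^4(V_8/U_2)\simeq\wedge^2(V_8/U_2)^\vee\otimes\det(V_8/U_2)$ is (up to a twist) a skew-symmetric form on the $6$-dimensional space $V_8/U_2$; globally this is a skew-symmetric morphism $\psi_v:\mathcal{Q}\to\mathcal{Q}^\vee(1)$, where $\mathcal{Q}$ is the rank six tautological quotient bundle. $D_{Z_1}(v)$ is the Pfaffian hypersurface where $\psi_v$ has rank at most $4$, and $D_{Z_6}(v)$ is the locus where $\psi_v$ has rank at most $2$. *)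

theory Defs
  imports "HOL-Analysis.Analysis"
begin

text \<open>
  The space \<open>V\<^sub>8\<close> is \<open>\<complex>\<^sup>8\<close>. Its exterior algebra has the basis \<open>e\<^sub>I\<close>, the wedge of the
  \<open>e\<^sub>i\<close> with \<open>i \<in> I\<close> in increasing order, where \<open>I\<close> runs through the subsets of the index type.
\<close>

type_synonym V8 = "complex ^ 8"
type_synonym ext8 = "complex ^ (8 set)"

text \<open>
  The sign counts inversions: \<open>e\<^sub>I \<and> e\<^sub>J\<close> is, for disjoint \<open>I\<close> and \<open>J\<close>, the vector \<open>e\<^sub>K\<close> with
  \<open>K = I \<union> J\<close>, times minus one to the number of pairs \<open>(i, j) \<in> I \<times> J\<close> with \<open>j < i\<close>.
\<close>

definition wedge :: "ext8 \<Rightarrow> ext8 \<Rightarrow> ext8"  (infixr "\<and>\<^sub>e" 70) where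
  "w \<and>\<^sub>e z = (\<chi> K. \<Sum>I\<in>Pow K.
      (-1) ^ card {(i, j). i \<in> I \<and> j \<in> K - I \<and> j < i} * w $ I * z $ (K - I))"

definition ext_one :: ext8 where
  "ext_one = (\<chi> I. if I = {} then 1 else 0)"

definition ext_vec :: "V8 \<Rightarrow> ext8" where
  "ext_vec x = (\<chi> I. \<Sum>i\<in>UNIV. if I = {i} then x $ i else 0)"

definition wedges :: "V8 list \<Rightarrow> ext8" where
  "wedges xs = foldr (\<lambda>x w. ext_vec x \<and>\<^sub>e w) xs ext_one"

definition ext_power :: "nat \<Rightarrow> ext8 set" where
  "ext_power k = {w. \<forall>I. card I \<noteq> k \<longrightarrow> w $ I = 0}"

text \<open>The isomorphism of the top exterior power with \<open>\<complex>\<close> given by the standard volume form.\<close>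

definition top_coeff :: "ext8 \<Rightarrow> complex" where
  "top_coeff w = w $ UNIV"

text \<open>The algebra of polynomial functions generated by a set \<open>L\<close> of coordinate functions.\<close>

inductive_set poly_functions :: "('a \<Rightarrow> complex) set \<Rightarrow> ('a \<Rightarrow> complex) set"
  for L :: "('a \<Rightarrow> complex) set" where
  const: "(\<lambda>_. c) \<in> poly_functions L"
| coord: "f \<in> L \<Longrightarrow> f \<in> poly_functions L"
| add: "f \<in> poly_functions L \<Longrightarrow> g \<in> poly_functions L \<Longrightarrow> (\<lambda>x. f x + g x) \<in> poly_functions L"
| mult: "f \<in> poly_functions L \<Longrightarrow> g \<in> poly_functions L \<Longrightarrow> (\<lambda>x. f x * g x) \<in> poly_functions L"

definition zariski_open_ext_power :: "nat \<Rightarrow> ext8 set \<Rightarrow> bool" where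
  "zariski_open_ext_power k \<Omega> \<longleftrightarrow>
    (\<exists>S \<subseteq> poly_functions {\<lambda>w. w $ I | I. True}.
       \<Omega> = ext_power k - {w \<in> ext_power k. \<forall>p\<in>S. p w = 0})"

definition grassmannian :: "V8 set set" where
  "grassmannian = {U. vec.subspace U \<and> vec.dim U = 2}"

text \<open>
  A basis of \<open>U\<close> is recorded as the two rows of a matrix \<open>M\<close>; the bases of all \<open>U\<close> in the
  Grassmannian are then exactly the \<open>2 \<times> 8\<close> matrices of rank 2, and \<open>GL\<^sub>2\<close> acts on the left.
\<close>

type_synonym frame = "complex ^ 8 ^ 2"

definition is_basis_of :: "frame \<Rightarrow> V8 set \<Rightarrow> bool" where
  "is_basis_of M U \<longleftrightarrow> rank M = 2 \<and> vec.span (rows M) = U"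

text \<open>
  The Pluecker line bundle is the determinant of the dual tautological bundle. A section of its
  square assigns to each \<open>U\<close> an element of the square of the dual of the line \<open>\<and>\<^sup>2U\<close>; the value
  \<open>s M\<close> is the evaluation of that element at \<open>u\<^sub>1 \<and> u\<^sub>2\<close>, for the basis \<open>u\<^sub>1, u\<^sub>2\<close> of \<open>U\<close> given
  by the rows of \<open>M\<close>. Only the values on matrices of rank 2 are meaningful. Algebraicity is
  required in each affine chart \<open>p\<^sub>i\<^sub>j \<noteq> 0\<close>, which is an affine space \<open>\<complex>\<^sup>1\<^sup>2\<close>: there \<open>U\<close> has a unique
  basis for which the columns \<open>i, j\<close> of \<open>M\<close> form the identity matrix, and \<open>u\<^sub>1 \<and> u\<^sub>2\<close> for this
  basis trivialises \<open>\<and>\<^sup>2U\<close>.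
\<close>

definition is_section_O2 :: "(frame \<Rightarrow> complex) \<Rightarrow> bool" where
  "is_section_O2 s \<longleftrightarrow>
    (\<forall>A M. invertible A \<and> rank M = 2 \<longrightarrow> s (A ** M) = (det A)\<^sup>2 * s M) \<and>
    (\<forall>i j. i \<noteq> j \<longrightarrow>
      (\<exists>p \<in> poly_functions {\<lambda>M. M $ k $ l | k l. True}.
        \<forall>M. M $ 1 $ i = 1 \<and> M $ 1 $ j = 0 \<and> M $ 2 $ i = 0 \<and> M $ 2 $ j = 1 \<longrightarrow> s M = p M))"

text \<open>
  A quadratic section is the divisor of a nonzero section. Two nonzero sections define the same
  divisor (the same subscheme) iff they are proportional.
\<close>

definition defines_quadratic_section :: "(frame \<Rightarrow> complex) \<Rightarrow> bool" where
  "defines_quadratic_section s \<longleftrightarrow> is_section_O2 s \<and> (\<exists>M. rank M = 2 \<and> s M \<noteq> 0)"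

definition same_hypersurface :: "(frame \<Rightarrow> complex) \<Rightarrow> (frame \<Rightarrow> complex) \<Rightarrow> bool" where
  "same_hypersurface s t \<longleftrightarrow> (\<exists>c. c \<noteq> 0 \<and> (\<forall>M. rank M = 2 \<longrightarrow> s M = c * t M))"

definition zero_locus :: "(frame \<Rightarrow> complex) \<Rightarrow> V8 set set" where
  "zero_locus s = {U \<in> grassmannian. \<forall>M. is_basis_of M U \<longrightarrow> s M = 0}"

text \<open>
  A local equation and its differential vanish at the point \<open>U\<close>. Every tangent vector of the
  Grassmannian at \<open>U\<close>, that is, every element of \<open>Hom(U, V\<^sub>8/U)\<close>, is the velocity at \<open>t = 0\<close> of the
  curve of row spaces of \<open>M + tN\<close> for some \<open>N\<close>.
\<close>

definition singular_at :: "(frame \<Rightarrow> complex) \<Rightarrow> V8 set \<Rightarrow> bool" where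
  "singular_at s U \<longleftrightarrow>
    (\<forall>M. is_basis_of M U \<longrightarrow> s M = 0 \<and>
      (\<forall>N :: frame. ((\<lambda>t. s (\<chi> k l. M $ k $ l + t * N $ k $ l)) has_field_derivative 0) (at 0)))"

definition singular_along :: "(frame \<Rightarrow> complex) \<Rightarrow> V8 set set \<Rightarrow> bool" where
  "singular_along s D \<longleftrightarrow> (\<forall>U\<in>D. singular_at s U)"

text \<open>
  Wedging with \<open>u\<^sub>1 \<and> u\<^sub>2\<close> identifies \<open>\<and>\<^sup>k(V\<^sub>8/U)\<close> with a subspace of \<open>\<and>\<^sup>k\<^sup>+\<^sup>2V\<^sub>8\<close>. The
  skew form \<open>\<psi>\<^sub>v\<close> on \<open>V\<^sub>8/U\<close> sends \<open>x, y\<close> to the wedge of the image of \<open>v\<close> in \<open>\<and>\<^sup>4(V\<^sub>8/U)\<close> with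
  \<open>x \<and> y\<close>, in the line \<open>\<and>\<^sup>6(V\<^sub>8/U)\<close>, which is identified with \<open>\<and>\<^sup>8V\<^sub>8\<close> by the basis \<open>u\<^sub>1, u\<^sub>2\<close>.
  It is written here as a form on \<open>V\<^sub>8\<close> with \<open>U\<close> in its kernel, so that its rank is the rank of
  the form on \<open>V\<^sub>8/U\<close>.
\<close>

definition psi :: "ext8 \<Rightarrow> frame \<Rightarrow> V8 \<Rightarrow> V8 \<Rightarrow> complex" where
  "psi v M x y = top_coeff (v \<and>\<^sub>e wedges [row 1 M, row 2 M, x, y])"

definition psi_matrix :: "ext8 \<Rightarrow> frame \<Rightarrow> complex ^ 8 ^ 8" where
  "psi_matrix v M = (\<chi> i j. psi v M (axis i 1) (axis j 1))"

definition degeneracy_locus :: "nat \<Rightarrow> ext8 \<Rightarrow> V8 set set" where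
  "degeneracy_locus r v =
    {U \<in> grassmannian. \<forall>M. is_basis_of M U \<longrightarrow> rank (psi_matrix v M) \<le> r}"

definition D_Z1 :: "ext8 \<Rightarrow> V8 set set" where
  "D_Z1 v = degeneracy_locus 4 v"

definition D_Z6 :: "ext8 \<Rightarrow> V8 set set" where
  "D_Z6 v = degeneracy_locus 2 v"

definition pfaffian :: "nat \<Rightarrow> (nat \<Rightarrow> nat \<Rightarrow> complex) \<Rightarrow> complex" where
  "pfaffian n a =
    (\<Sum>\<sigma> | \<sigma> permutes {..<2 * n}. of_int (sign \<sigma>) * (\<Prod>i<n. a (\<sigma> (2 * i)) (\<sigma> (2 * i + 1))))
      / (2 ^ n * fact n)"

text \<open>
  The Pfaffian of \<open>\<psi>\<^sub>v\<close> is an element of \<open>det (V\<^sub>8/U)\<^sup>\<or>\<close>, which the basis \<open>u\<^sub>1, u\<^sub>2\<close> identifies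
  with \<open>\<and>\<^sup>8V\<^sub>8\<^sup>\<or> = \<complex>\<close>. So it is the scalar \<open>c\<close> such that the Pfaffian of the \<open>6 \<times> 6\<close> matrix of
  \<open>\<psi>\<^sub>v\<close> on any \<open>x\<^sub>0, ..., x\<^sub>5\<close> is \<open>c\<close> times the volume of \<open>u\<^sub>1, u\<^sub>2, x\<^sub>0, ..., x\<^sub>5\<close>. A base change
  \<open>A\<close> of \<open>U\<close> multiplies the former by \<open>(det A)\<^sup>3\<close> and the latter by \<open>det A\<close>, hence \<open>c\<close> by
  \<open>(det A)\<^sup>2\<close>.
\<close>

definition pfaffian_section :: "ext8 \<Rightarrow> frame \<Rightarrow> complex" where
  "pfaffian_section v M =
    (THE c. \<forall>x :: nat \<Rightarrow> V8.
       pfaffian 3 (\<lambda>a b. psi v M (x a) (x b))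
         = c * top_coeff (wedges ([row 1 M, row 2 M] @ map x [0..<6])))"

end

theory Submission
  imports Defs "HOL-Combinatorics.Permutations" "HOL-Complex_Analysis.Cauchy_Integral_Formula"
    "HOL-Computational_Algebra.Fundamental_Theorem_Algebra"
begin

text \<open>
  A section of \<open>\<O>(2)\<close> is \<open>M \<mapsto> R(u, w, u, w)\<close> for an algebraic curvature tensor \<open>R\<close>, and it is singular at the
  row space of \<open>M\<close> iff \<open>R(u, w, u, \<cdot>) = R(u, w, w, \<cdot>) = 0\<close>. So uniqueness up to scaling is a linear statement
  about \<open>R\<close>: it suffices that a tensor singular along \<open>D\<close> with one prescribed component equal to zero vanishes.
  For a special 4-vector \<open>v\<^sub>0\<close>, part of \<open>D\<close> has a polynomial parametrisation, and restriction to one monomial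
  curve in it gives 335 independent linear conditions, as many as there are remaining components. Since \<open>D\<close>
  has the expected codimension at these points, they deform to the degeneracy loci of all 4-vectors close to
  \<open>v\<^sub>0\<close> (Brouwer), and compactness of the unit sphere of tensors gives the vanishing for these 4-vectors. The
  4-vectors for which it holds form a constructible set (Chevalley), which contains a Zariski open set because it
  contains a ball.
\<close>

text \<open>The number 335 is 336 - 1: curvature tensors on an n-dimensional space have dimension
  n^2(n^2 - 1)/12, and the prescribed component removes the freedom of scaling. The obstacle is that
  the degeneracy locus of a general 4-vector has no usable parametrisation. The special 4-vector
  \<open>base_point\<close> is so sparse that, near the span of e_0 and e_1, the six equations of
  the rank two locus form a triangular system, solvable for six of the twelve coordinates of the
  Grassmannian. In these coordinates the equations themselves are coordinates, so the deformation
  needs only continuity and a fixed point. Being singular at the deformed points is linear in the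
  tensor and closed, whence the limit on the unit sphere. This yields a Euclidean ball only; the
  condition on the 4-vector quantifies over all tensors and, inside, over all degenerate frames, and
  each of these two quantifiers is one projection of a constructible set. One more open condition is
  imposed at the end: the Pfaffian is nonzero at a fixed frame. It makes Q a quadratic section, and
  it forces the prescribed component of the Pfaffian tensor to be nonzero, so that this component
  can serve for the scaling.\<close>

unbundle no fps_syntax


section \<open>Wedge products and alternating forms\<close>

text \<open>Only singletons I survive in the sum, because \<open>ext_vec x\<close> has no other
  coordinates. As \<open>wedges\<close> multiplies by one vector at a time from the left, its
  identities reduce to this expansion.\<close>

lemma wedge_ext_vec:
  "(ext_vec x \<and>\<^sub>e w) $ K = (\<Sum>i\<in>K. (-1) ^ card {j\<in>K - {i}. j < i} * x $ i * w $ (K - {i}))"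
proof -
  have ev: "ext_vec x $ I = (if \<exists>i. I = {i} then x $ (THE i. I = {i}) else 0)" for I
  proof (cases "\<exists>i. I = {i}")
    case True
    then obtain i where "I = {i}" by blast
    then show ?thesis by (simp add: ext_vec_def)
  qed (auto simp: ext_vec_def)
  let ?f = "\<lambda>I. (-1) ^ card {(i, j). i \<in> I \<and> j \<in> K - I \<and> j < i} * ext_vec x $ I * w $ (K - I)"
  have "(ext_vec x \<and>\<^sub>e w) $ K = sum ?f (Pow K)"
    by (simp add: wedge_def)
  also have "\<dots> = sum ?f ((\<lambda>i. {i}) ` K)"
    by (rule sum.mono_neutral_right) (auto simp: ev)
  also have "\<dots> = (\<Sum>i\<in>K. ?f {i})"
    by (subst sum.reindex) (auto simp: inj_on_def)
  also have "\<dots> = (\<Sum>i\<in>K. (-1) ^ card {j\<in>K - {i}. j < i} * x $ i * w $ (K - {i}))"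
  proof (rule sum.cong)
    fix i assume "i \<in> K"
    have "{(a, j). a \<in> {i} \<and> j \<in> K - {i} \<and> j < a} = Pair i ` {j\<in>K - {i}. j < i}" by auto
    then have "card {(a, j). a \<in> {i} \<and> j \<in> K - {i} \<and> j < a} = card {j\<in>K - {i}. j < i}"
      by (simp add: card_image inj_on_def)
    then show "?f {i} = (-1) ^ card {j\<in>K - {i}. j < i} * x $ i * w $ (K - {i})"
      by (simp add: ev)
  qed simp
  finally show ?thesis .
qed

lemma wedge_ext_vec_add: "ext_vec (x + y) \<and>\<^sub>e w = (ext_vec x \<and>\<^sub>e w) + (ext_vec y \<and>\<^sub>e w)"
  by (simp add: vec_eq_iff wedge_ext_vec algebra_simps sum.distrib)

lemma wedge_ext_vec_scale: "ext_vec (c *s x) \<and>\<^sub>e w = c *s (ext_vec x \<and>\<^sub>e w)"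
  by (simp add: vec_eq_iff wedge_ext_vec algebra_simps sum_distrib_left)

lemma ext_vec_wedge_add: "ext_vec x \<and>\<^sub>e (w + z) = (ext_vec x \<and>\<^sub>e w) + (ext_vec x \<and>\<^sub>e z)"
  by (simp add: vec_eq_iff wedge_ext_vec algebra_simps sum.distrib)

lemma ext_vec_wedge_scale: "ext_vec x \<and>\<^sub>e (c *s w) = c *s (ext_vec x \<and>\<^sub>e w)"
  by (simp add: vec_eq_iff wedge_ext_vec algebra_simps sum_distrib_left)

lemma ext_vec_wedge_zero: "ext_vec x \<and>\<^sub>e 0 = 0"
  by (simp add: vec_eq_iff wedge_ext_vec)

text \<open>Deleting i and then j leaves the same index set as deleting j and then i, but with the
  opposite sign, so the double sum equals its own negative.\<close>

lemma wedge_ext_vec_self: "ext_vec x \<and>\<^sub>e (ext_vec x \<and>\<^sub>e w) = 0"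
proof -
  have "(ext_vec x \<and>\<^sub>e (ext_vec x \<and>\<^sub>e w)) $ K = 0" for K
  proof -
    let ?e = "\<lambda>K i. (-1 :: complex) ^ card {j\<in>K - {i}. j < i}"
    define f where "f i j = ?e K i * ?e (K - {i}) j * (x $ i * x $ j * w $ (K - {i} - {j}))" for i j
    have swap: "f j i = - f i j" if "i \<in> K" "j \<in> K" "i < j" for i j
    proof -
      \<comment> \<open>When j is removed first, the smaller index i is still present and
        contributes one more inversion.\<close>
      have "{a \<in> K - {j}. a < j} = insert i {a \<in> K - {i} - {j}. a < j}" using that by auto
      then have a: "?e K j = - ?e (K - {i}) j" by simp
      have b: "{a \<in> K - {j} - {i}. a < i} = {a \<in> K - {i}. a < i}" using that by auto
      have c: "?e (K - {j}) i = ?e K i" unfolding b ..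
      have d: "K - {j} - {i} = K - {i} - {j}" by auto
      show ?thesis unfolding f_def a c unfolding d by simp
    qed
    have anti: "f j i = - f i j" if "i \<in> K" "j \<in> K - {i}" for i j
      using swap[of i j] swap[of j i] that by (cases "i < j") auto
    have "(ext_vec x \<and>\<^sub>e (ext_vec x \<and>\<^sub>e w)) $ K = (\<Sum>i\<in>K. \<Sum>j\<in>K - {i}. f i j)"
      by (simp add: wedge_ext_vec f_def sum_distrib_left algebra_simps)
    also have "\<dots> = (\<Sum>i\<in>K. \<Sum>j\<in>K. if j = i then 0 else f i j)"
      by (intro sum.cong refl sum.mono_neutral_cong_left) auto
    finally have 1: "(ext_vec x \<and>\<^sub>e (ext_vec x \<and>\<^sub>e w)) $ K = (\<Sum>i\<in>K. \<Sum>j\<in>K. if j = i then 0 else f i j)" (is "?S = ?T") .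
    have "?T = (\<Sum>j\<in>K. \<Sum>i\<in>K. if j = i then 0 else f i j)" by (rule sum.swap)
    also have "\<dots> = (\<Sum>j\<in>K. \<Sum>i\<in>K. - (if i = j then 0 else f j i))"
    proof (intro sum.cong refl)
      fix i j assume "j \<in> K" "i \<in> K"
      then show "(if j = i then 0 else f i j) = - (if i = j then 0 else f j i)"
        using anti[of i j] by auto
    qed
    also have "\<dots> = - ?T" by (simp add: sum_negf)
    finally show ?thesis using 1 by simp
  qed
  then show ?thesis by (simp add: vec_eq_iff)
qed

lemma wedge_ext_vec_swap: "ext_vec x \<and>\<^sub>e (ext_vec y \<and>\<^sub>e w) = - (ext_vec y \<and>\<^sub>e (ext_vec x \<and>\<^sub>e w))"
proof -
  have "ext_vec (x + y) \<and>\<^sub>e (ext_vec (x + y) \<and>\<^sub>e w) = 0" by (rule wedge_ext_vec_self)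
  then show ?thesis
    by (simp add: wedge_ext_vec_add ext_vec_wedge_add wedge_ext_vec_self eq_neg_iff_add_eq_0 add.commute)
qed

lemma wedges_Nil [simp]: "wedges [] = ext_one" by (simp add: wedges_def)
lemma wedges_Cons: "wedges (x # xs) = ext_vec x \<and>\<^sub>e wedges xs" by (simp add: wedges_def)

lemma wedges_update_add:
  "wedges (xs @ (x + y) # ys) = wedges (xs @ x # ys) + wedges (xs @ y # ys)"
  by (induction xs) (simp_all add: wedges_Cons wedge_ext_vec_add ext_vec_wedge_add)

lemma wedges_update_scale: "wedges (xs @ (c *s x) # ys) = c *s wedges (xs @ x # ys)"
  by (induction xs) (simp_all add: wedges_Cons wedge_ext_vec_scale ext_vec_wedge_scale)

lemma wedges_repeat_Cons: "wedges (x # ys @ x # zs) = 0"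
proof (induction ys)
  case Nil then show ?case by (simp add: wedges_Cons wedge_ext_vec_self)
next
  case (Cons y ys)
  have "wedges (x # (y # ys) @ x # zs) = - (ext_vec y \<and>\<^sub>e wedges (x # ys @ x # zs))"
    by (simp add: wedges_Cons wedge_ext_vec_swap[of x y])
  then show ?case by (simp add: Cons ext_vec_wedge_zero)
qed

lemma wedges_repeat: "wedges (xs @ x # ys @ x # zs) = 0"
  by (induction xs) (simp_all add: wedges_Cons ext_vec_wedge_zero wedges_repeat_Cons[simplified wedges_Cons])

text \<open>The sign of e_I wedged with e_J for J the complement of I; with it, the top coefficient
  of a product becomes a signed pairing of complementary coordinates.\<close>

definition wsign :: "8 set \<Rightarrow> complex" where
  "wsign I = (-1) ^ card {(i, j). i \<in> I \<and> j \<in> - I \<and> j < i}"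

lemma wsign_sq [simp]: "wsign I * wsign I = 1"
  by (simp add: wsign_def flip: power_add mult_2)

lemma top_coeff_wedge: "top_coeff (v \<and>\<^sub>e z) = (\<Sum>I\<in>UNIV. wsign I * v $ I * z $ (- I))"
  by (simp add: top_coeff_def wedge_def wsign_def Compl_eq_Diff_UNIV)

lemma top_coeff_add: "top_coeff (w + z) = top_coeff w + top_coeff z"
  and top_coeff_scale: "top_coeff (c *s w) = c * top_coeff w"
  and top_coeff_0 [simp]: "top_coeff 0 = 0"
  by (simp_all add: top_coeff_def)

text \<open>In an increasing list the first index lies below all later ones, so wedging with its
  vector from the left creates no inversion.\<close>

lemma wedges_axis:
  assumes "sorted_wrt (<) ks"
  shows "wedges (map (\<lambda>i. axis i 1) ks) $ K = (if K = set ks then 1 else 0)"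
  using assms
proof (induction ks arbitrary: K)
  case Nil then show ?case by (simp add: ext_one_def)
next
  case (Cons a ks)
  have "wedges (map (\<lambda>i. axis i 1) (a # ks)) $ K =
    (\<Sum>i\<in>K. if i = a then (-1) ^ card {j\<in>K - {a}. j < a} * (if K - {a} = set ks then 1 else 0) else 0)"
    unfolding list.map wedges_Cons wedge_ext_vec
    by (rule sum.cong) (use Cons in \<open>auto simp: axis_def\<close>)
  also have "\<dots> = (if a \<in> K \<and> K - {a} = set ks then (-1) ^ card {j\<in>K - {a}. j < a} else 0)"
    by (simp add: sum.delta)
  also have "\<dots> = (if a \<in> K \<and> K - {a} = set ks then 1 else 0)"
  proof (rule if_cong)
    assume "a \<in> K \<and> K - {a} = set ks"
    then have "{j\<in>K - {a}. j < a} = {}" using Cons(2) by auto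
    then show "(-1 :: complex) ^ card {j\<in>K - {a}. j < a} = 1" by (simp only: card.empty power_0)
  qed auto
  also have "(a \<in> K \<and> K - {a} = set ks) \<longleftrightarrow> K = set (a # ks)"
    using Cons(2) by auto
  finally show ?case .
qed

lemma volume_basis: "top_coeff (wedges (map (\<lambda>i. axis i 1) (sorted_list_of_set UNIV))) = 1"
  by (simp add: top_coeff_def wedges_axis)

text \<open>The common frame for the Pfaffian and the volume, which have to be compared. A tuple is
  a function on the naturals of which only the first n values count, so replacing an argument is a
  function update and permuting the arguments is a composition.\<close>

locale alternating_form =
  fixes n :: nat and G :: "(nat \<Rightarrow> V8) \<Rightarrow> complex"
  assumes cong: "(\<And>i. i < n \<Longrightarrow> x i = y i) \<Longrightarrow> G x = G y"
    and add: "i < n \<Longrightarrow> G (x(i := a + b)) = G (x(i := a)) + G (x(i := b))"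
    and scale: "i < n \<Longrightarrow> G (x(i := c *s a)) = c * G (x(i := a))"
    and repeat: "i < n \<Longrightarrow> j < n \<Longrightarrow> i \<noteq> j \<Longrightarrow> x i = x j \<Longrightarrow> G x = 0"
begin

lemma zero: "i < n \<Longrightarrow> x i = 0 \<Longrightarrow> G x = 0"
  using scale[of i x 0 0] fun_upd_triv[of x i] by auto

lemma transpose:
  assumes "i < n" "j < n" "i \<noteq> j"
  shows "G (x \<circ> Transposition.transpose i j) = - G x"
proof -
  let ?y = "\<lambda>a b. x(i := a, j := b)"
  let ?s = "x i + x j"
  have "G (?y ?s ?s) = 0" by (rule repeat[of i j]) (use assms in auto)
  moreover have "G (?y (x i) (x i)) = 0" "G (?y (x j) (x j)) = 0"
    by (rule repeat[of i j]; use assms in auto)+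
  moreover have "G (?y (a + a') b) = G (?y a b) + G (?y a' b)" for a a' b
    using add[of i "x(j := b)" a a'] assms by (simp add: fun_upd_twist)
  moreover have "G (?y a (b + b')) = G (?y a b) + G (?y a b')" for a b b'
    using add[of j "x(i := a)" b b'] assms by simp
  ultimately have "G (?y (x j) (x i)) = - G (?y (x i) (x j))"
    by (simp add: eq_neg_iff_add_eq_0 add.commute)
  moreover have "?y (x i) (x j) = x" by (rule ext) auto
  moreover have "?y (x j) (x i) = x \<circ> Transposition.transpose i j"
    using assms by (auto simp: fun_eq_iff Transposition.transpose_def)
  ultimately show ?thesis by simp
qed

lemma permute_zero:
  assumes "\<sigma> permutes {..<n}" "G x = 0"
  shows "G (x \<circ> \<sigma>) = 0"
  using assms(1) finite_lessThan assms(2)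
proof (induction arbitrary: x rule: permutes_induct)
  case id
  then show ?case by simp
next
  case (swap a b p)
  have "G (x \<circ> Transposition.transpose a b) = 0"
    using swap.prems swap.hyps transpose[of a b x] by (cases "a = b") auto
  from swap.IH[OF this] show ?case by (simp add: comp_assoc)
qed

text \<open>The arguments are expanded one at a time: the induction shifts the boundary k between
  arguments in the span and arguments still in S.\<close>

lemma vanishes_on_span:
  assumes "\<And>x. (\<And>i. i < n \<Longrightarrow> x i \<in> S) \<Longrightarrow> G x = 0"
    and "\<And>i. i < n \<Longrightarrow> x i \<in> vec.span S"
  shows "G x = 0"
proof -
  have "G x = 0" if "k \<le> n" "\<And>i. i < k \<Longrightarrow> x i \<in> vec.span S" "\<And>i. k \<le> i \<Longrightarrow> i < n \<Longrightarrow> x i \<in> S" for k x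
    using that
  proof (induction k arbitrary: x)
    case 0
    then show ?case using assms(1) by simp
  next
    case (Suc k)
    then have k: "k < n" by simp
    have "G (x(k := a)) = 0" if "a \<in> vec.span S" for a
      using that
    proof (induction a rule: vec.span_induct_alt)
      case base
      show ?case by (rule zero[OF k]) simp
    next
      case (step c a b)
      have "G (x(k := a)) = 0"
        using k Suc.prems step by (intro Suc.IH) auto
      with step show ?case by (simp only: add[OF k] scale[OF k] mult_zero_right add_0)
    qed
    from this[of "x k"] Suc.prems show ?case by simp
  qed
  from this[of n x] assms(2) show ?thesis by simp
qed

text \<open>By multilinearity the arguments may be taken from W and b. Without an argument from W
  they are either a permutation of b or contain a repetition. In the applications W consists of
  vectors that both of two compared forms annihilate, such as the rows of a frame.\<close>

lemma eq_zero:
  assumes "G b = 0" "vec.span (W \<union> b ` {..<n}) = UNIV"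
    and W: "\<And>x i. i < n \<Longrightarrow> x i \<in> W \<Longrightarrow> G x = 0"
  shows "G x = 0"
proof (rule vanishes_on_span)
  show "x i \<in> vec.span (W \<union> b ` {..<n})" for i by (simp add: assms)
  fix x assume x: "\<And>i. i < n \<Longrightarrow> x i \<in> W \<union> b ` {..<n}"
  show "G x = 0"
  proof (cases "\<exists>i<n. x i \<in> W")
    case True
    then show ?thesis using W by blast
  next
    case False
    then have "\<forall>i\<in>{..<n}. \<exists>k. k < n \<and> x i = b k" using x by fastforce
    then obtain f where f: "\<And>i. i < n \<Longrightarrow> f i < n \<and> x i = b (f i)"
      by (metis lessThan_iff)
    show ?thesis
    proof (cases "inj_on f {..<n}")
      case True
      \<comment> \<open>Extending f by the identity turns the injection of the first n indices into
        a permutation in the sense of \<open>permutes\<close>.\<close>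
      define \<sigma> where "\<sigma> i = (if i < n then f i else i)" for i
      have "f ` {..<n} = {..<n}"
        by (rule card_subset_eq) (use f True in \<open>auto simp: card_image\<close>)
      then have "bij_betw \<sigma> {..<n} {..<n}"
        using True by (auto simp: bij_betw_def \<sigma>_def inj_on_def image_def)
      then have "\<sigma> permutes {..<n}"
        by (rule bij_imp_permutes) (auto simp: \<sigma>_def)
      from permute_zero[OF this assms(1)] have "G (b \<circ> \<sigma>) = 0" .
      moreover have "G x = G (b \<circ> \<sigma>)" by (rule cong) (use f in \<open>auto simp: \<sigma>_def\<close>)
      ultimately show ?thesis by simp
    next
      case False
      then obtain i j where "i < n" "j < n" "i \<noteq> j" "f i = f j" by (auto simp: inj_on_def)
      then show ?thesis using f by (intro repeat[of i j]) auto
    qed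
  qed
qed

end

lemma upt_split: "i \<le> j \<Longrightarrow> j \<le> k \<Longrightarrow> [i..<k] = [i..<j] @ [j..<k]"
  by (metis le_add_diff_inverse upt_add_eq_append)

text \<open>With c = H b and d = G b the combination vanishes at b; \<open>eq_zero\<close> then
  shows that G and H are proportional.\<close>

lemma alternating_form_combine:
  assumes "alternating_form n G" "alternating_form n H"
  shows "alternating_form n (\<lambda>x. c * G x - d * H x)"
proof -
  interpret G: alternating_form n G by fact
  interpret H: alternating_form n H by fact
  show ?thesis
  proof
    show "c * G x - d * H x = c * G y - d * H y" if "\<And>i. i < n \<Longrightarrow> x i = y i" for x y
      using G.cong[of x y] H.cong[of x y] that by simp
  qed (simp_all add: G.add H.add G.scale H.scale G.repeat H.repeat algebra_simps)
qed

lemma map_upt_fun_upd: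
  assumes "i < n"
  shows "map (x(i := a)) [0..<n] = map x [0..<i] @ a # map x [Suc i..<n]"
proof -
  have "[0..<n] = [0..<i] @ i # [Suc i..<n]"
    using assms upt_split[of 0 i n] by (simp add: upt_conv_Cons)
  then show ?thesis by auto
qed

lemma alternating_form_volume: "alternating_form n (\<lambda>x. top_coeff (wedges (pre @ map x [0..<n] @ post)))"
proof
  fix x y :: "nat \<Rightarrow> V8" assume "\<And>i. i < n \<Longrightarrow> x i = y i"
  then have "map x [0..<n] = map y [0..<n]" by auto
  then show "top_coeff (wedges (pre @ map x [0..<n] @ post)) = top_coeff (wedges (pre @ map y [0..<n] @ post))"
    by (simp only:)
next
  fix i x a b c assume "i < n"
  show "top_coeff (wedges (pre @ map (x(i := a + b)) [0..<n] @ post)) =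
       top_coeff (wedges (pre @ map (x(i := a)) [0..<n] @ post)) +
       top_coeff (wedges (pre @ map (x(i := b)) [0..<n] @ post))"
    using wedges_update_add[of "pre @ map x [0..<i]"]
    by (simp add: map_upt_fun_upd[OF \<open>i < n\<close>] top_coeff_add)
  show "top_coeff (wedges (pre @ map (x(i := c *s a)) [0..<n] @ post)) =
       c * top_coeff (wedges (pre @ map (x(i := a)) [0..<n] @ post))"
    using wedges_update_scale[of "pre @ map x [0..<i]"]
    by (simp add: map_upt_fun_upd[OF \<open>i < n\<close>] top_coeff_scale)
next
  have *: "top_coeff (wedges (pre @ map x [0..<n] @ post)) = 0" if "i < j" "j < n" "x i = x j" for i j x
  proof -
    have "[0..<n] = [0..<i] @ i # [Suc i..<j] @ j # [Suc j..<n]"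
      using that upt_split[of 0 i n] upt_split[of "Suc i" j n] by (simp add: upt_conv_Cons)
    then have "pre @ map x [0..<n] @ post =
        (pre @ map x [0..<i]) @ x i # map x [Suc i..<j] @ x i # (map x [Suc j..<n] @ post)"
      using that by simp
    then show ?thesis by (simp only: wedges_repeat top_coeff_0)
  qed
  fix i j x assume "i < n" "j < n" "i \<noteq> j" "x i = (x j :: V8)"
  then show "top_coeff (wedges (pre @ map x [0..<n] @ post)) = 0"
    using *[of i j x] *[of j i x] by (cases "i < j") auto
qed

text \<open>Linearity is stated for the first argument; skewness carries it over to the
  second.\<close>

definition skew_bilinear :: "(V8 \<Rightarrow> V8 \<Rightarrow> complex) \<Rightarrow> bool" where
  "skew_bilinear f \<longleftrightarrow> (\<forall>x y z. f (x + y) z = f x z + f y z) \<and> (\<forall>c x z. f (c *s x) z = c * f x z) \<and>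
    (\<forall>x y. f y x = - f x y)"

lemma skew_bilinearD:
  assumes "skew_bilinear f"
  shows "f (x + y) z = f x z + f y z" "f (c *s x) z = c * f x z" "f y x = - f x y"
    "f z (x + y) = f z x + f z y" "f z (c *s x) = c * f z x" "f x x = 0" "f 0 x = 0" "f x 0 = 0"
proof -
  show 1: "f (x + y) z = f x z + f y z" "f (c *s x) z = c * f x z" and 2: "f y x = - f x y" for x y z c
    using assms unfolding skew_bilinear_def by blast+
  show "f z (x + y) = f z x + f z y" "f z (c *s x) = c * f z x"
    using 1(1)[of x y z] 1(2)[of c x z] 2[of z "x + y"] 2[of z x] 2[of z y] 2[of z "c *s x"] by simp_all
  show "f x x = 0" using 2[of x x] by simp
  show 3: "f 0 x = 0" using 1(2)[of 0 0 x] by simp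
  show "f x 0 = 0" using 2[of 0 x] 3 by simp
qed

text \<open>Every index occurs exactly once in each product, which makes the Pfaffian multilinear.\<close>

lemma alternating_form_pfaffian:
  assumes f: "skew_bilinear f"
  shows "alternating_form (2 * n) (\<lambda>x. pfaffian n (\<lambda>a b. f (x a) (x b)))"
proof
  let ?p = "\<lambda>\<sigma> x. \<Prod>i<n. f (x (\<sigma> (2 * i))) (x (\<sigma> (2 * i + 1)))"
  fix x y :: "nat \<Rightarrow> V8" assume xy: "\<And>i. i < 2 * n \<Longrightarrow> x i = y i"
  have "?p \<sigma> x = ?p \<sigma> y" if "\<sigma> permutes {..<2 * n}" for \<sigma>
  proof (rule prod.cong)
    fix i assume "i \<in> {..<n}"
    then have "\<sigma> (2 * i) < 2 * n" "\<sigma> (2 * i + 1) < 2 * n"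
      using permutes_in_image[OF that, of "2 * i"] permutes_in_image[OF that, of "2 * i + 1"] by auto
    then show "f (x (\<sigma> (2 * i))) (x (\<sigma> (2 * i + 1))) = f (y (\<sigma> (2 * i))) (y (\<sigma> (2 * i + 1)))"
      using xy by simp
  qed simp
  then show "pfaffian n (\<lambda>a b. f (x a) (x b)) = pfaffian n (\<lambda>a b. f (y a) (y b))"
    by (simp add: pfaffian_def)
next
  let ?p = "\<lambda>\<sigma> x. \<Prod>i<n. f (x (\<sigma> (2 * i))) (x (\<sigma> (2 * i + 1)))"
  fix i x a b c assume i: "i < 2 * n"
  have "?p \<sigma> (x(i := a + b)) = ?p \<sigma> (x(i := a)) + ?p \<sigma> (x(i := b)) \<and> ?p \<sigma> (x(i := c *s a)) = c * ?p \<sigma> (x(i := a))"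
    if \<sigma>: "\<sigma> permutes {..<2 * n}" for \<sigma>
  proof -
    \<comment> \<open>j is the position at which \<sigma> takes the value i, so
      \<open>j div 2\<close> is the number of the one factor that contains x i.\<close>
    define j where "j = inv \<sigma> i"
    have j: "\<sigma> j = i" "j < 2 * n"
      using \<sigma> i permutes_in_image[OF permutes_inv[OF \<sigma>], of i] by (auto simp: j_def permutes_inverses)
    have eq: "\<sigma> l = i \<longleftrightarrow> l = j" for l
      using j permutes_inj[OF \<sigma>] by (auto simp: inj_def)
    define k where "k = j div 2"
    have k: "k < n" using j by (auto simp: k_def)
    have ne: "\<sigma> (2 * l) \<noteq> i" "\<sigma> (2 * l + 1) \<noteq> i" if "l \<noteq> k" for l
      unfolding eq using that by (auto simp: k_def)
    have fac: "?p \<sigma> (x(i := z)) = f ((x(i := z)) (\<sigma> (2 * k))) ((x(i := z)) (\<sigma> (2 * k + 1))) *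
       (\<Prod>l\<in>{..<n} - {k}. f (x (\<sigma> (2 * l))) (x (\<sigma> (2 * l + 1))))" for z
    proof -
      have "(\<Prod>l\<in>{..<n} - {k}. f ((x(i := z)) (\<sigma> (2 * l))) ((x(i := z)) (\<sigma> (2 * l + 1)))) =
          (\<Prod>l\<in>{..<n} - {k}. f (x (\<sigma> (2 * l))) (x (\<sigma> (2 * l + 1))))"
        by (rule prod.cong) (use ne in auto)
      then show ?thesis using k by (subst prod.remove[of _ k]) auto
    qed
    have "j = 2 * k \<or> j = 2 * k + 1" by (auto simp: k_def)
    then show ?thesis
    proof
      assume "j = 2 * k"
      then have "(x(i := z)) (\<sigma> (2 * k)) = z" "(x(i := z)) (\<sigma> (2 * k + 1)) = x (\<sigma> (2 * k + 1))" for z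
        using eq[of "2 * k"] eq[of "2 * k + 1"] by auto
      then show ?thesis unfolding fac by (simp add: skew_bilinearD(1,2)[OF f] algebra_simps)
    next
      assume "j = 2 * k + 1"
      then have "(x(i := z)) (\<sigma> (2 * k)) = x (\<sigma> (2 * k))" "(x(i := z)) (\<sigma> (2 * k + 1)) = z" for z
        using eq[of "2 * k"] eq[of "2 * k + 1"] by auto
      then show ?thesis unfolding fac by (simp add: skew_bilinearD(4,5)[OF f] algebra_simps)
    qed
  qed
  then show "pfaffian n (\<lambda>k l. f ((x(i := a + b)) k) ((x(i := a + b)) l)) =
      pfaffian n (\<lambda>k l. f ((x(i := a)) k) ((x(i := a)) l)) + pfaffian n (\<lambda>k l. f ((x(i := b)) k) ((x(i := b)) l))"
    and "pfaffian n (\<lambda>k l. f ((x(i := c *s a)) k) ((x(i := c *s a)) l)) =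
      c * pfaffian n (\<lambda>k l. f ((x(i := a)) k) ((x(i := a)) l))"
    unfolding pfaffian_def
    by (simp_all add: distrib_left sum.distrib add_divide_distrib sum_distrib_left mult.left_commute)
next
  fix i j and x :: "nat \<Rightarrow> V8" assume ij: "i < 2 * n" "j < 2 * n" "i \<noteq> j" "x i = x j"
  let ?g = "\<lambda>\<sigma>. of_int (sign \<sigma>) * (\<Prod>i<n. f (x (\<sigma> (2 * i))) (x (\<sigma> (2 * i + 1))))"
  let ?t = "Transposition.transpose i j"
  let ?P = "{\<sigma>. \<sigma> permutes {..<2 * n}}"
  have t: "?t permutes {..<2 * n}" using ij by (intro permutes_swap_id) auto
  have xt: "x (?t k) = x k" for k using ij by (auto simp: Transposition.transpose_def)
  \<comment> \<open>Left composition with the transposition permutes the summands. It preserves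
    every product, because x i = x j, and reverses every sign.\<close>
  have "sum ?g ?P = (\<Sum>\<sigma>\<in>?P. ?g (?t \<circ> \<sigma>))"
    by (rule setum_permutations_compose_left[OF t])
  also have "\<dots> = (\<Sum>\<sigma>\<in>?P. - ?g \<sigma>)"
  proof (rule sum.cong)
    fix \<sigma> assume "\<sigma> \<in> ?P"
    then have "sign (?t \<circ> \<sigma>) = - sign \<sigma>"
      using ij by (simp add: sign_compose permutes_imp_permutation[OF finite_lessThan] permutation_swap_id sign_swap_id)
    then show "?g (?t \<circ> \<sigma>) = - ?g \<sigma>" by (simp add: xt)
  qed simp
  finally show "pfaffian n (\<lambda>a b. f (x a) (x b)) = 0"
    by (simp add: pfaffian_def sum_negf)
qed

text \<open>In every summand x i occurs in some factor, on the left or on the right.\<close>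

lemma pfaffian_radical:
  assumes f: "skew_bilinear f" and "i < 2 * n" "\<And>y. f (x i) y = 0"
  shows "pfaffian n (\<lambda>a b. f (x a) (x b)) = 0"
proof -
  have "of_int (sign \<sigma>) * (\<Prod>k<n. f (x (\<sigma> (2 * k))) (x (\<sigma> (2 * k + 1)))) = 0"
    if \<sigma>: "\<sigma> permutes {..<2 * n}" for \<sigma>
  proof -
    define j where "j = inv \<sigma> i"
    have j: "\<sigma> j = i" "j < 2 * n"
      using \<sigma> assms permutes_in_image[OF permutes_inv[OF \<sigma>], of i] by (auto simp: j_def permutes_inverses)
    have "j = 2 * (j div 2) \<or> j = 2 * (j div 2) + 1" by auto
    then have "f (x (\<sigma> (2 * (j div 2)))) (x (\<sigma> (2 * (j div 2) + 1))) = 0"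
      using assms(3) j skew_bilinearD(3)[OF f] by (metis neg_0_equal_iff_equal)
    then have "(\<Prod>k<n. f (x (\<sigma> (2 * k))) (x (\<sigma> (2 * k + 1)))) = 0"
      using j by (intro prod_zero) (auto intro!: bexI[of _ "j div 2"])
    then show ?thesis by (simp only: mult_zero_right)
  qed
  then have "(\<Sum>\<sigma> | \<sigma> permutes {..<2 * n}. of_int (sign \<sigma>) * (\<Prod>k<n. f (x (\<sigma> (2 * k))) (x (\<sigma> (2 * k + 1))))) = 0"
    by (intro sum.neutral) blast
  then show ?thesis by (simp only: pfaffian_def div_0)
qed

text \<open>Removing the least index a costs no inversion, whereas the removal of any other index
  also passes a. Hence the minus sign in front of the expansion over K.\<close>

lemma wedge_ext_vec_insert_min:
  assumes "\<And>j. j \<in> K \<Longrightarrow> a < j"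
  shows "(ext_vec x \<and>\<^sub>e w) $ (insert a K) = x $ a * w $ K -
    (\<Sum>i\<in>K. (-1) ^ card {j\<in>K - {i}. j < i} * x $ i * w $ (insert a (K - {i})))"
proof -
  have a: "a \<notin> K" using assms by auto
  have "\<not> j < a" if "j \<in> K" for j using assms[OF that] by auto
  then have 1: "{j \<in> K. j < a} = {}" "insert a K - {a} = K" using a by auto
  have 2: "(-1) ^ card {j \<in> insert a K - {i}. j < i} * x $ i * w $ (insert a K - {i}) =
     - ((-1) ^ card {j\<in>K - {i}. j < i} * x $ i * w $ (insert a (K - {i})))" if "i \<in> K" for i
  proof -
    have "{j \<in> insert a K - {i}. j < i} = insert a {j\<in>K - {i}. j < i}" "insert a K - {i} = insert a (K - {i})"
      using that assms[OF that] by auto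
    then show ?thesis using a by simp
  qed
  show ?thesis
  proof -
    have "(ext_vec x \<and>\<^sub>e w) $ (insert a K) = (-1) ^ card {j \<in> insert a K - {a}. j < a} * x $ a * w $ (insert a K - {a}) +
      (\<Sum>i\<in>K. (-1) ^ card {j \<in> insert a K - {i}. j < i} * x $ i * w $ (insert a K - {i}))"
      unfolding wedge_ext_vec using a by (intro sum.insert) auto
    also have "(\<Sum>i\<in>K. (-1) ^ card {j \<in> insert a K - {i}. j < i} * x $ i * w $ (insert a K - {i})) =
      (\<Sum>i\<in>K. - ((-1) ^ card {j\<in>K - {i}. j < i} * x $ i * w $ (insert a (K - {i}))))"
      by (rule sum.cong[OF refl 2])
    finally show ?thesis unfolding 1 by (simp only: sum_negf card.empty) simp
  qed
qed

text \<open>Laplace expansion of a 4 by 4 minor along its first two rows. It makes all later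
  evaluations of \<open>psi\<close> at explicit frames a matter of rewriting.\<close>

lemma wedges4:
  assumes "a < b" "b < c" "c < (d :: 8)"
  shows "wedges [u, w, x, y] $ {a, b, c, d} =
    (u $ a * w $ b - u $ b * w $ a) * (x $ c * y $ d - x $ d * y $ c)
    - (u $ a * w $ c - u $ c * w $ a) * (x $ b * y $ d - x $ d * y $ b)
    + (u $ a * w $ d - u $ d * w $ a) * (x $ b * y $ c - x $ c * y $ b)
    + (u $ b * w $ c - u $ c * w $ b) * (x $ a * y $ d - x $ d * y $ a)
    - (u $ b * w $ d - u $ d * w $ b) * (x $ a * y $ c - x $ c * y $ a)
    + (u $ c * w $ d - u $ d * w $ c) * (x $ a * y $ b - x $ b * y $ a)"
proof -
  have e1: "(ext_vec x \<and>\<^sub>e w) $ {p} = x $ p * w $ {}" for x w and p :: 8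
    by (simp add: wedge_ext_vec)
  have e2: "(ext_vec x \<and>\<^sub>e w) $ {p, q} = x $ p * w $ {q} - x $ q * w $ {p}" if "p < q" for x w and p q :: 8
    using that by (subst wedge_ext_vec_insert_min) auto
  have e3: "(ext_vec x \<and>\<^sub>e w) $ {p, q, r} = x $ p * w $ {q, r} - x $ q * w $ {p, r} + x $ r * w $ {p, q}"
    if "p < q" "q < r" for x w and p q r :: 8
  proof -
    have s: "{q, r} - {q} = {r}" "{q, r} - {r} = {q}" "{j \<in> {r}. j < q} = {}" "{j \<in> {q}. j < r} = {q}" "q \<noteq> r"
      using that by auto
    have "(ext_vec x \<and>\<^sub>e w) $ (insert p {q, r}) = x $ p * w $ {q, r} -
      (\<Sum>i\<in>{q, r}. (-1) ^ card {j\<in>{q, r} - {i}. j < i} * x $ i * w $ (insert p ({q, r} - {i})))"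
      by (rule wedge_ext_vec_insert_min) (use that in auto)
    also have "(\<Sum>i\<in>{q, r}. (-1) ^ card {j\<in>{q, r} - {i}. j < i} * x $ i * w $ (insert p ({q, r} - {i})))
      = x $ q * w $ {p, r} - x $ r * w $ {p, q}"
    proof -
      have "sum f {q, r} = f q + f r" for f :: "8 \<Rightarrow> complex"
        using s(5) by simp
      then show ?thesis by (simp only: s card.empty power_0) simp
    qed
    finally show ?thesis by simp
  qed
  have e4: "(ext_vec x \<and>\<^sub>e w) $ {a, b, c, d} = x $ a * w $ {b, c, d} - x $ b * w $ {a, c, d}
      + x $ c * w $ {a, b, d} - x $ d * w $ {a, b, c}" for x w
  proof -
    have s: "{b, c, d} - {b} = {c, d}" "{b, c, d} - {c} = {b, d}" "{b, c, d} - {d} = {b, c}"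
      "{j \<in> {c, d}. j < b} = {}" "{j \<in> {b, d}. j < c} = {b}" "{j \<in> {b, c}. j < d} = {b, c}"
      "b \<noteq> c" "b \<noteq> d" "c \<noteq> d"
      using assms by auto
    have k: "card {b, c} = 2" using s by simp
    have "(ext_vec x \<and>\<^sub>e w) $ (insert a {b, c, d}) = x $ a * w $ {b, c, d} -
      (\<Sum>i\<in>{b, c, d}. (-1) ^ card {j\<in>{b, c, d} - {i}. j < i} * x $ i * w $ (insert a ({b, c, d} - {i})))"
      by (rule wedge_ext_vec_insert_min) (use assms in auto)
    also have "(\<Sum>i\<in>{b, c, d}. (-1) ^ card {j\<in>{b, c, d} - {i}. j < i} * x $ i * w $ (insert a ({b, c, d} - {i})))
      = x $ b * w $ {a, c, d} - x $ c * w $ {a, b, d} + x $ d * w $ {a, b, c}"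
    proof -
      have "sum f {b, c, d} = f b + f c + f d" for f :: "8 \<Rightarrow> complex"
        using s(7-9) by (simp add: add.assoc)
      then show ?thesis by (simp only: s k card.empty power_0) simp
    qed
    finally show ?thesis by simp
  qed
  have l: "a < c" "a < d" "b < d" using assms by auto
  show ?thesis
    by (simp add: wedges_Cons e1 e2 e3 e4 l assms ext_one_def) (simp add: algebra_simps)
qed

section \<open>The Pfaffian\<close>

text \<open>Exactly 8 = 2^2 * 2! permutations preserve the partition into the pairs {2, 3} and {4,
  5}; each contributes the same product, and all others hit a zero entry.\<close>

lemma sum_permutations_4_block:
  fixes a :: "nat \<Rightarrow> nat \<Rightarrow> complex"
  assumes skew: "\<And>i j. a j i = - a i j"
    and z: "a 2 4 = 0" "a 2 5 = 0" "a 3 4 = 0" "a 3 5 = 0"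
  shows "(\<Sum>r | r permutes {2, 3, 4, 5}. of_int (sign r) * (a (r 2) (r 3) * a (r 4) (r 5))) = 8 * (a 2 3 * a 4 5)"
proof -
  have z': "a 4 2 = 0" "a 5 2 = 0" "a 4 3 = 0" "a 5 3 = 0" "a 3 2 = - a 2 3" "a 5 4 = - a 4 5"
    using z skew[of 2 4] skew[of 2 5] skew[of 3 4] skew[of 3 5] skew[of 2 3] skew[of 4 5] by auto
  have perm: "permutation (Transposition.transpose i j)" for i j :: nat by (rule permutation_swap_id)
  show ?thesis
    by (simp add: sum_over_permutations_insert sign_compose permutation_compose perm sign_swap_id z z'
      permutation_id sign_id)
qed

text \<open>For a block diagonal form only the 48 = 2^3 * 3! permutations that preserve the three
  pairs contribute, and 48 is the normalising denominator of the Pfaffian.\<close>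

lemma pfaffian_3_block:
  fixes a :: "nat \<Rightarrow> nat \<Rightarrow> complex"
  assumes skew: "\<And>i j. a j i = - a i j"
    and z: "a 0 2 = 0" "a 0 3 = 0" "a 0 4 = 0" "a 0 5 = 0" "a 1 2 = 0" "a 1 3 = 0" "a 1 4 = 0" "a 1 5 = 0"
     "a 2 4 = 0" "a 2 5 = 0" "a 3 4 = 0" "a 3 5 = 0"
  shows "pfaffian 3 a = a 0 1 * a 2 3 * a 4 5"
proof -
  have z': "a 2 0 = 0" "a 3 0 = 0" "a 4 0 = 0" "a 5 0 = 0" "a 2 1 = 0" "a 3 1 = 0" "a 4 1 = 0" "a 5 1 = 0"
     "a 4 2 = 0" "a 5 2 = 0" "a 4 3 = 0" "a 5 3 = 0"
     using z skew[of 0 2] skew[of 0 3] skew[of 0 4] skew[of 0 5] skew[of 1 2] skew[of 1 3] skew[of 1 4] skew[of 1 5]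
      skew[of 2 4] skew[of 2 5] skew[of 3 4] skew[of 3 5] by auto
  have s: "a 1 0 = - a 0 1" "a 3 2 = - a 2 3" "a 5 4 = - a 4 5" by (rule skew)+
  have d: "a i i = 0" for i using skew[of i i] by simp
  let ?tr = "Transposition.transpose :: nat \<Rightarrow> nat \<Rightarrow> nat \<Rightarrow> nat"
  \<comment> \<open>A permutation of six indices is the transposition of 0 and b, after that of 1
    and c, after a permutation r of {2, 3, 4, 5}. Here b is the image of 0, and (b, c) determines
    the images of 0 and 1, so the first factor does not depend on r.\<close>
  define F where "F \<sigma> = of_int (sign \<sigma>) * (a (\<sigma> 0) (\<sigma> 1) * (a (\<sigma> 2) (\<sigma> 3) * a (\<sigma> 4) (\<sigma> 5)))" for \<sigma>
  let ?R = "{r. r permutes {2, 3, 4, 5::nat}}"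
  have F: "(\<Sum>r\<in>?R. F (?tr 0 b \<circ> (?tr 1 c \<circ> r))) =
     of_int (sign (?tr 0 b \<circ> ?tr 1 c)) * (a ((?tr 0 b \<circ> ?tr 1 c) 0) ((?tr 0 b \<circ> ?tr 1 c) 1) *
     (\<Sum>r\<in>?R. of_int (sign r) * (a ((?tr 0 b \<circ> ?tr 1 c) (r 2)) ((?tr 0 b \<circ> ?tr 1 c) (r 3)) *
        a ((?tr 0 b \<circ> ?tr 1 c) (r 4)) ((?tr 0 b \<circ> ?tr 1 c) (r 5)))))" (is "_ = ?rhs") for b c
  proof -
    have "F (?tr 0 b \<circ> (?tr 1 c \<circ> r)) =
      of_int (sign (?tr 0 b \<circ> ?tr 1 c)) * (a ((?tr 0 b \<circ> ?tr 1 c) 0) ((?tr 0 b \<circ> ?tr 1 c) 1) *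
       (of_int (sign r) * (a ((?tr 0 b \<circ> ?tr 1 c) (r 2)) ((?tr 0 b \<circ> ?tr 1 c) (r 3)) *
        a ((?tr 0 b \<circ> ?tr 1 c) (r 4)) ((?tr 0 b \<circ> ?tr 1 c) (r 5)))))" if "r \<in> ?R" for r
    proof -
      have r: "r permutes {2, 3, 4, 5}" using that by simp
      have "r 0 = 0" "r 1 = 1" using permutes_not_in[OF r] by auto
      moreover have "sign (?tr 0 b \<circ> ?tr 1 c \<circ> r) = sign (?tr 0 b \<circ> ?tr 1 c) * sign r"
        using permutes_imp_permutation[OF _ r] by (intro sign_compose permutation_compose permutation_swap_id) auto
      ultimately show ?thesis by (simp add: F_def comp_assoc)
    qed
    then show ?thesis by (simp add: sum_distrib_left)
  qed
  have F0: "(\<Sum>r\<in>?R. F (?tr 0 b \<circ> (?tr 1 c \<circ> r))) = 0"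
    if "a ((?tr 0 b \<circ> ?tr 1 c) 0) ((?tr 0 b \<circ> ?tr 1 c) 1) = 0" for b c
    unfolding F that by simp
  have F1: "(\<Sum>r\<in>?R. F (?tr 0 b \<circ> (?tr 1 c \<circ> r))) =
     of_int (sign (?tr 0 b \<circ> ?tr 1 c)) * (a ((?tr 0 b \<circ> ?tr 1 c) 0) ((?tr 0 b \<circ> ?tr 1 c) 1) *
     (8 * (a ((?tr 0 b \<circ> ?tr 1 c) 2) ((?tr 0 b \<circ> ?tr 1 c) 3) * a ((?tr 0 b \<circ> ?tr 1 c) 4) ((?tr 0 b \<circ> ?tr 1 c) 5))))"
    if "\<forall>i\<in>{2,3}. \<forall>j\<in>{4,5}. a ((?tr 0 b \<circ> ?tr 1 c) i) ((?tr 0 b \<circ> ?tr 1 c) j) = 0" for b c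
    unfolding F using that by (subst sum_permutations_4_block) (rule skew refl | simp)+
  have sg: "sign (?tr 0 b \<circ> ?tr 1 c) = (if b = 0 then 1 else -1) * (if c = 1 then 1 else -1)" for b c
    by (simp add: sign_compose permutation_swap_id sign_swap_id)
  define S where "S b c = (\<Sum>r\<in>?R. F (?tr 0 b \<circ> (?tr 1 c \<circ> r)))" for b c
  let ?X = "a 0 1 * (a 2 3 * a 4 5)"
  have e: "{..<2 * 3} = insert 0 (insert 1 {2, 3, 4, 5::nat})" by auto
  have "(\<Sum>\<sigma> | \<sigma> permutes {..<2 * 3}. F \<sigma>) = (\<Sum>b\<in>insert 0 (insert 1 {2, 3, 4, 5}). \<Sum>c\<in>insert 1 {2, 3, 4, 5}. S b c)"
    unfolding e S_def by (subst sum_over_permutations_insert, simp, simp, subst sum_over_permutations_insert, simp, simp, rule refl)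
  \<comment> \<open>These six of the thirty pairs (b, c) send {0, 1} onto a block; for the other 24
    the first factor is zero.\<close>
  moreover have "S 0 1 = 8 * ?X" "S 1 1 = 8 * ?X" "S 2 3 = 8 * ?X" "S 3 2 = 8 * ?X" "S 4 5 = 8 * ?X" "S 5 4 = 8 * ?X"
    unfolding S_def by (subst F1; simp add: sg sign_swap_id z z' s d Transposition.transpose_def del: One_nat_def)+
  moreover have "S 0 2 = 0" "S 0 3 = 0" "S 0 4 = 0" "S 0 5 = 0" "S 1 2 = 0" "S 1 3 = 0" "S 1 4 = 0" "S 1 5 = 0" "S 2 1 = 0" "S 2 2 = 0" "S 2 4 = 0" "S 2 5 = 0" "S 3 1 = 0" "S 3 3 = 0" "S 3 4 = 0" "S 3 5 = 0" "S 4 1 = 0" "S 4 2 = 0" "S 4 3 = 0" "S 4 4 = 0" "S 5 1 = 0" "S 5 2 = 0" "S 5 3 = 0" "S 5 5 = 0"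
    unfolding S_def by (rule F0; simp add: z z' d Transposition.transpose_def del: One_nat_def)+
  ultimately have "(\<Sum>\<sigma> | \<sigma> permutes {..<2 * 3}. F \<sigma>) = 48 * ?X"
    by simp
  moreover have "(\<Prod>i<(3 :: nat). a (\<sigma> (2 * i)) (\<sigma> (2 * i + 1))) = a (\<sigma> 0) (\<sigma> 1) * (a (\<sigma> 2) (\<sigma> 3) * a (\<sigma> 4) (\<sigma> 5))"
    for \<sigma> :: "nat \<Rightarrow> nat" proof -
    have "{..<3 :: nat} = {0, 1, 2}" by auto
    then show ?thesis by simp
  qed
  ultimately show ?thesis unfolding pfaffian_def F_def by (simp add: fact_numeral)
qed

section \<open>Radicals, ranks and bases adapted to a frame\<close>

abbreviation volume :: "V8 \<Rightarrow> V8 \<Rightarrow> (nat \<Rightarrow> V8) \<Rightarrow> complex" where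
  "volume u w x \<equiv> top_coeff (wedges ([u, w] @ map x [0..<6]))"

definition radical :: "(V8 \<Rightarrow> V8 \<Rightarrow> complex) \<Rightarrow> V8 set" where
  "radical f = {x. \<forall>y. f x y = 0}"

lemma sum_scaled_axis: "(\<Sum>i\<in>UNIV. x $ i *s axis i 1) = (x :: V8)"
  by (simp add: vec_eq_iff axis_def if_distrib cong: if_cong)

lemma skew_bilinear_sum_left:
  assumes "skew_bilinear f"
  shows "f x y = (\<Sum>i\<in>UNIV. x $ i * f (axis i 1) y)"
proof -
  note D = skew_bilinearD[OF assms]
  have "f (\<Sum>i\<in>A. g i) y = (\<Sum>i\<in>A. f (g i) y)" if "finite A" for A and g :: "8 \<Rightarrow> V8"
    using that by (induction A) (auto simp: D(1,7))
  from this[of UNIV "\<lambda>i. x $ i *s axis i 1"] show ?thesis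
    by (simp add: sum_scaled_axis D(2))
qed

lemma radical_axis:
  assumes f: "skew_bilinear f" and "\<And>j. f x (axis j 1) = 0"
  shows "x \<in> radical f"
proof -
  have "f y x = 0" for y
    using assms(2) skew_bilinearD(3)[OF f, of _ x] by (subst skew_bilinear_sum_left[OF f]) simp
  then show ?thesis using skew_bilinearD(3)[OF f, of _ x] by (simp add: radical_def)
qed

lemma rank_matrix_le:
  fixes a :: "nat \<Rightarrow> V8" and b :: "nat \<Rightarrow> 8 \<Rightarrow> complex"
  assumes "\<And>i. row i A = (\<Sum>k<r. b k i *s a k)"
  shows "rank A \<le> r"
proof -
  have "rows A \<subseteq> vec.span (a ` {..<r})"
  proof -
    have "row i A \<in> vec.span (a ` {..<r})" for i
      unfolding assms by (intro vec.span_sum vec.span_scale vec.span_base) auto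
    then show ?thesis by (auto simp: rows_def)
  qed
  then have "vec.dim (rows A) \<le> card (a ` {..<r})" by (rule vec.dim_le_card) simp
  also have "\<dots> \<le> r" using card_image_le[of "{..<r}" a] by simp
  finally show ?thesis by (simp add: row_rank_def_gen)
qed

lemma rank_2_iff:
  fixes M :: frame
  shows "rank M = 2 \<longleftrightarrow> (row 1 M \<noteq> row 2 M \<and> vec.independent {row 1 M, row 2 M})"
proof -
  have rows: "rows M = {row 1 M, row 2 M}"
    by (auto simp: rows_def) (metis exhaust_2)
  show ?thesis
  proof
    assume "rank M = 2"
    then have d: "vec.dim {row 1 M, row 2 M} = 2" by (simp add: row_rank_def_gen rows)
    obtain B where B: "B \<subseteq> {row 1 M, row 2 M}" "vec.independent B" "card B = 2"
      using vec.basis_exists[of "{row 1 M, row 2 M}"] d by metis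
    then have "B = {row 1 M, row 2 M}"
      by (intro card_seteq) (auto simp: card_insert_if)
    with B show "row 1 M \<noteq> row 2 M \<and> vec.independent {row 1 M, row 2 M}"
      by (auto simp: card_insert_if)
  next
    assume *: "row 1 M \<noteq> row 2 M \<and> vec.independent {row 1 M, row 2 M}"
    then show "rank M = 2"
      by (simp add: row_rank_def_gen rows vec.dim_eq_card_independent)
  qed
qed

text \<open>The Pluecker coordinates. Rank two means that one of them is nonzero, an open condition
  that is scaled by the determinant under base change.\<close>

definition pl :: "frame \<Rightarrow> 8 \<Rightarrow> 8 \<Rightarrow> complex" where
  "pl M i j = M $ 1 $ i * M $ 2 $ j - M $ 1 $ j * M $ 2 $ i"

lemma rank_2_pl: "rank M = 2 \<longleftrightarrow> (\<exists>i j. pl M i j \<noteq> 0)"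
proof -
  let ?u = "row 1 M" and ?w = "row 2 M"
  have pl: "pl M i j = ?u $ i * ?w $ j - ?u $ j * ?w $ i" for i j by (simp add: pl_def row_def)
  show ?thesis unfolding rank_2_iff
  proof
    assume *: "?u \<noteq> ?w \<and> vec.independent {?u, ?w}"
    show "\<exists>i j. pl M i j \<noteq> 0"
    proof (rule ccontr)
      assume "\<not> ?thesis"
      then have z: "?u $ i * ?w $ j = ?u $ j * ?w $ i" for i j by (simp add: pl)
      from * have "?u \<noteq> 0" using vec.dependent_zero[of "{?u, ?w}"] by auto
      then obtain i where i: "?u $ i \<noteq> 0" by (auto simp: vec_eq_iff)
      have "?w = (?w $ i / ?u $ i) *s ?u" using i z[of i] by (auto simp: vec_eq_iff field_simps)
      then have "?w \<in> vec.span {?u}" using vec.span_breakdown_eq by (metis vec.span_base vec.span_scale insertI1)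
      moreover have "{?u, ?w} - {?w} = {?u}" using * by auto
      ultimately have "vec.dependent {?u, ?w}" by (auto simp: vec.dependent_def)
      then show False using * by simp
    qed
  next
    assume "\<exists>i j. pl M i j \<noteq> 0"
    then obtain i j where ij: "?u $ i * ?w $ j - ?u $ j * ?w $ i \<noteq> 0" by (auto simp: pl)
    have ne: "?u \<noteq> ?w" using ij by auto
    have "?w \<noteq> 0" using ij by auto
    have "?u \<notin> vec.span {?w}"
    proof
      assume "?u \<in> vec.span {?w}"
      then obtain c where "?u = c *s ?w" by (auto simp: vec.span_singleton)
      then show False using ij by simp
    qed
    with \<open>?w \<noteq> 0\<close> ne show "?u \<noteq> ?w \<and> vec.independent {?u, ?w}"
      by (simp add: vec.independent_insert vec.dependent_single)
  qed
qed

text \<open>If the volume vanished on a spanning 8-tuple, \<open>eq_zero\<close> would make it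
  vanish identically, but it is 1 on the standard basis.\<close>

lemma volume_nonzero:
  assumes "vec.span ({u, w} \<union> x ` {..<6}) = UNIV"
  shows "volume u w x \<noteq> 0"
proof
  assume 0: "volume u w x = 0"
  define y where "y i = (if i = 0 then u else if i = 1 then w else x (i - 2))" for i :: nat
  have 8: "[0..<8] = 0 # 1 # map (\<lambda>i. i + 2) [0..<6::nat]" by (simp add: upt_rec numeral_eq_Suc)
  have y: "map y [0..<8] = [u, w] @ map x [0..<6]"
    unfolding 8 by (simp add: y_def comp_def)
  interpret alternating_form 8 "\<lambda>x. top_coeff (wedges ([] @ map x [0..<8] @ []))"
    by (rule alternating_form_volume)
  have "{u, w} \<union> x ` {..<6} \<subseteq> y ` {..<8}"
  proof -
    have "x i \<in> y ` {..<8}" if "i < 6" for i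
      using that by (intro image_eqI[of _ _ "i + 2"]) (auto simp: y_def)
    moreover have "u \<in> y ` {..<8}" by (rule image_eqI[of _ _ 0]) (auto simp: y_def)
    moreover have "w \<in> y ` {..<8}" by (rule image_eqI[of _ _ 1]) (auto simp: y_def)
    ultimately show ?thesis by auto
  qed
  from vec.span_mono[OF this] have sp: "vec.span (y ` {..<8}) = UNIV" using assms by auto
  have z: "top_coeff (wedges ([] @ map z [0..<8] @ [])) = 0" for z
  proof (rule eq_zero[of y "{}"])
    show "top_coeff (wedges ([] @ map y [0..<8] @ [])) = 0" using 0 by (simp only: y append_Nil append_Nil2)
  qed (use sp in auto)
  let ?l = "sorted_list_of_set (UNIV :: 8 set)"
  have "length ?l = 8" by simp
  then have "map (\<lambda>i. axis (?l ! i) (1 :: complex)) [0..<8] = map (\<lambda>i. axis i 1) ?l"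
    by (intro nth_equalityI) auto
  then show False using z[of "\<lambda>i. axis (?l ! i) 1"] volume_basis by simp
qed

text \<open>The basis adapted to a form with radical K of dimension at least 8 - r: it starts with
  the rows of the frame, and its last 6 - r vectors lie in K. It is used with r = 4 and r = 2 for
  the two degeneracy loci, and with r = 6 for a basis without further condition.\<close>

lemma complete_basis:
  fixes u w :: V8
  assumes "u \<noteq> w" "vec.independent {u, w}" "vec.subspace K" "{u, w} \<subseteq> K" "6 - r + 2 \<le> vec.dim K"
  obtains x :: "nat \<Rightarrow> V8" where "vec.span ({u, w} \<union> x ` {..<6}) = UNIV" "\<And>i. r \<le> i \<Longrightarrow> i < 6 \<Longrightarrow> x i \<in> K"
proof -
  obtain B where B: "{u, w} \<subseteq> B" "B \<subseteq> K" "vec.independent B" "K \<subseteq> vec.span B"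
    using vec.maximal_independent_subset_extend[OF assms(4,2)] by blast
  have fB: "finite B" using B(3) by (rule vec.finiteI_independent)
  have cB: "6 - r + 2 \<le> card B" using assms(5) B vec.dim_eq_card[of B K] vec.span_minimal[OF B(2) assms(3)]
    vec.basis_card_eq_dim[OF B(2,4,3)] by simp
  have "card (B - {u, w}) = card B - 2" using B(1) assms(1) fB by (subst card_Diff_subset) auto
  with cB have "6 - r \<le> card (B - {u, w})" by simp
  then obtain C where C: "C \<subseteq> B - {u, w}" "card C = 6 - r" "finite C"
    using fB by (metis obtain_subset_with_card_n finite_Diff finite_subset)
  have "vec.independent ({u, w} \<union> C)" by (rule vec.independent_mono[OF B(3)]) (use B C in auto)
  then obtain E where E: "{u, w} \<union> C \<subseteq> E" "vec.independent E" "vec.span E = UNIV"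
    using vec.maximal_independent_subset_extend[OF subset_UNIV, of "{u, w} \<union> C"] by (metis top.extremum_uniqueI)
  have fE: "finite E" using E(2) by (rule vec.finiteI_independent)
  have "card E = 8" using vec.dim_eq_card[of E UNIV] E by (simp add: card_cart_basis)
  moreover have "card ({u, w} \<union> C) = 2 + (6 - r)" using C assms(1) by (subst card_Un_disjoint) auto
  ultimately have cE: "card (E - ({u, w} \<union> C)) = 6 - (6 - r)"
    using E(1) C fE by (subst card_Diff_subset) (auto intro: finite_subset)
  \<comment> \<open>By truncated subtraction this is the minimum of r and 6.\<close>
  define r' where "r' = 6 - (6 - r)"
  obtain g where g: "bij_betw g {..<r'} (E - ({u, w} \<union> C))"
    using cE fE r'_def by (metis bij_betw_iff_card card_lessThan finite_Diff finite_lessThan)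
  obtain h where h: "bij_betw h {r'..<6} C"
    using C r'_def by (metis bij_betw_iff_card card_atLeastLessThan finite_atLeastLessThan diff_diff_cancel diff_le_self)
  define x where "x i = (if i < r' then g i else h i)" for i
  have "r' \<le> 6" by (simp add: r'_def)
  then have "{..<6} = {..<r'} \<union> {r'..<6}" by auto
  then have "x ` {..<6} = g ` {..<r'} \<union> h ` {r'..<6}" by (auto simp: x_def image_def)
  also have "\<dots> = (E - ({u, w} \<union> C)) \<union> C" using g h by (simp add: bij_betw_def)
  finally have "{u, w} \<union> x ` {..<6} = E" using E(1) by auto
  moreover have "x i \<in> K" if "r \<le> i" "i < 6" for i
  proof -
    have "\<not> i < r'" using that by (simp add: r'_def)
    then have "x i = h i" by (simp add: x_def)
    then have "x i \<in> C" using h that \<open>\<not> i < r'\<close> by (auto simp: bij_betw_def)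
    then show ?thesis using C B by auto
  qed
  ultimately show ?thesis using that[of x] E(3) by simp
qed

lemma subspace_radical: "skew_bilinear f \<Longrightarrow> vec.subspace (radical f)"
  by (auto simp: vec.subspace_def radical_def skew_bilinearD(1,2,7))

text \<open>Rank and nullity of the map \<open>T\<close> that sends x to the linear form f(x, .):
  its kernel is the radical and its image lies in the row space of the Gram matrix.\<close>

lemma dim_radical:
  assumes f: "skew_bilinear f" and "rank (\<chi> i j. f (axis i 1) (axis j 1) :: complex ^ 8 ^ 8) \<le> r"
  shows "8 - r \<le> vec.dim (radical f)"
proof -
  define A :: "complex ^ 8 ^ 8" where "A = (\<chi> i j. f (axis i 1) (axis j 1))"
  define T where "T x = (\<chi> j. f x (axis j 1))" for x :: V8
  have lin: "Vector_Spaces.linear (*s) (*s) T"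
    by unfold_locales (simp_all add: T_def vec_eq_iff skew_bilinearD(1,2)[OF f] algebra_simps)
  have row: "T x = (\<Sum>i\<in>UNIV. x $ i *s row i A)" for x
  proof -
    have "f x (axis j 1) = (\<Sum>i\<in>UNIV. x $ i * f (axis i 1) (axis j 1))" for j
      by (rule skew_bilinear_sum_left[OF f])
    then show ?thesis by (simp add: T_def vec_eq_iff row_def A_def)
  qed
  have im: "range T \<subseteq> vec.span (rows A)"
  proof -
    have "T x \<in> vec.span (rows A)" for x
      unfolding row by (intro vec.span_sum vec.span_scale vec.span_base) (auto simp: rows_def)
    then show ?thesis by auto
  qed
  have ker: "T x = 0 \<longleftrightarrow> x \<in> radical f" for x
  proof
    assume "T x = 0"
    then show "x \<in> radical f" by (intro radical_axis[OF f]) (simp add: T_def vec_eq_iff)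
  qed (simp add: T_def radical_def vec_eq_iff)
  obtain B where B: "B \<subseteq> radical f" "vec.independent B" "radical f \<subseteq> vec.span B" "card B = vec.dim (radical f)"
    using vec.basis_exists by blast
  obtain D where D: "D \<subseteq> range T" "vec.independent D" "range T \<subseteq> vec.span D" "card D = vec.dim (range T)"
    using vec.basis_exists by blast
  have fin: "finite B" "finite D" using B D by (auto intro: vec.finiteI_independent)
  have "vec.dim (range T) \<le> r"
    using im assms(2) vec.dim_subset[OF im] by (simp add: A_def row_rank_def_gen)
  with D have cD: "card D \<le> r" by simp
  \<comment> \<open>p lifts a basis of the image; the lifts together with a basis of the kernel span
    the whole space.\<close>
  define p where "p = inv T"
  have p: "T (p d) = d" if "d \<in> D" for d
    unfolding p_def using D(1) that by (intro f_inv_into_f) auto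
  interpret T: Vector_Spaces.linear "(*s)" "(*s)" T by (rule lin)
  have "UNIV \<subseteq> vec.span (B \<union> p ` D)"
  proof
    fix x
    have "T ` (p ` D) = D" unfolding image_image using p by simp
    then have "vec.span D = T ` vec.span (p ` D)" using T.span_image[of "p ` D"] by simp
    moreover have "T x \<in> vec.span D" using D(3) by blast
    ultimately have "T x \<in> T ` vec.span (p ` D)" by simp
    then obtain y where y: "y \<in> vec.span (p ` D)" "T x = T y" by blast
    then have "T (x - y) = 0" by (simp add: T.diff)
    then have "x - y \<in> vec.span B" using ker B(3) by auto
    then have "(x - y) + y \<in> vec.span (B \<union> p ` D)"
      using y by (intro vec.span_add) (meson Un_upper1 Un_upper2 subsetD vec.span_mono)+
    then show "x \<in> vec.span (B \<union> p ` D)" by simp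
  qed
  then have "vec.dim (UNIV :: V8 set) \<le> card (B \<union> p ` D)"
    using fin by (intro vec.dim_le_card) auto
  also have "\<dots> \<le> card B + card (p ` D)" by (rule card_Un_le)
  also have "\<dots> \<le> card B + r" using card_image_le[OF fin(2), of p] cD by simp
  finally show ?thesis using B(4) by (simp add: card_cart_basis)
qed

section \<open>Polynomial dependence of forms and volumes on parameters\<close>

lemma poly_sum:
  assumes "\<And>a. a \<in> A \<Longrightarrow> (\<lambda>x. f a x) \<in> poly_functions L"
  shows "(\<lambda>x. \<Sum>a\<in>A. f a x) \<in> poly_functions L"
  using assms by (induction A rule: infinite_finite_induct) (auto intro: poly_functions.intros)

lemma poly_prod:
  assumes "\<And>a. a \<in> A \<Longrightarrow> (\<lambda>x. f a x) \<in> poly_functions L"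
  shows "(\<lambda>x. \<Prod>a\<in>A. f a x) \<in> poly_functions L"
  using assms by (induction A rule: infinite_finite_induct) (auto intro: poly_functions.intros)

lemma poly_diff:
  assumes "f \<in> poly_functions L" "g \<in> poly_functions L"
  shows "(\<lambda>x. f x - g x) \<in> poly_functions L"
  using poly_functions.add[OF assms(1) poly_functions.mult[OF poly_functions.const[of "-1"] assms(2)]] by simp

lemmas poly_intros = poly_functions.const poly_functions.add poly_functions.mult poly_diff poly_sum poly_prod

text \<open>The vectors are given by a list of functions of the parameter, so that the induction
  runs over a list that is the same for all parameter values.\<close>

lemma poly_wedges:
  assumes "\<And>f i. f \<in> set fs \<Longrightarrow> (\<lambda>p. f p $ i) \<in> poly_functions L"
  shows "(\<lambda>p. wedges (map (\<lambda>f. f p) fs) $ K) \<in> poly_functions L"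
  using assms
  by (induction fs arbitrary: K) (auto simp: wedges_Cons wedge_ext_vec intro!: poly_intros)

lemma poly_psi:
  assumes "\<And>I. (\<lambda>p. v p $ I) \<in> poly_functions L" "\<And>k l. (\<lambda>p. M p $ k $ l) \<in> poly_functions L"
    "\<And>i. (\<lambda>p. x p $ i) \<in> poly_functions L" "\<And>i. (\<lambda>p. y p $ i) \<in> poly_functions L"
  shows "(\<lambda>p. psi (v p) (M p) (x p) (y p)) \<in> poly_functions L"
proof -
  have "(\<lambda>p. wedges (map (\<lambda>f. f p) [\<lambda>p. row 1 (M p), \<lambda>p. row 2 (M p), x, y]) $ K) \<in> poly_functions L" for K
    by (rule poly_wedges) (auto simp: row_def assms)
  then show ?thesis
    by (auto simp: psi_def top_coeff_wedge intro!: poly_intros assms)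
qed

lemma poly_pfaffian:
  assumes "\<And>i j. (\<lambda>p. a p i j) \<in> poly_functions L"
  shows "(\<lambda>p. pfaffian n (a p)) \<in> poly_functions L"
  unfolding pfaffian_def divide_inverse by (intro poly_intros assms)

lemma poly_differentiable:
  assumes "f \<in> poly_functions {\<lambda>t. t}"
  shows "\<exists>D. (f has_field_derivative D) (at z)"
  using assms by induction (auto intro: derivative_eq_intros exI DERIV_const DERIV_ident DERIV_add DERIV_mult)

lemma ext_vec_wedge_minus: "ext_vec x \<and>\<^sub>e (- w) = - (ext_vec x \<and>\<^sub>e w)"
  using ext_vec_wedge_scale[of x "-1" w] by simp

lemma wedges_swap: "wedges (pre @ b # a # post) = - wedges (pre @ a # b # post)"
  by (induction pre) (simp_all add: wedges_Cons wedge_ext_vec_swap[of b a] ext_vec_wedge_minus)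

lemma wedges_not_distinct: "\<not> distinct xs \<Longrightarrow> wedges xs = 0"
  using not_distinct_decomp[of xs] wedges_repeat by auto

lemma top_wedge_add: "top_coeff (v \<and>\<^sub>e (w + z)) = top_coeff (v \<and>\<^sub>e w) + top_coeff (v \<and>\<^sub>e z)"
  and top_wedge_scale: "top_coeff (v \<and>\<^sub>e (c *s w)) = c * top_coeff (v \<and>\<^sub>e w)"
  by (simp_all add: top_coeff_wedge algebra_simps sum.distrib sum_distrib_left)

text \<open>Serves three times: for \<open>psi\<close> in its two arguments, and for
  \<open>psi\<close> and the volume in the two rows of the frame, where it yields the determinant of
  a base change.\<close>

lemma skew_bilinear_wedges:
  assumes "\<And>w z. h (w + z) = h w + h z" "\<And>c w. h (c *s w) = c * h w"
  shows "skew_bilinear (\<lambda>a b. h (wedges (pre @ a # b # post)))"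
proof -
  have m: "h (- w) = - h w" for w using assms(2)[of "-1" w] by simp
  show ?thesis
    unfolding skew_bilinear_def
  proof (intro conjI allI)
    fix x y z c
    show "h (wedges (pre @ y # x # post)) = - h (wedges (pre @ x # y # post))"
      by (simp only: wedges_swap[of _ y x] m)
  qed (simp_all add: wedges_update_add wedges_update_scale assms)
qed

lemma skew_bilinear_psi: "skew_bilinear (psi v M)"
  using skew_bilinear_wedges[of "\<lambda>w. top_coeff (v \<and>\<^sub>e w)" "[row 1 M, row 2 M]" "[]"]
  by (simp add: top_wedge_add top_wedge_scale psi_def[abs_def])

lemma psi_row: "psi v M (row 1 M) y = 0" "psi v M (row 2 M) y = 0"
  by (simp_all add: psi_def wedges_not_distinct top_coeff_wedge)

lemma row_mult:
  fixes A :: "complex ^ 2 ^ 2"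
  shows "row i (A ** M) = A $ i $ 1 *s row 1 M + A $ i $ 2 *s row 2 M"
  by (simp add: vec_eq_iff row_def matrix_matrix_mult_def UNIV_2)

lemma skew_bilinear_det:
  fixes A :: "complex ^ 2 ^ 2"
  assumes "skew_bilinear g"
  shows "g (row 1 (A ** M)) (row 2 (A ** M)) = det A * g (row 1 M) (row 2 M)"
  unfolding row_mult
  by (simp add: skew_bilinearD(1,2,4,5,6)[OF assms] skew_bilinearD(3)[OF assms, of "row 1 M" "row 2 M"] det_2 algebra_simps)

lemma psi_mult: "psi v (A ** M) x y = det A * psi v M x y"
  using skew_bilinear_det[OF skew_bilinear_wedges[of "\<lambda>w. top_coeff (v \<and>\<^sub>e w)" "[]" "[x, y]"], of A M]
  by (simp add: top_wedge_add top_wedge_scale psi_def)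

lemma volume_mult:
  fixes A :: "complex ^ 2 ^ 2" and M :: frame
  shows "volume (row 1 (A ** M)) (row 2 (A ** M)) x = det A * volume (row 1 M) (row 2 M) x"
  using skew_bilinear_det[OF skew_bilinear_wedges[of top_coeff "[]" "map x [0..<6]"], of A M]
  by (simp add: top_coeff_add top_coeff_scale)

lemma pl_mult:
  fixes A :: "complex ^ 2 ^ 2"
  shows "pl (A ** M) i j = det A * pl M i j"
  by (simp add: pl_def matrix_matrix_mult_def UNIV_2 det_2 algebra_simps)

lemma basis_extending_frame:
  fixes M :: frame
  assumes "rank M = 2"
  obtains x :: "nat \<Rightarrow> V8" where "vec.span ({row 1 M, row 2 M} \<union> x ` {..<6}) = UNIV"
proof -
  have "row 1 M \<noteq> row 2 M" "vec.independent {row 1 M, row 2 M}" using assms by (auto simp: rank_2_iff)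
  then show ?thesis
  proof (rule complete_basis[of "row 1 M" "row 2 M" UNIV 6])
    fix x :: "nat \<Rightarrow> V8" assume "vec.span ({row 1 M, row 2 M} \<union> x ` {..<6}) = UNIV"
    then show ?thesis by (rule that)
  qed (simp_all add: card_cart_basis)
qed

text \<open>Makes the definite description in \<open>pfaffian_section\<close> meaningful. Both sides
  are alternating in x and vanish when some x i is a row of M, so they are proportional; a basis
  with nonzero volume determines the ratio.\<close>

lemma pfaffian_eq:
  fixes M :: frame and x :: "nat \<Rightarrow> V8"
  assumes "rank M = 2"
  shows "pfaffian 3 (\<lambda>a b. psi v M (x a) (x b)) = pfaffian_section v M * volume (row 1 M) (row 2 M) x"
proof -
  let ?P = "\<lambda>x. pfaffian 3 (\<lambda>a b. psi v M (x a) (x b))"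
  let ?V = "\<lambda>x. volume (row 1 M) (row 2 M) x"
  obtain b :: "nat \<Rightarrow> V8" where b: "vec.span ({row 1 M, row 2 M} \<union> b ` {..<6}) = UNIV"
    using basis_extending_frame[OF assms] .
  have V: "?V b \<noteq> 0" using b by (rule volume_nonzero)
  have "alternating_form 6 ?P"
    using alternating_form_pfaffian[OF skew_bilinear_psi, of 3] by simp
  moreover have "alternating_form 6 ?V"
    using alternating_form_volume[of 6 "[row 1 M, row 2 M]" "[]"] by simp
  ultimately interpret alternating_form 6 "\<lambda>x. ?V b * ?P x - ?P b * ?V x"
    by (rule alternating_form_combine)
  have "?V b * ?P x - ?P b * ?V x = 0" for x :: "nat \<Rightarrow> V8"
  proof (rule eq_zero[OF _ b])
    fix x :: "nat \<Rightarrow> V8" and i assume i: "i < 6" "x i \<in> {row 1 M, row 2 M}"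
    have "?P x = 0"
      by (rule pfaffian_radical[OF skew_bilinear_psi, of i]) (use i psi_row in auto)
    moreover have "\<not> distinct ([row 1 M, row 2 M] @ map x [0..<6])" using i by force
    then have "wedges ([row 1 M, row 2 M] @ map x [0..<6]) = 0" by (rule wedges_not_distinct)
    then have "?V x = 0" by (simp only: top_coeff_0)
    ultimately show "?V b * ?P x - ?P b * ?V x = 0" by (simp only: mult_zero_right diff_self)
  qed simp
  then have ex: "?P x = ?P b / ?V b * ?V x" for x :: "nat \<Rightarrow> V8" using V by (simp add: field_simps)
  have "pfaffian_section v M = ?P b / ?V b"
    unfolding pfaffian_section_def
  proof (rule the_equality)
    fix c assume "\<forall>x. ?P x = c * ?V x"
    then have "?P b = c * ?V b" ..
    with V show "c = ?P b / ?V b" by (simp only: nonzero_mult_div_cancel_right not_False_eq_True)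
  qed (use ex in blast)
  then show ?thesis using ex[of x] by (simp only:)
qed

lemma pfaffian_scale: "pfaffian n (\<lambda>a b. c * f a b) = c ^ n * pfaffian n f"
  by (simp add: pfaffian_def prod.distrib sum_distrib_left mult.left_commute)

lemma pfaffian_section_mult:
  assumes "invertible A" "rank M = 2"
  shows "pfaffian_section v (A ** M) = (det A)\<^sup>2 * pfaffian_section v M"
proof -
  have d: "det A \<noteq> 0" using assms invertible_det_nz by blast
  have r: "rank (A ** M) = 2" using assms(2) d by (simp add: rank_2_pl pl_mult)
  obtain b :: "nat \<Rightarrow> V8" where b: "vec.span ({row 1 M, row 2 M} \<union> b ` {..<6}) = UNIV"
    using basis_extending_frame[OF assms(2)] .
  have V: "volume (row 1 M) (row 2 M) b \<noteq> 0" using b by (rule volume_nonzero)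
  have "det A ^ 3 * (pfaffian_section v M * volume (row 1 M) (row 2 M) b) =
      pfaffian_section v (A ** M) * (det A * volume (row 1 M) (row 2 M) b)"
    using pfaffian_eq[OF r, of v b]
    unfolding psi_mult volume_mult pfaffian_scale pfaffian_eq[OF assms(2), of v b] .
  then show ?thesis using d V by (simp add: power2_eq_square power3_eq_cube mult.assoc)
qed

text \<open>As functions of (u, w), both the volume and the Pluecker coordinate are alternating and
  vanish on the coordinate vectors outside i, j, so one is a constant multiple of the other.\<close>

lemma volume_chart:
  assumes "i \<noteq> j" "bij_betw g {..<6} (- {i, j})"
  shows "volume u w (\<lambda>k. axis (g k) 1) = (u $ i * w $ j - u $ j * w $ i) * volume (axis i 1) (axis j 1) (\<lambda>k. axis (g k) 1)"
    and "volume (axis i 1) (axis j 1) (\<lambda>k. axis (g k) 1) \<noteq> 0"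
proof -
  let ?x = "\<lambda>k. axis (g k) 1 :: V8"
  let ?V = "\<lambda>y. top_coeff (wedges ([] @ map y [0..<2] @ map ?x [0..<6]))"
  let ?d = "\<lambda>y :: nat \<Rightarrow> V8. y 0 $ i * y 1 $ j - y 0 $ j * y 1 $ i"
  let ?b = "\<lambda>k :: nat. if k = 0 then axis i 1 else axis j 1 :: V8"
  have m: "map y [0..<2] = [y 0, y 1]" for y :: "nat \<Rightarrow> V8" by (simp add: upt_rec)
  have less2: "k < 2 \<longleftrightarrow> k = 0 \<or> k = 1" for k :: nat by auto
  have "alternating_form 2 ?V" by (rule alternating_form_volume)
  moreover have "alternating_form 2 ?d"
    by unfold_locales (auto simp: less2 algebra_simps)
  ultimately interpret alternating_form 2 "\<lambda>y. 1 * ?V y - ?V ?b * ?d y"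
    by (rule alternating_form_combine)
  have span: "vec.span ({axis i 1, axis j 1} \<union> ?x ` {..<6}) = (UNIV :: V8 set)"
  proof -
    have "axis k 1 \<in> {axis i 1, axis j 1} \<union> ?x ` {..<6}" for k :: 8
    proof (cases "k \<in> {i, j}")
      case False
      then have "k \<in> g ` {..<6}" using assms(2) by (simp add: bij_betw_def)
      then show ?thesis by blast
    qed auto
    then have "x \<in> vec.span ({axis i 1, axis j 1} \<union> ?x ` {..<6})" for x :: V8
      by (subst sum_scaled_axis[symmetric]) (intro vec.span_sum vec.span_scale vec.span_base)
    then show ?thesis by blast
  qed
  show "volume (axis i 1) (axis j 1) (\<lambda>k. axis (g k) 1) \<noteq> 0" by (rule volume_nonzero[OF span])
  have "?b ` {..<2} = {axis i 1, axis j 1}" by (auto simp: less2)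
  with span have span': "vec.span (?x ` {..<6} \<union> ?b ` {..<2}) = UNIV" by (simp add: Un_commute)
  have "1 * ?V y - ?V ?b * ?d y = 0" for y
  proof (rule eq_zero[OF _ span'])
    show "1 * ?V ?b - ?V ?b * ?d ?b = 0" using assms(1) by (simp add: axis_def)
    fix y and k :: nat assume k: "k < 2" "y k \<in> ?x ` {..<6}"
    then have "\<not> distinct ([] @ map y [0..<2] @ map ?x [0..<6])" by force
    then have "wedges ([] @ map y [0..<2] @ map ?x [0..<6]) = 0" by (rule wedges_not_distinct)
    then have 1: "?V y = 0" by (simp only: top_coeff_0)
    obtain l where l: "y k = axis (g l) 1" "l < 6" using k by auto
    then have "g l \<noteq> i" "g l \<noteq> j" using assms(2) by (auto simp: bij_betw_def)
    then have "?d y = 0" using k(1) l by (auto simp: less2 axis_def)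
    then show "1 * ?V y - ?V ?b * ?d y = 0" using 1 by (simp only: mult_zero_right diff_self)
  qed
  from this[of "\<lambda>k. if k = 0 then u else w"]
  show "volume u w ?x = (u $ i * w $ j - u $ j * w $ i) * volume (axis i 1) (axis j 1) ?x"
    by (simp add: m mult.commute)
qed

lemma chart_enumeration:
  assumes "i \<noteq> (j :: 8)"
  obtains g :: "nat \<Rightarrow> 8" where "bij_betw g {..<6} (- {i, j})"
proof -
  have "card (- {i, j}) = 6" using assms by (simp add: Compl_eq_Diff_UNIV card_Diff_subset)
  then have "card {..<6 :: nat} = card (- {i, j})" by simp
  then show ?thesis using that bij_betw_iff_card[OF finite_lessThan finite] by blast
qed

text \<open>In the chart of i, j the coordinate vectors with other indices complete the frame to a
  basis whose volume is constant. The section is then the Pfaffian of polynomial entries divided by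
  a constant.\<close>

lemma pfaffian_section_is_section: "is_section_O2 (pfaffian_section v)"
  unfolding is_section_O2_def
proof (intro conjI allI impI)
  fix i j :: 8 assume ij: "i \<noteq> j"
  obtain g :: "nat \<Rightarrow> 8" where g: "bij_betw g {..<6} (- {i, j})" using chart_enumeration[OF ij] .
  let ?x = "\<lambda>k. axis (g k) 1 :: V8"
  let ?p = "\<lambda>M. pfaffian 3 (\<lambda>a b. psi v M (?x a) (?x b)) * inverse (volume (axis i 1) (axis j 1) ?x)"
  have "?p \<in> poly_functions {\<lambda>M. M $ k $ l | k l. True}"
    by (intro poly_intros poly_pfaffian poly_psi poly_functions.coord) auto
  moreover have "pfaffian_section v M = ?p M"
    if M: "M $ 1 $ i = 1 \<and> M $ 1 $ j = 0 \<and> M $ 2 $ i = 0 \<and> M $ 2 $ j = 1" for M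
  proof -
    have "pl M i j = 1" using M by (simp add: pl_def)
    then have r: "rank M = 2" unfolding rank_2_pl by (intro exI[of _ i] exI[of _ j]) simp
    have "volume (row 1 M) (row 2 M) ?x = volume (axis i 1) (axis j 1) ?x"
      using M by (subst volume_chart(1)[OF ij g]) (simp add: row_def)
    then show ?thesis using pfaffian_eq[OF r, of v ?x] volume_chart(2)[OF ij g] by simp
  qed
  ultimately show "\<exists>p\<in>poly_functions {\<lambda>M. M $ k $ l | k l. True}.
      \<forall>M. M $ 1 $ i = 1 \<and> M $ 1 $ j = 0 \<and> M $ 2 $ i = 0 \<and> M $ 2 $ j = 1 \<longrightarrow> pfaffian_section v M = p M"
    by (intro bexI[of _ ?p]) simp_all
qed (simp add: pfaffian_section_mult)

text \<open>One step of symplectic Gram-Schmidt: P projects onto the orthogonal complement of the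
  hyperbolic pair p, q, and f is the restricted form g plus a part of rank two.\<close>

lemma skew_bilinear_reduce:
  assumes f: "skew_bilinear f" and c: "f p q \<noteq> 0"
  obtains g P where "skew_bilinear g" "\<And>x y. g x y = f (P x) (P y)" "\<And>x. f (P x) p = 0" "\<And>x. f (P x) q = 0"
    "\<And>x y. f x y = g x y + (f x q / f p q) * f p y - (f x p / f p q) * f q y"
proof -
  have diff: "f (x - y) z = f x z - f y z" for x y z
    using skew_bilinearD(1)[OF f, of "x - y" y z] by simp
  note D = skew_bilinearD(1,2,4,5,6)[OF f] diff
  define P where "P x = x + (- (f x q / f p q)) *s p + (f x p / f p q) *s q" for x
  have qp: "f q p = - f p q" by (rule skew_bilinearD(3)[OF f])
  have Pp: "f (P x) p = 0" and Pq: "f (P x) q = 0" for x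
    using c by (simp_all add: P_def D qp)
  have Pp': "f p (P x) = 0" and Pq': "f q (P x) = 0" for x
    using Pp[of x] Pq[of x] skew_bilinearD(3)[OF f, of p "P x"] skew_bilinearD(3)[OF f, of q "P x"] by simp_all
  have e: "f (P x) (P y) = f x y - (f x q / f p q) * f p y + (f x p / f p q) * f q y" for x y
  proof -
    have "f (P x) (P y) = f (P x) y"
      unfolding P_def[of y] by (simp only: D(1-5) Pp Pq mult_zero_right add_0_right)
    then show ?thesis by (simp add: P_def D)
  qed
  have "skew_bilinear (\<lambda>x y. f (P x) (P y))"
    unfolding skew_bilinear_def
  proof (intro conjI allI)
    show "f (P y) (P x) = - f (P x) (P y)" for x y by (rule skew_bilinearD(3)[OF f])
    show "f (P (x + y)) (P z) = f (P x) (P z) + f (P y) (P z)" for x y z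
      unfolding e by (simp add: D add_divide_distrib algebra_simps)
    show "f (P (c *s x)) (P z) = c * f (P x) (P z)" for c x z
      unfolding e by (simp add: D algebra_simps)
  qed
  then show ?thesis
  proof (rule that[of "\<lambda>x y. f (P x) (P y)" P])
    show "f x y = f (P x) (P y) + (f x q / f p q) * f p y - (f x p / f p q) * f q y" for x y
      unfolding e by simp
  qed (simp_all only: Pp Pq)
qed

text \<open>A radical of dimension four contains two vectors independent modulo the frame, and one
  of them already kills the Pfaffian. Conversely, rank above four allows three successive splittings
  by \<open>skew_bilinear_reduce\<close>, and the Pfaffian on the three hyperbolic pairs is a
  product of nonzero numbers.\<close>

lemma rank_le_4_iff:
  assumes M: "rank M = 2"
  shows "rank (psi_matrix v M) \<le> 4 \<longleftrightarrow> pfaffian_section v M = 0"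
proof
  let ?f = "psi v M"
  assume "rank (psi_matrix v M) \<le> 4"
  then have "4 \<le> vec.dim (radical ?f)"
    using dim_radical[OF skew_bilinear_psi, of v M 4] by (simp add: psi_matrix_def)
  moreover have "{row 1 M, row 2 M} \<subseteq> radical ?f" by (auto simp: radical_def psi_row)
  moreover have "row 1 M \<noteq> row 2 M" "vec.independent {row 1 M, row 2 M}" using M by (auto simp: rank_2_iff)
  ultimately obtain x :: "nat \<Rightarrow> V8" where x: "vec.span ({row 1 M, row 2 M} \<union> x ` {..<6}) = UNIV"
      "\<And>i. 4 \<le> i \<Longrightarrow> i < 6 \<Longrightarrow> x i \<in> radical ?f"
    using complete_basis[of "row 1 M" "row 2 M" "radical ?f" 4] subspace_radical[OF skew_bilinear_psi[of v M]]
    by auto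
  have "pfaffian 3 (\<lambda>a b. ?f (x a) (x b)) = 0"
    by (rule pfaffian_radical[OF skew_bilinear_psi, of 4]) (use x(2)[of 4] in \<open>auto simp: radical_def\<close>)
  then show "pfaffian_section v M = 0"
    using pfaffian_eq[OF M, of v x] volume_nonzero[OF x(1)] by simp
next
  let ?f = "psi v M"
  note f = skew_bilinear_psi[of v M]
  assume 0: "pfaffian_section v M = 0"
  show "rank (psi_matrix v M) \<le> 4"
  proof (rule ccontr)
    assume r: "\<not> ?thesis"
    \<comment> \<open>A sum of four products of linear functions has rank at most four. This
      excludes that the remainder vanishes after zero, one or two splittings.\<close>
    have low: "False" if "\<And>x y. ?f x y = (\<Sum>k<4. a k x * b k y)" for a b :: "nat \<Rightarrow> V8 \<Rightarrow> complex"
    proof -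
      have "rank (psi_matrix v M) \<le> 4"
        by (rule rank_matrix_le[where a = "\<lambda>k. \<chi> j. b k (axis j 1)" and b = "\<lambda>k i. a k (axis i 1)"])
          (simp add: vec_eq_iff row_def psi_matrix_def that)
      then show False using r by simp
    qed
    have s4: "sum h {..<4} = h 0 + h 1 + h 2 + h 3" for h :: "nat \<Rightarrow> complex"
      by (simp add: numeral_eq_Suc)
    have "\<exists>p q. ?f p q \<noteq> 0"
    proof (rule ccontr)
      assume "\<not> ?thesis"
      then show False using low[of "\<lambda>_ _. 0" "\<lambda>_ _. 0"] by simp
    qed
    then obtain p q where pq: "?f p q \<noteq> 0" by blast
    obtain g P where g: "skew_bilinear g" "\<And>x y. g x y = ?f (P x) (P y)" "\<And>x. ?f (P x) p = 0" "\<And>x. ?f (P x) q = 0"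
      "\<And>x y. ?f x y = g x y + (?f x q / ?f p q) * ?f p y - (?f x p / ?f p q) * ?f q y"
      using skew_bilinear_reduce[OF f pq] by blast
    have "\<exists>p q. g p q \<noteq> 0"
    proof (rule ccontr)
      assume *: "\<not> ?thesis"
      show False
      proof (rule low)
        show "?f x y = (\<Sum>k<(4 :: nat). (\<lambda>k x. if k = 0 then ?f x q / ?f p q else if k = 1 then - (?f x p / ?f p q) else 0) k x *
            (\<lambda>k y. if k = 0 then ?f p y else if k = 1 then ?f q y else 0) k y)" for x y
          using * by (subst g(5)) (simp add: s4)
      qed
    qed
    then obtain p1 q1 where pq1: "g p1 q1 \<noteq> 0" by blast
    obtain h R where h: "skew_bilinear h" "\<And>x y. h x y = g (R x) (R y)" "\<And>x. g (R x) p1 = 0" "\<And>x. g (R x) q1 = 0"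
      "\<And>x y. g x y = h x y + (g x q1 / g p1 q1) * g p1 y - (g x p1 / g p1 q1) * g q1 y"
      using skew_bilinear_reduce[OF g(1) pq1] by blast
    have "\<exists>p q. h p q \<noteq> 0"
    proof (rule ccontr)
      assume *: "\<not> ?thesis"
      show False
      proof (rule low)
        show "?f x y = (\<Sum>k<(4 :: nat). (\<lambda>k x. if k = 0 then ?f x q / ?f p q else if k = 1 then - (?f x p / ?f p q)
             else if k = 2 then g x q1 / g p1 q1 else - (g x p1 / g p1 q1)) k x *
            (\<lambda>k y. if k = 0 then ?f p y else if k = 1 then ?f q y else if k = 2 then g p1 y else g q1 y) k y)" for x y
          using * by (subst g(5), subst h(5)) (simp add: s4)
      qed
    qed
    then obtain p2 q2 where pq2: "h p2 q2 \<noteq> 0" by blast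
    \<comment> \<open>Three mutually orthogonal pairs; the projections P and R move each pair into
      the complement of the earlier ones.\<close>
    define x where "x = (!) [p, q, P p1, P q1, P (R p2), P (R q2)]"
    have "pfaffian 3 (\<lambda>a b. ?f (x a) (x b)) = ?f (x 0) (x 1) * ?f (x 2) (x 3) * ?f (x 4) (x 5)"
    proof (rule pfaffian_3_block)
      have sw: "?f p (P y) = 0" "?f q (P y) = 0" "g p1 (R y) = 0" "g q1 (R y) = 0" for y
        using skew_bilinearD(3)[OF f, of p "P y"] skew_bilinearD(3)[OF f, of q "P y"]
          skew_bilinearD(3)[OF g(1), of p1 "R y"] skew_bilinearD(3)[OF g(1), of q1 "R y"] g(3,4) h(3,4)
        by simp_all
      show "?f (x 0) (x 2) = 0" "?f (x 0) (x 3) = 0" "?f (x 0) (x 4) = 0" "?f (x 0) (x 5) = 0"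
        "?f (x 1) (x 2) = 0" "?f (x 1) (x 3) = 0" "?f (x 1) (x 4) = 0" "?f (x 1) (x 5) = 0"
        by (simp_all add: x_def sw)
      show "?f (x 2) (x 4) = 0" "?f (x 2) (x 5) = 0" "?f (x 3) (x 4) = 0" "?f (x 3) (x 5) = 0"
        by (simp_all add: x_def sw flip: g(2))
    qed (rule skew_bilinearD(3)[OF f])
    also have "\<dots> \<noteq> 0" using pq pq1 pq2 by (simp add: x_def flip: g(2) h(2))
    finally show False using pfaffian_eq[OF M, of v x] 0 by simp
  qed
qed

lemma D_Z6_subset_D_Z1: "D_Z6 v \<subseteq> D_Z1 v"
  by (auto simp: D_Z6_def D_Z1_def degeneracy_locus_def intro: order_trans)

lemma D_Z1_eq_zero_locus: "D_Z1 v = zero_locus (pfaffian_section v)"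
  by (auto simp: D_Z1_def degeneracy_locus_def zero_locus_def is_basis_of_def rank_le_4_iff)

section \<open>Singularity of the Pfaffian hypersurface along the rank two locus\<close>

lemma poly_affine_frame:
  "(\<lambda>t. (\<chi> k l. M $ k $ l + t * N $ k $ l) $ i $ j) \<in> poly_functions {\<lambda>t. t}"
  by (simp, intro poly_intros poly_functions.coord) simp

text \<open>By hypothesis at least two of the three factors vanish at 0, so every term of the
  product rule retains a vanishing factor.\<close>

lemma has_derivative_zero_prod_3:
  assumes "\<And>i. i < (3 :: nat) \<Longrightarrow> f i \<in> poly_functions {\<lambda>t. t}"
    and z: "\<And>i j. i < 3 \<Longrightarrow> j < 3 \<Longrightarrow> i \<noteq> j \<Longrightarrow> f i 0 = 0 \<or> f j 0 = 0"
  shows "((\<lambda>t. \<Prod>i<3. f i t) has_field_derivative 0) (at 0)"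
proof -
  obtain D where D: "\<And>i. i < 3 \<Longrightarrow> (f i has_field_derivative D i) (at 0)"
    using poly_differentiable[OF assms(1), of _ 0] by metis
  have e: "(\<Prod>i<3. f i t) = f 0 t * f 1 t * f 2 t" for t by (simp add: numeral_3_eq_3 numeral_2_eq_2)
  have "((\<lambda>t. f 0 t * f 1 t * f 2 t) has_field_derivative
     (D 0 * f 1 0 + D 1 * f 0 0) * f 2 0 + D 2 * (f 0 0 * f 1 0)) (at 0)"
    by (intro DERIV_mult D) auto
  moreover have "(D 0 * f 1 0 + D 1 * f 0 0) * f 2 0 + D 2 * (f 0 0 * f 1 0) = 0"
    using z[of 0 1] z[of 0 2] z[of 1 2] by auto
  ultimately show ?thesis unfolding e by simp
qed

text \<open>In a basis with four vectors in the radical, at most one factor of each product in the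
  Pfaffian is nonzero.\<close>

lemma pfaffian_section_singular:
  fixes M N :: frame
  assumes M: "rank M = 2" and r: "rank (psi_matrix v M) \<le> 2"
  shows "((\<lambda>t. pfaffian_section v (\<chi> k l. M $ k $ l + t * N $ k $ l)) has_field_derivative 0) (at 0)"
proof -
  let ?K = "radical (psi v M)"
  let ?M = "\<lambda>t. (\<chi> k l. M $ k $ l + t * N $ k $ l) :: frame"
  have M0: "?M 0 = M" by (simp add: vec_eq_iff)
  have "6 \<le> vec.dim ?K"
    using dim_radical[OF skew_bilinear_psi, of v M 2] r by (simp add: psi_matrix_def)
  moreover have "{row 1 M, row 2 M} \<subseteq> ?K" by (auto simp: radical_def psi_row)
  moreover have "row 1 M \<noteq> row 2 M" "vec.independent {row 1 M, row 2 M}" using M by (auto simp: rank_2_iff)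
  ultimately obtain x :: "nat \<Rightarrow> V8" where x: "vec.span ({row 1 M, row 2 M} \<union> x ` {..<6}) = UNIV"
      "\<And>i. 2 \<le> i \<Longrightarrow> i < 6 \<Longrightarrow> x i \<in> ?K"
    using complete_basis[of "row 1 M" "row 2 M" ?K 2] subspace_radical[OF skew_bilinear_psi[of v M]]
    by auto
  define q where "q t = volume (row 1 (?M t)) (row 2 (?M t)) x" for t
  define g where "g t = pfaffian 3 (\<lambda>a b. psi v (?M t) (x a) (x b))" for t
  have q0: "q 0 \<noteq> 0" unfolding q_def M0 by (rule volume_nonzero[OF x(1)])
  have "q \<in> poly_functions {\<lambda>t. t}"
  proof -
    let ?fs = "[\<lambda>t. row 1 (?M t), \<lambda>t. row 2 (?M t)] @ map (\<lambda>i t. x i) [0..<6]"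
    have "(\<lambda>t. wedges (map (\<lambda>f. f t) ?fs) $ UNIV) \<in> poly_functions {\<lambda>t. t}"
    proof (rule poly_wedges)
      fix f i assume "f \<in> set ?fs"
      then consider "f = (\<lambda>t. row 1 (?M t))" | "f = (\<lambda>t. row 2 (?M t))" | k where "f = (\<lambda>t. x k)" by auto
      then show "(\<lambda>p. f p $ i) \<in> poly_functions {\<lambda>t. t}"
        using poly_affine_frame[of M N] by cases (simp_all add: row_def poly_functions.const)
    qed
    moreover have "map (\<lambda>f. f t) ?fs = [row 1 (?M t), row 2 (?M t)] @ map x [0..<6]" for t
      by (simp add: comp_def)
    ultimately show ?thesis unfolding q_def top_coeff_def by (simp only:)
  qed
  from poly_differentiable[OF this] obtain D where D: "(q has_field_derivative D) (at 0)" by blast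
  have psi: "(\<lambda>t. psi v (?M t) a b) \<in> poly_functions {\<lambda>t. t}" for a b
    by (rule poly_psi[OF _ poly_affine_frame]) (rule poly_functions.const)+
  have rad: "psi v M (x i) y = 0" "psi v M y (x i) = 0" if "2 \<le> i" "i < 6" for i y
    using x(2)[OF that] skew_bilinearD(3)[OF skew_bilinear_psi, of v M y "x i"] by (simp_all add: radical_def)
  have g': "(g has_field_derivative 0) (at 0)"
  proof -
    have "((\<lambda>t. of_int (sign \<sigma>) * (\<Prod>i<3. psi v (?M t) (x (\<sigma> (2 * i))) (x (\<sigma> (2 * i + 1))))) has_field_derivative
        of_int (sign \<sigma>) * 0) (at 0)" if \<sigma>: "\<sigma> permutes {..<2 * 3}" for \<sigma>
    proof (intro DERIV_cmult has_derivative_zero_prod_3)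
      fix i j :: nat assume ij: "i < 3" "j < 3" "i \<noteq> j"
      have l: "\<sigma> k < 6" if "k < 6" for k using permutes_in_image[OF \<sigma>, of k] that by simp
      have inj: "\<sigma> k = \<sigma> l \<longleftrightarrow> k = l" for k l using permutes_inj[OF \<sigma>] by (auto simp: inj_def)
      \<comment> \<open>Only x 0 and x 1 may lie outside the radical, and three distinct positions
        cannot all be sent to the indices 0 and 1.\<close>
      have "2 \<le> \<sigma> (2 * i) \<or> 2 \<le> \<sigma> (2 * i + 1) \<or> 2 \<le> \<sigma> (2 * j)"
      proof (rule ccontr)
        assume "\<not> ?thesis"
        then have "\<sigma> (2 * i) < 2" "\<sigma> (2 * i + 1) < 2" "\<sigma> (2 * j) < 2" by auto
        moreover have "2 * i + 1 \<noteq> 2 * j" by presburger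
        then have "\<sigma> (2 * i) \<noteq> \<sigma> (2 * i + 1)" "\<sigma> (2 * i) \<noteq> \<sigma> (2 * j)" "\<sigma> (2 * i + 1) \<noteq> \<sigma> (2 * j)"
          using ij by (simp_all add: inj)
        ultimately show False by linarith
      qed
      then show "psi v (?M 0) (x (\<sigma> (2 * i))) (x (\<sigma> (2 * i + 1))) = 0 \<or>
         psi v (?M 0) (x (\<sigma> (2 * j))) (x (\<sigma> (2 * j + 1))) = 0"
        unfolding M0 using rad l ij by auto
    qed (rule psi)
    then have "((\<lambda>t. \<Sum>\<sigma> | \<sigma> permutes {..<2 * 3}. of_int (sign \<sigma>) *
        (\<Prod>i<3. psi v (?M t) (x (\<sigma> (2 * i))) (x (\<sigma> (2 * i + 1))))) has_field_derivative
        (\<Sum>\<sigma> | \<sigma> permutes {..<2 * 3 :: nat}. of_int (sign \<sigma>) * 0)) (at 0)"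
      by (intro DERIV_sum) blast
    from DERIV_cdivide[OF this] show ?thesis unfolding g_def pfaffian_def by simp
  qed
  have g0: "g 0 = 0"
    unfolding g_def M0
    by (rule pfaffian_radical[OF skew_bilinear_psi, of 2]) (use rad(1)[of 2] in auto)
  obtain i j where ij: "pl M i j \<noteq> 0" using M rank_2_pl by blast
  have "(\<lambda>t. pl (?M t) i j) \<in> poly_functions {\<lambda>t. t}"
    unfolding pl_def by (intro poly_intros poly_affine_frame)
  from poly_differentiable[OF this, of 0] have "isCont (\<lambda>t. pl (?M t) i j) 0" by (auto intro: DERIV_isCont)
  then have "\<forall>\<^sub>F t in at 0. pl (?M t) i j \<noteq> 0"
    using ij M0 by (intro tendsto_imp_eventually_ne[of _ "pl (?M 0) i j"]) (auto simp: isCont_def)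
  then have e1: "\<forall>\<^sub>F t in nhds 0. pl (?M t) i j \<noteq> 0"
    using ij M0 by (simp add: eventually_nhds_conv_at)
  have "\<forall>\<^sub>F t in at 0. q t \<noteq> 0"
    using q0 DERIV_isCont[OF D] by (intro tendsto_imp_eventually_ne[of _ "q 0"]) (auto simp: isCont_def)
  then have e2: "\<forall>\<^sub>F t in nhds 0. q t \<noteq> 0"
    using q0 by (simp add: eventually_nhds_conv_at)
  \<comment> \<open>The quotient formula holds only where the frame has rank two and the volume is
    nonzero, hence near t = 0.\<close>
  have e3: "\<forall>\<^sub>F t in nhds 0. pfaffian_section v (?M t) = g t / q t"
    using e1 e2
  proof eventually_elim
    case (elim t)
    then have "rank (?M t) = 2" using rank_2_pl by blast
    from pfaffian_eq[OF this, of v x] elim(2) show ?case by (simp add: g_def q_def)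
  qed
  have "((\<lambda>t. g t / q t) has_field_derivative 0) (at 0)"
    using DERIV_divide[OF g' D q0] g0 by simp
  then show ?thesis by (simp add: DERIV_cong_ev[OF refl e3 refl])
qed

lemma pfaffian_section_singular_along: "singular_along (pfaffian_section v) (D_Z6 v)"
  unfolding singular_along_def singular_at_def
proof (intro ballI allI impI conjI)
  fix U M N assume U: "U \<in> D_Z6 v" "is_basis_of M U"
  then have r: "rank M = 2" "rank (psi_matrix v M) \<le> 2"
    by (auto simp: D_Z6_def degeneracy_locus_def is_basis_of_def)
  then show "pfaffian_section v M = 0" using rank_le_4_iff[of M v] by simp
  from r show "((\<lambda>t. pfaffian_section v (\<chi> k l. M $ k $ l + t * N $ k $ l)) has_field_derivative 0) (at 0)"
    by (rule pfaffian_section_singular)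
qed

section \<open>Quadratic sections as algebraic curvature tensors\<close>

definition frame_of :: "V8 \<Rightarrow> V8 \<Rightarrow> frame" where
  "frame_of u w = (\<chi> k. if k = 1 then u else w)"

lemma frame_of_nth [simp]: "frame_of u w $ 1 = u" "frame_of u w $ 2 = w"
  by (simp_all add: frame_of_def)

lemma frame_of_rows [simp]: "frame_of (M $ 1) (M $ 2) = M"
  using exhaust_2 by (force simp: frame_of_def vec_eq_iff)

lemma frame_eqI: "M $ 1 = M' $ 1 \<Longrightarrow> M $ 2 = M' $ 2 \<Longrightarrow> M = (M' :: frame)"
  by (metis frame_of_rows)

lemma section_mult:
  assumes "is_section_O2 s" "rank (frame_of u w) = 2" "a * d - b * c \<noteq> 0"
  shows "s (frame_of (a *s u + b *s w) (c *s u + d *s w)) = (a * d - b * c)\<^sup>2 * s (frame_of u w)"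
proof -
  define A :: "complex ^ 2 ^ 2" where
    "A = (\<chi> i j. if i = 1 then (if j = 1 then a else b) else (if j = 1 then c else d))"
  have d: "det A = a * d - b * c" by (simp add: A_def det_2)
  have "A ** frame_of u w = frame_of (a *s u + b *s w) (c *s u + d *s w)"
    by (rule frame_eqI) (simp_all add: matrix_matrix_mult_def UNIV_2 A_def vec_eq_iff)
  then show ?thesis using assms d unfolding is_section_O2_def by (metis invertible_det_nz)
qed

lemma poly_holomorphic:
  assumes "p \<in> poly_functions {\<lambda>M. M $ k $ l | k l. True}"
    and "\<And>k l. (\<lambda>t. M t $ k $ l) holomorphic_on S"
  shows "(\<lambda>t. p (M t :: frame)) holomorphic_on S"
  using assms(1) by induction (use assms(2) in \<open>auto intro!: holomorphic_intros\<close>)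

text \<open>Near each parameter a fixed Pluecker coordinate is nonzero; normalising the frame to
  that chart gives a polynomial in holomorphic entries, and homogeneity restores the factor.\<close>

lemma section_holomorphic:
  assumes s: "is_section_O2 s"
    and M: "\<And>k l. (\<lambda>t. M t $ k $ l) holomorphic_on UNIV" "\<And>t. rank (M t) = 2"
  shows "(\<lambda>t. s (M t)) holomorphic_on UNIV"
  unfolding holomorphic_on_def
proof
  fix t0 :: complex
  obtain i j where ij: "pl (M t0) i j \<noteq> 0" using M(2) rank_2_pl by blast
  then have "i \<noteq> j" by (auto simp: pl_def)
  then obtain p where p: "p \<in> poly_functions {\<lambda>M. M $ k $ l | k l. True}"
    "\<And>M. M $ 1 $ i = 1 \<Longrightarrow> M $ 1 $ j = 0 \<Longrightarrow> M $ 2 $ i = 0 \<Longrightarrow> M $ 2 $ j = 1 \<Longrightarrow> s M = p M"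
    using s unfolding is_section_O2_def by meson
  let ?q = "\<lambda>t. pl (M t) i j"
  define S where "S = {t. ?q t \<noteq> 0}"
  have q: "?q holomorphic_on UNIV" unfolding pl_def by (intro holomorphic_intros M)
  have S: "open S" unfolding S_def
    by (intro open_Collect_neq holomorphic_on_imp_continuous_on q continuous_intros)
  \<comment> \<open>M t multiplied from the left by the inverse of its 2 by 2 submatrix with columns
    i, j.\<close>
  define N where "N t = frame_of ((M t $ 2 $ j / ?q t) *s (M t $ 1) + (- (M t $ 1 $ j) / ?q t) *s (M t $ 2))
      ((- (M t $ 2 $ i) / ?q t) *s (M t $ 1) + (M t $ 1 $ i / ?q t) *s (M t $ 2))" for t
  have "s (M t) = (?q t)\<^sup>2 * p (N t)" if "t \<in> S" for t
  proof -
    have qt: "?q t \<noteq> 0" using that by (simp add: S_def)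
    have "(M t $ 2 $ j / ?q t) * (M t $ 1 $ i / ?q t) - (- (M t $ 1 $ j) / ?q t) * (- (M t $ 2 $ i) / ?q t)
        = (M t $ 1 $ i * M t $ 2 $ j - M t $ 1 $ j * M t $ 2 $ i) / (?q t)\<^sup>2"
      by (simp add: power2_eq_square diff_divide_distrib mult.commute)
    also have "\<dots> = 1 / ?q t" using qt by (simp add: pl_def power2_eq_square)
    finally have det: "(M t $ 2 $ j / ?q t) * (M t $ 1 $ i / ?q t) - (- (M t $ 1 $ j) / ?q t) * (- (M t $ 2 $ i) / ?q t)
        = 1 / ?q t" .
    have "s (N t) = (1 / ?q t)\<^sup>2 * s (M t)"
      using section_mult[OF s, of "M t $ 1" "M t $ 2" "M t $ 2 $ j / ?q t" "M t $ 1 $ i / ?q t"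
        "- (M t $ 1 $ j) / ?q t" "- (M t $ 2 $ i) / ?q t"] M(2) qt unfolding det N_def by simp
    moreover have "s (N t) = p (N t)"
    proof -
      have e: "a / ?q t * x + - b / ?q t * y = (a * x - b * y) / ?q t"
        "- b / ?q t * y + a / ?q t * x = (a * x - b * y) / ?q t" for a b x y
        by (simp_all add: diff_divide_distrib)
      show ?thesis
        by (rule p(2); unfold N_def frame_of_nth vector_add_component vector_smult_component e)
          (use qt in \<open>simp_all add: pl_def mult.commute\<close>)
    qed
    ultimately show ?thesis using qt by (simp add: field_simps)
  qed
  moreover have "(\<lambda>t. (?q t)\<^sup>2 * p (N t)) holomorphic_on S"
  proof (intro holomorphic_intros poly_holomorphic[OF p(1)])
    show q': "?q holomorphic_on S" using q holomorphic_on_subset by blast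
    have M': "(\<lambda>t. M t $ k $ l) holomorphic_on S" for k l using M(1) holomorphic_on_subset by blast
    fix k :: 2 and l
    have "k = 1 \<or> k = 2" by (rule exhaust_2)
    then show "(\<lambda>t. N t $ k $ l) holomorphic_on S"
      by (elim disjE; simp add: N_def) (intro holomorphic_intros M' q'; simp add: S_def)+
  qed
  ultimately have "(\<lambda>t. s (M t)) holomorphic_on S" by (simp cong: holomorphic_cong)
  moreover have "t0 \<in> S" using ij by (simp add: S_def)
  ultimately show "(\<lambda>t. s (M t)) field_differentiable at t0 within UNIV"
    using S holomorphic_on_imp_differentiable_at by blast
qed

text \<open>On a projective line a section of O(2) is a binary quadratic form. Here f describes the
  line away from infinity and g near infinity, and homogeneity gives f(t) = t^2 g(1/t). So f is
  entire of quadratic growth, and Liouville's theorem makes it a polynomial of degree at most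
  two.\<close>

lemma section_line:
  assumes s: "is_section_O2 s"
    and r: "\<And>a b. a \<noteq> 0 \<or> b \<noteq> 0 \<Longrightarrow> rank (frame_of (a *s u + b *s z) w) = 2"
  shows "\<exists>c. \<forall>t. s (frame_of (u + t *s z) w) = s (frame_of u w) + t * c + t\<^sup>2 * s (frame_of z w)"
proof -
  define f where "f t = s (frame_of (u + t *s z) w)" for t
  define g where "g t = s (frame_of (z + t *s u) w)" for t
  have ru: "rank (frame_of (u + t *s z) w) = 2" and rz: "rank (frame_of (z + t *s u) w) = 2" for t
    using r[of 1 t] r[of t 1] by (simp_all add: add.commute)
  have ent: "(\<lambda>t. frame_of (x + t *s y) w $ k $ l) holomorphic_on UNIV" for x y k l
    using exhaust_2[of k] by (elim disjE; simp) (intro holomorphic_intros)+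
  have f: "f holomorphic_on UNIV" and g: "g holomorphic_on UNIV"
    unfolding f_def g_def by (rule section_holomorphic[OF s ent]; rule ru rz)+
  have fg: "f t = t\<^sup>2 * g (inverse t)" if "t \<noteq> 0" for t
  proof -
    have "t *s (z + inverse t *s u) + 0 *s w = u + t *s z" "0 *s (z + inverse t *s u) + 1 *s w = w"
      using that by (simp_all add: vec_eq_iff algebra_simps)
    with section_mult[OF s rz[of "inverse t"], of t 1 0 0] that show ?thesis
      by (simp add: f_def g_def add.commute)
  qed
  have "compact (g ` cball 0 1)"
    by (intro compact_continuous_image holomorphic_on_imp_continuous_on compact_cball)
      (use g holomorphic_on_subset in blast)
  then have "bounded (g ` cball 0 1)" by (rule compact_imp_bounded)
  then obtain B where "\<forall>x\<in>cball 0 1. norm (g x) \<le> B" unfolding bounded_iff by auto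
  then have B: "norm (g t) \<le> B" if "norm t \<le> 1" for t using that by simp
  have bd: "norm (f t) \<le> B * norm t ^ 2" if "1 \<le> norm t" for t
  proof -
    have "t \<noteq> 0" using that by auto
    moreover have "norm (inverse t) \<le> 1" using that by (simp add: norm_inverse inverse_le_1_iff)
    ultimately show ?thesis
      using B[of "inverse t"] by (simp add: fg norm_mult norm_power mult.commute mult_left_mono)
  qed
  define a where "a k = (deriv ^^ k) f 0 / fact k" for k
  have fp: "f t = a 0 + a 1 * t + a 2 * t\<^sup>2" for t
  proof -
    have "f t = (\<Sum>k\<le>2. (deriv ^^ k) f 0 / fact k * t ^ k)" by (rule Liouville_polynomial[OF f bd])
    then show ?thesis by (simp add: a_def numeral_2_eq_2)
  qed
  \<comment> \<open>The transition formula determines g away from 0 only; continuity at 0 then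
    identifies the leading coefficient a 2 with g 0.\<close>
  have "g t = a 2 + a 1 * t + a 0 * t\<^sup>2" if "t \<noteq> 0" for t
    using fg[of "inverse t"] that by (simp add: fp field_simps power2_eq_square)
  then have "\<forall>\<^sub>F t in at 0. g t = a 2 + a 1 * t + a 0 * t\<^sup>2"
    by (auto simp: eventually_at_filter)
  moreover have "(g \<longlongrightarrow> g 0) (at 0)"
    using holomorphic_on_imp_continuous_on[OF g] by (simp add: continuous_on_def)
  ultimately have "((\<lambda>t. a 2 + a 1 * t + a 0 * t\<^sup>2) \<longlongrightarrow> g 0) (at 0)"
    using tendsto_cong by force
  moreover have "((\<lambda>t. a 2 + a 1 * t + a 0 * t\<^sup>2) \<longlongrightarrow> a 2 + a 1 * 0 + a 0 * 0\<^sup>2) (at 0)"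
    by (intro tendsto_intros)
  ultimately have "g 0 = a 2" using tendsto_unique[OF at_neq_bot] by fastforce
  moreover have "f 0 = a 0" using fp[of 0] by simp
  ultimately show ?thesis using fp by (intro exI[of _ "a 1"]) (simp add: f_def g_def mult.commute)
qed

text \<open>A function that is quadratic on every affine line and homogeneous of degree two is a quadratic
  form (Jordan and von Neumann); no continuity is needed.\<close>

definition quadratic :: "(V8 \<Rightarrow> complex) \<Rightarrow> bool" where
  "quadratic q \<longleftrightarrow> (\<forall>c x. q (c *s x) = c\<^sup>2 * q x) \<and>
     (\<forall>x y. \<exists>b. \<forall>t. q (x + t *s y) = q x + t * b + t\<^sup>2 * q y)"

definition polar :: "(V8 \<Rightarrow> complex) \<Rightarrow> V8 \<Rightarrow> V8 \<Rightarrow> complex" where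
  "polar q x y = (q (x + y) - q x - q y) / 2"

lemma polar_sym: "polar q x y = polar q y x"
  by (simp add: polar_def add.commute)

lemma quadratic_polar:
  assumes q: "quadratic q"
  shows "polar q (x + y) z = polar q x z + polar q y z" "polar q (c *s x) z = c * polar q x z" "polar q x x = q x"
proof -
  have hom: "q (c *s x) = c\<^sup>2 * q x" for c x using q unfolding quadratic_def by blast
  have hom': "q (- x) = q x" "q (2 *s x) = 4 * q x" "q 0 = 0" for x
    using hom[of "-1" x] hom[of 2 x] hom[of 0 x] by simp_all
  have line: "q (x + t *s y) = q x + t * (q (x + y) - q x - q y) + t\<^sup>2 * q y" for x y t
  proof -
    obtain b where b: "\<And>t. q (x + t *s y) = q x + t * b + t\<^sup>2 * q y" using q unfolding quadratic_def by blast
    from b[of 1] have "b = q (x + y) - q x - q y" by simp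
    then show ?thesis using b by simp
  qed
  \<comment> \<open>The parallelogram law is the case t = -1. Additivity of the polar form is a
    linear combination of instances of it.\<close>
  have par: "q (x - y) = 2 * q x + 2 * q y - q (x + y)" for x y
    using line[of x "-1" y] by simp
  show "polar q (x + y) z = polar q x z + polar q y z"
  proof -
    have 1: "q (x + z - y) = 2 * q (x + z) + 2 * q y - q (x + z + y)" by (rule par)
    have 2: "q (y + z - x) = 2 * q (y + z) + 2 * q x - q (y + z + x)" by (rule par)
    have 3: "q (z - (x - y)) = 2 * q z + 2 * q (x - y) - q (z + (x - y))" by (rule par)
    have 4: "q (x - y) = 2 * q x + 2 * q y - q (x + y)" by (rule par)
    have e: "z - (x - y) = y + z - x" "z + (x - y) = x + z - y" "x + z + y = x + y + z" "y + z + x = x + y + z"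
      by (simp_all add: algebra_simps)
    have "q (x + y + z) = q (x + z) + q (y + z) + q (x + y) - q x - q y - q z"
      using 1 2 3 4 unfolding e by algebra
    then have "q (x + y + z) - q (x + y) - q z = (q (x + z) - q x - q z) + (q (y + z) - q y - q z)"
      by simp
    then show ?thesis unfolding polar_def add_divide_distrib[symmetric] by (simp only:)
  qed
  show "polar q (c *s x) z = c * polar q x z"
  proof -
    have "q (c *s x + z) - q (c *s x) - q z = c * (q (x + z) - q x - q z)"
      using line[of z c x] hom[of c x] by (simp add: add.commute algebra_simps)
    then show ?thesis unfolding polar_def by simp
  qed
  have "x + x = 2 *s x" by (simp add: vec_eq_iff)
  then show "polar q x x = q x" by (simp add: polar_def hom')
qed

lemma quadratic_polar':
  assumes "quadratic q"
  shows "polar q z (x + y) = polar q z x + polar q z y" "polar q z (c *s x) = c * polar q z x"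
  using quadratic_polar(1,2)[OF assms] by (simp_all add: polar_sym[of q z])

text \<open>Polarising a biquadratic form in one variable gives an expression of this shape in the
  other, so that it can be polarised a second time.\<close>

lemma quadratic_combine:
  assumes "quadratic p" "quadratic q" "quadratic r"
  shows "quadratic (\<lambda>x. (p x - q x - r x) / 2)"
  unfolding quadratic_def
proof (intro conjI allI)
  show "(p (c *s x) - q (c *s x) - r (c *s x)) / 2 = c\<^sup>2 * ((p x - q x - r x) / 2)" for c x
    using assms by (simp add: quadratic_def algebra_simps)
  fix x y
  obtain a b c where "\<And>t. p (x + t *s y) = p x + t * a + t\<^sup>2 * p y"
    "\<And>t. q (x + t *s y) = q x + t * b + t\<^sup>2 * q y" "\<And>t. r (x + t *s y) = r x + t * c + t\<^sup>2 * r y"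
    using assms unfolding quadratic_def by metis
  then show "\<exists>b. \<forall>t. (p (x + t *s y) - q (x + t *s y) - r (x + t *s y)) / 2 =
      (p x - q x - r x) / 2 + t * b + t\<^sup>2 * ((p y - q y - r y) / 2)"
    by (intro exI[of _ "(a - b - c) / 2"]) (simp add: field_simps)
qed

text \<open>The symmetries of the Riemann tensor: skew in the first pair, symmetric under exchange
  of the pairs, first Bianchi identity; skewness in the second pair follows. These tensors form the
  dual of the representation of GL(V_8) of shape (2, 2), which is the space of sections of
  O(2).\<close>

definition curvature :: "(8 \<Rightarrow> 8 \<Rightarrow> 8 \<Rightarrow> 8 \<Rightarrow> complex) \<Rightarrow> bool" where
  "curvature r \<longleftrightarrow> (\<forall>i j k l. r j i k l = - r i j k l \<and> r k l i j = r i j k l \<and>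
      r i j k l + r j k i l + r k i j l = 0)"

definition contract :: "(8 \<Rightarrow> 8 \<Rightarrow> 8 \<Rightarrow> 8 \<Rightarrow> complex) \<Rightarrow> V8 \<Rightarrow> V8 \<Rightarrow> V8 \<Rightarrow> V8 \<Rightarrow> complex" where
  "contract r x y z w = (\<Sum>i\<in>UNIV. \<Sum>j\<in>UNIV. \<Sum>k\<in>UNIV. \<Sum>l\<in>UNIV. r i j k l * (x $ i * y $ j * z $ k * w $ l))"

lemma contract_linear:
  "contract r (x + x') y z w = contract r x y z w + contract r x' y z w"
  "contract r x (y + y') z w = contract r x y z w + contract r x y' z w"
  "contract r x y (z + z') w = contract r x y z w + contract r x y z' w"
  "contract r x y z (w + w') = contract r x y z w + contract r x y z w'"
  "contract r (c *s x) y z w = c * contract r x y z w"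
  "contract r x (c *s y) z w = c * contract r x y z w"
  "contract r x y (c *s z) w = c * contract r x y z w"
  "contract r x y z (c *s w) = c * contract r x y z w"
  by (simp_all add: contract_def algebra_simps sum.distrib sum_distrib_left)

lemma sum_swap_pairs:
  "(\<Sum>k\<in>K. \<Sum>l\<in>L. \<Sum>i\<in>I. \<Sum>j\<in>J. g i j k l) = (\<Sum>i\<in>I. \<Sum>j\<in>J. \<Sum>k\<in>K. \<Sum>l\<in>L. g i j k l)"
proof -
  have "(\<Sum>k\<in>K. \<Sum>l\<in>L. \<Sum>i\<in>I. \<Sum>j\<in>J. g i j k l) = (\<Sum>k\<in>K. \<Sum>i\<in>I. \<Sum>l\<in>L. \<Sum>j\<in>J. g i j k l)"
    by (intro sum.cong refl) (rule sum.swap)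
  also have "\<dots> = (\<Sum>i\<in>I. \<Sum>k\<in>K. \<Sum>l\<in>L. \<Sum>j\<in>J. g i j k l)" by (rule sum.swap)
  also have "\<dots> = (\<Sum>i\<in>I. \<Sum>k\<in>K. \<Sum>j\<in>J. \<Sum>l\<in>L. g i j k l)"
    by (intro sum.cong refl) (rule sum.swap)
  also have "\<dots> = (\<Sum>i\<in>I. \<Sum>j\<in>J. \<Sum>k\<in>K. \<Sum>l\<in>L. g i j k l)"
    by (intro sum.cong refl) (rule sum.swap)
  finally show ?thesis .
qed

lemma contract_pair:
  assumes "curvature r"
  shows "contract r z w x y = contract r x y z w"
proof -
  have r: "r k l i j = r i j k l" for i j k l using assms unfolding curvature_def by blast
  have "contract r z w x y = (\<Sum>k\<in>UNIV. \<Sum>l\<in>UNIV. \<Sum>i\<in>UNIV. \<Sum>j\<in>UNIV. r i j k l * (x $ i * y $ j * z $ k * w $ l))"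
    unfolding contract_def by (intro sum.cong refl) (subst r, simp add: ac_simps)
  also have "\<dots> = contract r x y z w" unfolding contract_def by (rule sum_swap_pairs)
  finally show ?thesis .
qed

lemma contract_skew:
  assumes "curvature r"
  shows "contract r y x z w = - contract r x y z w" "contract r x y w z = - contract r x y z w"
proof -
  show 1: "contract r y x z w = - contract r x y z w" for x y z w
  proof -
    have "contract r y x z w = (\<Sum>j\<in>UNIV. \<Sum>i\<in>UNIV. \<Sum>k\<in>UNIV. \<Sum>l\<in>UNIV. - (r i j k l * (x $ i * y $ j * z $ k * w $ l)))"
    proof -
      have r: "r j i k l = - r i j k l" for i j k l using assms unfolding curvature_def by blast
      show ?thesis unfolding contract_def by (intro sum.cong refl) (subst r, simp add: ac_simps)
    qed
    also have "\<dots> = - contract r x y z w" unfolding contract_def sum_negf by (subst sum.swap) (rule refl)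
    finally show ?thesis .
  qed
  show "contract r x y w z = - contract r x y z w"
    using contract_pair[OF assms, of x y w z] contract_pair[OF assms, of x y z w] 1[of w z x y]
    by simp
qed

lemma linear_axis:
  fixes f :: "V8 \<Rightarrow> complex"
  assumes "\<And>x y. f (x + y) = f x + f y" "\<And>c x. f (c *s x) = c * f x"
  shows "f x = (\<Sum>i\<in>UNIV. x $ i * f (axis i 1))"
proof -
  have 0: "f 0 = 0" using assms(2)[of 0 0] by simp
  have "f (\<Sum>i\<in>A. g i) = (\<Sum>i\<in>A. f (g i))" if "finite A" for A and g :: "8 \<Rightarrow> V8"
    using that by (induction A) (auto simp: assms(1) 0)
  from this[of UNIV "\<lambda>i. x $ i *s axis i 1"] show ?thesis
    by (simp add: sum_scaled_axis assms(2))
qed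

lemma contract_multilinear:
  assumes "\<And>y z w. \<forall>x x' c. R (x + x') y z w = R x y z w + R x' y z w \<and> R (c *s x) y z w = c * R x y z w"
    "\<And>x z w. \<forall>y y' c. R x (y + y') z w = R x y z w + R x y' z w \<and> R x (c *s y) z w = c * R x y z w"
    "\<And>x y w. \<forall>z z' c. R x y (z + z') w = R x y z w + R x y z' w \<and> R x y (c *s z) w = c * R x y z w"
    "\<And>x y z. \<forall>w w' c. R x y z (w + w') = R x y z w + R x y z w' \<and> R x y z (c *s w) = c * (R x y z w :: complex)"
  shows "R x y z w = contract (\<lambda>i j k l. R (axis i 1) (axis j 1) (axis k 1) (axis l 1)) x y z w"
proof -
  have 1: "R x y z w = (\<Sum>i\<in>UNIV. x $ i * R (axis i 1) y z w)" for x y z w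
    using assms(1)[of y z w] by (intro linear_axis[of "\<lambda>x. R x y z w"]) auto
  have 2: "R x y z w = (\<Sum>i\<in>UNIV. y $ i * R x (axis i 1) z w)" for x y z w
    using assms(2)[of x z w] by (intro linear_axis[of "\<lambda>y. R x y z w"]) auto
  have 3: "R x y z w = (\<Sum>i\<in>UNIV. z $ i * R x y (axis i 1) w)" for x y z w
    using assms(3)[of x y w] by (intro linear_axis[of "\<lambda>z. R x y z w"]) auto
  have 4: "R x y z w = (\<Sum>i\<in>UNIV. w $ i * R x y z (axis i 1))" for x y z w
    using assms(4)[of x y z] by (intro linear_axis[of "\<lambda>w. R x y z w"]) auto
  show ?thesis
    unfolding contract_def
    by (subst 1, intro sum.cong refl, subst 2, unfold sum_distrib_left, intro sum.cong refl,
        subst 3, unfold sum_distrib_left, intro sum.cong refl, subst 4, unfold sum_distrib_left, intro sum.cong refl)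
      (simp add: algebra_simps)
qed

text \<open>The polarisation of a biquadratic form \<open>F\<close> on pairs of vectors, depending only on their span, is
  a symmetric version of an algebraic curvature tensor.\<close>

lemma biquadratic_curvature:
  assumes sym: "\<And>u w. F u w = F w u" and q: "\<And>w. quadratic (\<lambda>u. F u w)"
    and shear: "\<And>u w. F (u + w) w = F u w" and diag: "\<And>u. F u u = 0"
  obtains r where "curvature r" "\<And>u w. F u w = contract r u w u w"
proof -
  define B where "B w x x' = polar (\<lambda>u. F u w) x x'" for w x x'
  have Bq: "quadratic (\<lambda>w. B w x x')" for x x'
  proof -
    have "quadratic (\<lambda>w. F u w)" for u
    proof -
      have "(\<lambda>w. F u w) = (\<lambda>w. F w u)" by (rule ext) (rule sym)
      then show ?thesis by (rule ssubst) (rule q)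
    qed
    then show ?thesis unfolding B_def polar_def by (intro quadratic_combine)
  qed
  \<comment> \<open>The full polarisation of F: symmetric within each pair, and under exchange of
    the pairs because F is symmetric.\<close>
  define C where "C x x' y y' = polar (\<lambda>w. B w x x') y y'" for x x' y y'
  have C3: "C x x' (y + z) y' = C x x' y y' + C x x' z y'" "C x x' (c *s y) y' = c * C x x' y y'"
     "C x x' y' (y + z) = C x x' y' y + C x x' y' z" "C x x' y' (c *s y) = c * C x x' y' y"
     "C x x' y y = B y x x'" for x x' y y' z c
    unfolding C_def by (simp_all only: quadratic_polar[OF Bq] quadratic_polar'[OF Bq])
  have Csym: "C x x' y y' = C x' x y y'" "C x x' y y' = C x x' y' y" for x x' y y'
    unfolding C_def B_def by (simp_all add: polar_def add.commute algebra_simps)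
  have Cpair: "C x x' y y' = C y y' x x'" for x x' y y'
  proof -
    have "C x x' y y' = (F (x + x') (y + y') - F x (y + y') - F x' (y + y') - (F (x + x') y - F x y - F x' y)
        - (F (x + x') y' - F x y' - F x' y')) / 4" for x x' y y'
      unfolding C_def B_def polar_def by (simp add: field_simps)
    from this[of x x' y y'] this[of y y' x x'] show ?thesis
      by (simp only: sym[of "y + y'"] sym[of y] sym[of y']) (simp add: algebra_simps)
  qed
  have C1: "C (x + z) x' y y' = C x x' y y' + C z x' y y'" "C (c *s x) x' y y' = c * C x x' y y'"
    "C x' (x + z) y y' = C x' x y y' + C x' z y y'" "C x' (c *s x) y y' = c * C x' x y y'" for x x' y y' z c
    by (simp_all only: Cpair[of _ _ y y'] C3(1-4))
  have Bww: "B w x w = 0" for w x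
    unfolding B_def polar_def by (simp add: shear diag)
  \<comment> \<open>The polarisation in w of the cubic identity C x w w w = 0, which holds because
    F(x + w, w) = F(x, w) and F(w, w) = 0.\<close>
  have cyc: "C x a b c + C x b a c + C x c a b = 0" for x a b c
  proof -
    have T: "C x w w w = 0" for w using Bww by (simp add: C3(5))
    have "C x (a + b + c) (a + b + c) (a + b + c) - C x (a + b) (a + b) (a + b) - C x (a + c) (a + c) (a + c)
       - C x (b + c) (b + c) (b + c) + C x a a a + C x b b b + C x c c c
      = 2 * (C x a b c + C x b a c + C x c a b)"
      by (simp add: C1 C3(1-4) Csym(2)[of x a c b] Csym(2)[of x b c a] Csym(2)[of x c b a] algebra_simps)
    then have "0 = 2 * (C x a b c + C x b a c + C x c a b)" unfolding T by (simp only: diff_self add_0)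
    then show ?thesis by (metis mult_eq_0_iff zero_neq_numeral)
  qed
  \<comment> \<open>The cyclic identity gives C u w u w = - F u w / 2, so F u w - C u w u w is 3/2
    times F u w; the constant 2/3 compensates this factor.\<close>
  define h :: complex where "h = 2 / 3"
  define R where "R x y z w = h * (C x z y w - C x w y z)" for x y z w
  define r where "r i j k l = R (axis i 1) (axis j 1) (axis k 1) (axis l 1)" for i j k l
  have "R x y z w = contract r x y z w" for x y z w
    unfolding r_def by (rule contract_multilinear) (simp_all add: R_def C1 C3(1-4) algebra_simps)
  moreover have "F u w = R u w u w" for u w
  proof -
    have "C u u w w + C u w u w + C u w u w = 0" using cyc[of u u w w] by simp
    moreover have "C u u w w = F u w"
      unfolding C3(5) B_def by (rule quadratic_polar(3)[OF q])
    ultimately have "F u w = - 2 * C u w u w" by (simp add: add_eq_0_iff2)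
    moreover have "R u w u w = h * (F u w - C u w u w)"
      unfolding R_def \<open>C u u w w = F u w\<close> Csym(2)[of u w w u] ..
    ultimately show ?thesis by (simp add: h_def)
  qed
  moreover have "curvature r"
    unfolding curvature_def r_def
  proof (intro allI conjI)
    fix i j k l :: 8
    let ?e = "\<lambda>i :: 8. axis i (1 :: complex)"
    have p: "C x z y w = C y w x z" for x y z w by (rule Cpair)
    show "R (?e k) (?e l) (?e i) (?e j) = R (?e i) (?e j) (?e k) (?e l)"
      unfolding R_def
      using Csym(1)[of "?e i" "?e k"] Csym(2)[of "?e k" "?e i" "?e l" "?e j"] p[of "?e k" "?e j" "?e l" "?e i"]
        Csym(1)[of "?e l" "?e i"] Csym(2)[of "?e i" "?e l" "?e k" "?e j"] by simp
    show "R (?e j) (?e i) (?e k) (?e l) = - R (?e i) (?e j) (?e k) (?e l)"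
      unfolding R_def using p[of "?e j" "?e k" "?e i" "?e l"] p[of "?e j" "?e l" "?e i" "?e k"] by (simp add: algebra_simps)
    show "R (?e i) (?e j) (?e k) (?e l) + R (?e j) (?e k) (?e i) (?e l) + R (?e k) (?e i) (?e j) (?e l) = 0"
      unfolding R_def using p[of "?e i" "?e k" "?e j" "?e l"] p[of "?e j" "?e i" "?e k" "?e l"] p[of "?e k" "?e j" "?e i" "?e l"]
        Csym by (simp add: algebra_simps)
  qed
  ultimately show ?thesis using that by metis
qed

definition e8 :: "8 \<Rightarrow> V8" where "e8 i = axis i 1"

lemma e8_nth [simp]: "e8 i $ j = (if j = i then 1 else 0)"
  by (simp add: e8_def axis_def)

text \<open>The two families are half the derivatives of R(u, w, u, w) in w and, up to sign, in u.
  The value itself is covered by linearity in the last argument.\<close>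

definition singular_tensor :: "(8 \<Rightarrow> 8 \<Rightarrow> 8 \<Rightarrow> 8 \<Rightarrow> complex) \<Rightarrow> frame \<Rightarrow> bool" where
  "singular_tensor r M \<longleftrightarrow> (\<forall>k. contract r (M $ 1) (M $ 2) (M $ 1) (e8 k) = 0 \<and> contract r (M $ 1) (M $ 2) (M $ 2) (e8 k) = 0)"

lemma curvatureD:
  assumes "curvature r"
  shows "r j i k l = - r i j k l" "r k l i j = r i j k l" "r i j k l + r j k i l + r k i j l = 0"
  using assms unfolding curvature_def by iprover+

lemma curvature_combine:
  assumes "curvature r" "curvature r'"
  shows "curvature (\<lambda>i j k l. a * r i j k l + b * r' i j k l)"
  unfolding curvature_def
proof (intro allI conjI)
  fix i j k l
  show "a * r j i k l + b * r' j i k l = - (a * r i j k l + b * r' i j k l)"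
    using curvatureD(1)[OF assms(1), of j i k l] curvatureD(1)[OF assms(2), of j i k l] by algebra
  show "a * r k l i j + b * r' k l i j = a * r i j k l + b * r' i j k l"
    using curvatureD(2)[OF assms(1), of k l i j] curvatureD(2)[OF assms(2), of k l i j] by simp
  show "a * r i j k l + b * r' i j k l + (a * r j k i l + b * r' j k i l) + (a * r k i j l + b * r' k i j l) = 0"
    using curvatureD(3)[OF assms(1), of i j k l] curvatureD(3)[OF assms(2), of i j k l] by algebra
qed

lemma contract_combine:
  "contract (\<lambda>i j k l. a * r i j k l + b * r' i j k l) x y z w = a * contract r x y z w + b * contract r' x y z w"
  by (simp add: contract_def sum_distrib_left sum.distrib distrib_right mult.assoc)

lemma singular_tensor_combine:
  "singular_tensor r M \<Longrightarrow> singular_tensor r' M \<Longrightarrow> singular_tensor (\<lambda>i j k l. a * r i j k l + b * r' i j k l) M"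
  by (simp add: singular_tensor_def contract_combine)

lemma pl_combine:
  "pl (frame_of (a *s u + b *s w) (c *s u + d *s w)) i j = (a * d - b * c) * pl (frame_of u w) i j"
  by (simp add: pl_def algebra_simps)

text \<open>Values of a section on dependent pairs are arbitrary; zero is the value that a
  biquadratic form depending only on the span must have there.\<close>

definition extended :: "(frame \<Rightarrow> complex) \<Rightarrow> V8 \<Rightarrow> V8 \<Rightarrow> complex" where
  "extended s u w = (if rank (frame_of u w) = 2 then s (frame_of u w) else 0)"

lemma extended_mult:
  assumes "is_section_O2 s"
  shows "extended s (a *s u + b *s w) (c *s u + d *s w) = (a * d - b * c)\<^sup>2 * extended s u w"
proof (cases "a * d - b * c = 0")
  case True
  then have "rank (frame_of (a *s u + b *s w) (c *s u + d *s w)) \<noteq> 2"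
    unfolding rank_2_pl pl_combine by simp
  with True show ?thesis by (simp add: extended_def)
next
  case False
  then have "rank (frame_of (a *s u + b *s w) (c *s u + d *s w)) = 2 \<longleftrightarrow> rank (frame_of u w) = 2"
    unfolding rank_2_pl pl_combine by simp
  with False section_mult[OF assms _ False, of u w] show ?thesis by (simp add: extended_def)
qed

lemma dependent_if_rank:
  assumes "rank (frame_of y w) \<noteq> 2" "w \<noteq> 0"
  obtains c where "y = c *s w"
proof -
  obtain j where j: "w $ j \<noteq> 0" using assms(2) by (auto simp: vec_eq_iff)
  have "y $ i * w $ j - y $ j * w $ i = 0" for i using assms(1) by (auto simp: rank_2_pl pl_def)
  then have "y = (y $ j / w $ j) *s w" using j by (simp add: vec_eq_iff field_simps)
  then show thesis by (rule that)
qed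

text \<open>If u and z stay independent modulo w, this is \<open>section_line\<close>. Otherwise,
  for nonzero w, there is a relation a u + b z = c w, which makes u a multiple of w or z a
  combination of u and w; the function of t is then a constant times the square of a polynomial of
  degree at most one.\<close>

lemma extended_line:
  assumes s: "is_section_O2 s"
  shows "\<exists>b. \<forall>t. extended s (u + t *s z) w = extended s u w + t * b + t\<^sup>2 * extended s z w"
proof (cases "\<forall>a b. a \<noteq> 0 \<or> b \<noteq> 0 \<longrightarrow> rank (frame_of (a *s u + b *s z) w) = 2")
  case True
  then have r: "rank (frame_of (u + t *s z) w) = 2" "rank (frame_of z w) = 2" for t
    using True[rule_format, of 1 t] True[rule_format, of 0 1] by simp_all
  show ?thesis
    using section_line[OF s True[rule_format]] r r(1)[of 0] unfolding extended_def by simp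
next
  case False
  then obtain a b where ab: "a \<noteq> 0 \<or> b \<noteq> 0" and dep: "rank (frame_of (a *s u + b *s z) w) \<noteq> 2"
    unfolding not_all not_imp by (elim exE conjE)
  have lin: "extended s (c *s x + d *s w) w = c\<^sup>2 * extended s x w" for c d x
    using extended_mult[OF s, of c x d w 0 1] by simp
  show ?thesis
  proof (cases "w = 0")
    case True
    have "extended s x 0 = 0" for x using extended_mult[OF s, of 1 x 0 x 0 0] by simp
    then show ?thesis unfolding True by simp
  next
    case False
    obtain c where c: "a *s u + b *s z = c *s w" using dependent_if_rank[OF dep False] .
    have c': "a * u $ i + b * z $ i = c * w $ i" for i using c by (simp add: vec_eq_iff)
    show ?thesis
    proof (cases "b = 0")
      case True
      then have u: "u = (c / a) *s w" using c' ab by (simp add: vec_eq_iff field_simps)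
      have "extended s (u + t *s z) w = t\<^sup>2 * extended s z w" for t
        using lin[of t z "c / a"] unfolding u by (simp add: add.commute)
      moreover have "extended s u w = 0" using lin[of 0 z "c / a"] unfolding u by simp
      ultimately show ?thesis by (intro exI[of _ 0]) simp
    next
      case b: False
      have z: "z $ i = (c * w $ i - a * u $ i) / b" for i using c'[of i] b by (simp add: field_simps)
      have e: "u + t *s z = (1 - t * a / b) *s u + (t * c / b) *s w" for t
        using b by (simp add: vec_eq_iff z field_simps)
      have 1: "extended s (u + t *s z) w = (1 - t * a / b)\<^sup>2 * extended s u w" for t
        unfolding e by (rule lin)
      have e': "z = (- a / b) *s u + (c / b) *s w" using b by (simp add: vec_eq_iff z field_simps)
      have 2: "extended s z w = (- a / b)\<^sup>2 * extended s u w"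
        by (subst e') (rule lin)
      show ?thesis unfolding 1 2
        by (intro exI[of _ "- 2 * a / b * extended s u w"]) (use b in \<open>simp add: field_simps power2_eq_square\<close>)
    qed
  qed
qed

text \<open>Extended by zero, a section is symmetric, unchanged by adding w to u, zero on the
  diagonal, and quadratic in each vector. These are the hypotheses of
  \<open>biquadratic_curvature\<close>.\<close>

lemma section_curvature:
  assumes s: "is_section_O2 s"
  obtains r where "curvature r" "\<And>M. rank M = 2 \<Longrightarrow> s M = contract r (M $ 1) (M $ 2) (M $ 1) (M $ 2)"
proof (rule biquadratic_curvature)
  note m = extended_mult[OF s]
  show "extended s u w = extended s w u" for u w using m[of 0 w 1 u 1 0] by simp
  show "extended s (u + w) w = extended s u w" for u w using m[of 1 u 1 w 0 1] by simp
  show "extended s u u = 0" for u using m[of 1 u 0 u 1 0] by simp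
  have "extended s (c *s u) w = c\<^sup>2 * extended s u w" for c u w using m[of c u 0 w 0 1] by simp
  then show "quadratic (\<lambda>u. extended s u w)" for w
    unfolding quadratic_def using extended_line[OF s] by simp
next
  fix r assume r: "curvature r" "\<And>u w. extended s u w = contract r u w u w"
  have "s M = contract r (M $ 1) (M $ 2) (M $ 1) (M $ 2)" if "rank M = 2" for M
    using r(2)[of "M $ 1" "M $ 2"] that by (simp add: extended_def)
  with r(1) show thesis by (rule that)
qed

lemma derivative_zero_quadratic:
  fixes f :: "complex \<Rightarrow> complex"
  assumes "(f has_field_derivative 0) (at 0)" "\<forall>\<^sub>F t in nhds 0. f t = a + t * b + t\<^sup>2 * c"
  shows "b = 0"
proof -
  have "((\<lambda>t. a + t * b + t\<^sup>2 * c) has_field_derivative b) (at 0)"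
    by (auto intro!: derivative_eq_intros)
  then have "(f has_field_derivative b) (at 0)"
    using DERIV_cong_ev[OF refl assms(2) refl] by blast
  with assms(1) show ?thesis using DERIV_unique by blast
qed

text \<open>Moving only one row of M in a coordinate direction makes the section a quadratic
  polynomial in t near 0; pair symmetry gives its linear coefficient as twice a component of R, and
  singularity makes it zero.\<close>

lemma singular_at_tensor:
  assumes sing: "singular_at s (vec.span (rows M))" and M: "is_basis_of M (vec.span (rows M))"
    and r: "curvature r" "\<And>M. rank M = 2 \<Longrightarrow> s M = contract r (M $ 1) (M $ 2) (M $ 1) (M $ 2)"
  shows "singular_tensor r M"
proof -
  let ?N = "\<lambda>x y t. frame_of (M $ 1 + t *s x) (M $ 2 + t *s y)"
  have rk: "rank M = 2" using M by (simp add: is_basis_of_def)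
  have ev: "\<forall>\<^sub>F t in nhds 0. s (?N x y t) = contract r (M $ 1 + t *s x) (M $ 2 + t *s y) (M $ 1 + t *s x) (M $ 2 + t *s y)" for x y
  proof -
    obtain i j where ij: "pl M i j \<noteq> 0" using rk rank_2_pl by blast
    have "open {t. pl (?N x y t) i j \<noteq> 0}"
      unfolding pl_def frame_of_nth vector_add_component vector_smult_component
      by (intro open_Collect_neq continuous_intros)
    moreover have "0 \<in> {t. pl (?N x y t) i j \<noteq> 0}" using ij by simp
    ultimately have "\<forall>\<^sub>F t in nhds 0. pl (?N x y t) i j \<noteq> 0" using eventually_nhds by blast
    then show ?thesis
      by eventually_elim (subst r(2), auto simp: rank_2_pl)
  qed
  have der: "((\<lambda>t. s (?N x y t)) has_field_derivative 0) (at 0)" for x y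
  proof -
    have "(\<chi> k l. M $ k $ l + t * frame_of x y $ k $ l) = ?N x y t" for t
      by (rule frame_eqI) (simp_all add: vec_eq_iff)
    then show ?thesis
      using conjunct2[OF sing[unfolded singular_at_def, rule_format, OF M], rule_format, of "frame_of x y"] by (simp only:)
  qed
  show ?thesis
    unfolding singular_tensor_def
  proof (intro allI conjI)
    fix k
    let ?u = "M $ 1" and ?w = "M $ 2" and ?e = "e8 k"
    have "\<forall>\<^sub>F t in nhds 0. s (?N 0 ?e t) = contract r ?u ?w ?u ?w + t * (2 * contract r ?u ?w ?u ?e) + t\<^sup>2 * contract r ?u ?e ?u ?e"
      using ev[of 0 ?e]
      by eventually_elim (simp add: contract_linear contract_pair[OF r(1), of ?u ?w ?u ?e] algebra_simps power2_eq_square)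
    from derivative_zero_quadratic[OF der this] show "contract r ?u ?w ?u ?e = 0" by simp
    have "\<forall>\<^sub>F t in nhds 0. s (?N ?e 0 t) = contract r ?u ?w ?u ?w + t * (2 * contract r ?u ?w ?e ?w) + t\<^sup>2 * contract r ?e ?w ?e ?w"
      using ev[of ?e 0]
      by eventually_elim (simp add: contract_linear contract_pair[OF r(1), of ?u ?w ?e ?w] algebra_simps power2_eq_square)
    from derivative_zero_quadratic[OF der this] show "contract r ?u ?w ?w ?e = 0"
      using contract_skew(2)[OF r(1), of ?u ?w ?e ?w] by simp
  qed
qed

section \<open>Constructible sets and generic 4-vectors\<close>

definition coord_polys :: "(('k \<Rightarrow> complex) \<Rightarrow> complex) set" where
  "coord_polys = poly_functions {\<lambda>x. x k | k. True}"

lemma coord_polys_intros: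
  "(\<lambda>_. c) \<in> coord_polys"
  "(\<lambda>x. x k) \<in> coord_polys"
  "f \<in> coord_polys \<Longrightarrow> g \<in> coord_polys \<Longrightarrow> (\<lambda>x. f x + g x) \<in> coord_polys"
  "f \<in> coord_polys \<Longrightarrow> g \<in> coord_polys \<Longrightarrow> (\<lambda>x. f x * g x) \<in> coord_polys"
  "f \<in> coord_polys \<Longrightarrow> g \<in> coord_polys \<Longrightarrow> (\<lambda>x. f x - g x) \<in> coord_polys"
  unfolding coord_polys_def by (auto intro: poly_intros poly_functions.coord)

inductive_set constructible :: "('k \<Rightarrow> complex) set set" where
  zeros: "p \<in> coord_polys \<Longrightarrow> {x. p x = 0} \<in> constructible"
| Compl: "A \<in> constructible \<Longrightarrow> - A \<in> constructible"
| Un: "A \<in> constructible \<Longrightarrow> B \<in> constructible \<Longrightarrow> A \<union> B \<in> constructible"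

lemma constructible_Int: "A \<in> constructible \<Longrightarrow> B \<in> constructible \<Longrightarrow> A \<inter> B \<in> constructible"
  using constructible.Compl[OF constructible.Un[OF constructible.Compl constructible.Compl], of A B] by simp

lemma constructible_UNIV: "UNIV \<in> constructible"
  using constructible.zeros[OF coord_polys_intros(1)[of 0]] by simp

lemma constructible_empty: "{} \<in> constructible"
  using constructible.Compl[OF constructible_UNIV] by simp

lemma constructible_UN: "finite I \<Longrightarrow> (\<And>i. i \<in> I \<Longrightarrow> A i \<in> constructible) \<Longrightarrow> (\<Union>i\<in>I. A i) \<in> constructible"
  by (induction rule: finite_induct) (auto intro: constructible_empty constructible.Un)

lemma constructible_INT: "finite I \<Longrightarrow> (\<And>i. i \<in> I \<Longrightarrow> A i \<in> constructible) \<Longrightarrow> (\<Inter>i\<in>I. A i) \<in> constructible"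
  by (induction rule: finite_induct) (auto intro: constructible_UNIV constructible_Int)

text \<open>One inequation suffices for closure under intersection, since several inequations
  multiply to one.\<close>

definition basic :: "('k \<Rightarrow> complex) set set" where
  "basic = {{x. (\<forall>p\<in>P. p x = 0) \<and> q x \<noteq> 0} | P q. finite P \<and> P \<subseteq> coord_polys \<and> q \<in> coord_polys}"

definition basic_unions :: "('k \<Rightarrow> complex) set set" where
  "basic_unions = {\<Union>F | F. finite F \<and> F \<subseteq> basic}"

lemma basicI:
  assumes "finite P" "P \<subseteq> coord_polys" "q \<in> coord_polys"
  shows "{x. (\<forall>p\<in>P. p x = 0) \<and> q x \<noteq> 0} \<in> basic"
  unfolding basic_def using assms by blast

lemma basicE:
  assumes "A \<in> basic"
  obtains P q where "A = {x. (\<forall>p\<in>P. p x = 0) \<and> q x \<noteq> 0}" "finite P" "P \<subseteq> coord_polys" "q \<in> coord_polys"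
  using assms unfolding basic_def by (elim CollectE exE conjE) (rule that)

lemma basic_unionsE:
  assumes "A \<in> basic_unions"
  obtains F where "A = \<Union>F" "finite F" "F \<subseteq> basic"
  using assms unfolding basic_unions_def by (elim CollectE exE conjE) (rule that)

lemma basic_Int:
  assumes "A \<in> basic" "B \<in> basic"
  shows "A \<inter> B \<in> basic"
proof -
  obtain P q P' q' where A: "A = {x. (\<forall>p\<in>P. p x = 0) \<and> q x \<noteq> 0}" "finite P" "P \<subseteq> coord_polys" "q \<in> coord_polys"
    and B: "B = {x. (\<forall>p\<in>P'. p x = 0) \<and> q' x \<noteq> 0}" "finite P'" "P' \<subseteq> coord_polys" "q' \<in> coord_polys"
    using assms unfolding basic_def by blast
  have "A \<inter> B = {x. (\<forall>p\<in>P \<union> P'. p x = 0) \<and> q x * q' x \<noteq> 0}" using A(1) B(1) by auto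
  moreover have "(\<lambda>x. q x * q' x) \<in> coord_polys" using A B by (intro coord_polys_intros)
  ultimately show ?thesis using A B by (simp only: basicI finite_Un Un_subset_iff)
qed

lemma basic_unions_Un:
  assumes "A \<in> basic_unions" "B \<in> basic_unions"
  shows "A \<union> B \<in> basic_unions"
proof -
  obtain F G where "finite F" "F \<subseteq> basic" "A = \<Union>F" "finite G" "G \<subseteq> basic" "B = \<Union>G"
    using assms unfolding basic_unions_def by blast
  then have "finite (F \<union> G)" "F \<union> G \<subseteq> basic" "A \<union> B = \<Union>(F \<union> G)" by simp_all
  then show ?thesis unfolding basic_unions_def by blast
qed

lemma basic_unions_Int:
  assumes "A \<in> basic_unions" "B \<in> basic_unions"
  shows "A \<inter> B \<in> basic_unions"
proof -
  obtain F G where FG: "finite F" "F \<subseteq> basic" "A = \<Union>F" "finite G" "G \<subseteq> basic" "B = \<Union>G"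
    using assms unfolding basic_unions_def by blast
  let ?H = "(\<lambda>(C, D). C \<inter> D) ` (F \<times> G)"
  have "A \<inter> B = \<Union>?H" unfolding FG(3,6) by auto
  moreover have "?H \<subseteq> basic"
  proof
    fix X assume "X \<in> ?H"
    then obtain C D where "C \<in> F" "D \<in> G" "X = C \<inter> D" by auto
    then show "X \<in> basic" using FG basic_Int by blast
  qed
  moreover have "finite ?H" using FG(1,4) by simp
  ultimately show ?thesis unfolding basic_unions_def by blast
qed

lemma basic_in_basic_unions:
  assumes "A \<in> basic"
  shows "A \<in> basic_unions"
  unfolding basic_unions_def using assms by (intro CollectI exI[of _ "{A}"]) simp

text \<open>The normal form is proved for a set together with its complement, which makes the
  complement step of the induction trivial.\<close>

lemma constructible_union_basic:
  assumes "A \<in> constructible"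
  shows "A \<in> basic_unions"
proof -
  have "A \<in> basic_unions \<and> - A \<in> basic_unions"
    using assms
  proof induction
    case (zeros p)
    have "{x. (\<forall>p\<in>{p}. p x = 0) \<and> 1 \<noteq> (0::complex)} \<in> basic" "{x. (\<forall>p\<in>{}. p x = 0) \<and> p x \<noteq> 0} \<in> basic"
      using zeros basicI[of "{p}" "\<lambda>_. 1"] basicI[of "{}" p] coord_polys_intros(1)[of 1] by auto
    then show ?case by (simp add: Collect_neg_eq basic_in_basic_unions)
  next
    case (Compl A)
    then show ?case by simp
  next
    case (Un A B)
    then show ?case by (simp add: basic_unions_Un basic_unions_Int)
  qed
  then show ?thesis ..
qed

section \<open>Elimination of one variable\<close>

definition coeffs_in :: "'k \<Rightarrow> (('k \<Rightarrow> complex) \<Rightarrow> complex) set" where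
  "coeffs_in k = {f \<in> coord_polys. \<forall>x t. f (x(k := t)) = f x}"

lemma coeffs_in_intros:
  "(\<lambda>_. c) \<in> coeffs_in k"
  "f \<in> coeffs_in k \<Longrightarrow> g \<in> coeffs_in k \<Longrightarrow> (\<lambda>x. f x + g x) \<in> coeffs_in k"
  "f \<in> coeffs_in k \<Longrightarrow> g \<in> coeffs_in k \<Longrightarrow> (\<lambda>x. f x * g x) \<in> coeffs_in k"
  "f \<in> coeffs_in k \<Longrightarrow> g \<in> coeffs_in k \<Longrightarrow> (\<lambda>x. f x - g x) \<in> coeffs_in k"
  by (auto simp: coeffs_in_def intro: coord_polys_intros)

text \<open>A polynomial in the variable k whose coefficients are polynomials in the other
  variables. The number n bounds the formal length, not the degree: coefficient n - 1 may vanish at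
  some points, and n = 0 means the zero polynomial.\<close>

definition family :: "'k \<Rightarrow> nat \<Rightarrow> (('k \<Rightarrow> complex) \<Rightarrow> complex poly) \<Rightarrow> bool" where
  "family k n P \<longleftrightarrow> (\<forall>i. (\<lambda>x. coeff (P x) i) \<in> coeffs_in k) \<and> (\<forall>x. \<forall>i\<ge>n. coeff (P x) i = 0)"

lemma family_const:
  assumes "f \<in> coeffs_in k"
  shows "family k 1 (\<lambda>x. [:f x:])"
proof -
  have "(\<lambda>x. coeff [:f x:] i) \<in> coeffs_in k" for i
    using assms coeffs_in_intros(1)[of 0 k] by (cases i) (simp_all add: coeff_pCons)
  then show ?thesis by (auto simp: family_def coeff_pCons split: nat.split)
qed

lemma coeffs_in_sum: "(\<And>a. a \<in> A \<Longrightarrow> (\<lambda>x. f a x) \<in> coeffs_in k) \<Longrightarrow> (\<lambda>x. \<Sum>a\<in>A. f a x) \<in> coeffs_in k"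
  by (induction A rule: infinite_finite_induct) (auto intro: coeffs_in_intros)

lemma family_add:
  assumes "family k n P" "family k m Q"
  shows "family k (max n m) (\<lambda>x. P x + Q x)"
  using assms by (auto simp: family_def intro: coeffs_in_intros)

lemma family_mult:
  assumes "family k n P" "family k m Q"
  shows "family k (n + m) (\<lambda>x. P x * Q x)"
proof -
  have "(\<lambda>x. coeff (P x * Q x) i) \<in> coeffs_in k" for i
    unfolding coeff_mult by (intro coeffs_in_sum coeffs_in_intros) (use assms in \<open>auto simp: family_def\<close>)
  moreover have "coeff (P x * Q x) i = 0" if "n + m \<le> i" for x i
    unfolding coeff_mult
  proof (rule sum.neutral, rule ballI)
    fix j assume "j \<in> {..i}"
    then have "n \<le> j \<or> m \<le> i - j" using that by auto
    then show "coeff (P x) j * coeff (Q x) (i - j) = 0" using assms by (auto simp: family_def)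
  qed
  ultimately show ?thesis by (simp add: family_def)
qed

lemma poly_as_family:
  assumes "p \<in> coord_polys"
  shows "\<exists>n P. family k n P \<and> (\<forall>x t. p (x(k := t)) = poly (P x) t)"
  using assms unfolding coord_polys_def
proof induction
  case (const c)
  show ?case
    by (rule exI[of _ 1], rule exI[of _ "\<lambda>_. [:c:]"], rule conjI, rule family_const, rule coeffs_in_intros) simp
next
  case (coord f)
  then obtain j where f: "f = (\<lambda>x. x j)" by auto
  show ?case
  proof (cases "j = k")
    case True
    have "family k 2 (\<lambda>_. [:0, 1:])"
      by (auto simp: family_def coeff_pCons coeffs_in_intros split: nat.split)
    then show ?thesis using True f by (intro exI[of _ 2] exI[of _ "\<lambda>_. [:0, 1:]"]) simp
  next
    case False
    then have "f \<in> coeffs_in k" using f by (auto simp: coeffs_in_def intro: coord_polys_intros)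
    then show ?thesis using f False by (intro exI[of _ 1] exI[of _ "\<lambda>x. [:f x:]"] conjI family_const) auto
  qed
next
  case (add f g)
  then obtain n P m Q where *: "family k n P" "\<forall>x t. f (x(k := t)) = poly (P x) t" "family k m Q" "\<forall>x t. g (x(k := t)) = poly (Q x) t"
    by blast
  show ?case
    by (intro exI[of _ "max n m"] exI[of _ "\<lambda>x. P x + Q x"] conjI family_add *(1,3) allI)
      (simp only: poly_add *(2)[rule_format] *(4)[rule_format])
next
  case (mult f g)
  then obtain n P m Q where *: "family k n P" "\<forall>x t. f (x(k := t)) = poly (P x) t" "family k m Q" "\<forall>x t. g (x(k := t)) = poly (Q x) t"
    by blast
  show ?case
    by (intro exI[of _ "n + m"] exI[of _ "\<lambda>x. P x * Q x"] conjI family_mult *(1,3) allI)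
      (simp only: poly_mult *(2)[rule_format] *(4)[rule_format])
qed

lemma constructible_coeff_zero: "f \<in> coeffs_in k \<Longrightarrow> {x. f x = 0} \<in> constructible"
  by (rule constructible.zeros) (simp add: coeffs_in_def)

lemma constructible_family_zero:
  assumes "family k n P"
  shows "{x. P x = 0} \<in> constructible"
proof -
  have "P x = 0" if "\<And>i. i < n \<Longrightarrow> coeff (P x) i = 0" for x
  proof (rule poly_eqI)
    show "coeff (P x) i = coeff 0 i" for i
      using that[of i] assms by (cases "i < n") (simp_all add: family_def)
  qed
  then have "{x. P x = 0} = (\<Inter>i\<in>{..<n}. {x. coeff (P x) i = 0})" by auto
  also have "\<dots> \<in> constructible"
    by (intro constructible_INT constructible_coeff_zero) (use assms in \<open>auto simp: family_def\<close>)
  finally show ?thesis .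
qed

lemma family_truncate:
  assumes "family k (Suc n) P"
  shows "family k n (\<lambda>x. P x - monom (coeff (P x) n) n)"
proof -
  have e: "coeff (P x - monom (coeff (P x) n) n) i = (if i = n then 0 else coeff (P x) i)" for x i by simp
  have "(\<lambda>x. if i = n then 0 else coeff (P x) i) \<in> coeffs_in k" for i
    using assms by (cases "i = n") (auto simp: family_def coeffs_in_intros)
  then show ?thesis using assms unfolding family_def e by auto
qed

lemma family_mono: "family k n P \<Longrightarrow> n \<le> m \<Longrightarrow> family k m P"
  by (auto simp: family_def)

text \<open>One step of division with remainder that stays in the coefficient ring: cross
  multiplication by the formal leading coefficients cancels coefficient m.\<close>

lemma family_reduce:
  assumes P: "family k (Suc n) P" and Q: "family k (Suc m) Q" and "n \<le> m"
  shows "family k m (\<lambda>x. smult (coeff (P x) n) (Q x) - monom (coeff (Q x) m) (m - n) * P x)"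
proof -
  have e: "coeff (smult (coeff (P x) n) (Q x) - monom (coeff (Q x) m) (m - n) * P x) i =
     coeff (P x) n * coeff (Q x) i - (if m - n \<le> i then coeff (Q x) m * coeff (P x) (i - (m - n)) else 0)" for x i
    by (simp add: coeff_monom_mult)
  have "coeff (P x) n * coeff (Q x) i - (if m - n \<le> i then coeff (Q x) m * coeff (P x) (i - (m - n)) else 0) = 0"
    if "m \<le> i" for x i
  proof (cases "i = m")
    case False
    then have "Suc m \<le> i" "Suc n \<le> i - (m - n)" using that assms(3) by auto
    then have "coeff (Q x) i = 0" "coeff (P x) (i - (m - n)) = 0" using P Q by (auto simp: family_def)
    then show ?thesis by simp
  qed (use assms(3) in simp)
  moreover have "(\<lambda>x. coeff (P x) n * coeff (Q x) i - (if m - n \<le> i then coeff (Q x) m * coeff (P x) (i - (m - n)) else 0)) \<in> coeffs_in k" for i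
    using P Q by (cases "m - n \<le> i") (auto simp: family_def intro!: coeffs_in_intros)
  ultimately show ?thesis unfolding family_def e by blast
qed

text \<open>Multiplying Q by a power of the formal leading coefficient of P avoids denominators. The
  exponent is uniform in x, so the remainder is again a family.\<close>

lemma pseudo_remainder:
  assumes P: "family k (Suc n) P" and Q: "family k m Q"
  shows "\<exists>R e G. family k n R \<and> (\<forall>x. smult (coeff (P x) n ^ e) (Q x) = G x * P x + R x)"
  using Q
proof (induction m arbitrary: Q)
  case 0
  then show ?case by (intro exI[of _ Q] exI[of _ 0] exI[of _ "\<lambda>_. 0"]) (auto intro: family_mono)
next
  case (Suc m)
  show ?case
  proof (cases "n \<le> m")
    case True
    let ?Q = "\<lambda>x. smult (coeff (P x) n) (Q x) - monom (coeff (Q x) m) (m - n) * P x"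
    obtain R e G where R: "family k n R" "\<And>x. smult (coeff (P x) n ^ e) (?Q x) = G x * P x + R x"
      using Suc.IH[OF family_reduce[OF P Suc.prems True]] by blast
    have "smult (coeff (P x) n ^ Suc e) (Q x) =
        (G x + smult (coeff (P x) n ^ e) (monom (coeff (Q x) m) (m - n))) * P x + R x" for x
      using R(2)[of x] by (simp add: smult_diff_right algebra_simps)
    with R(1) show ?thesis by (intro exI conjI allI)
  next
    case False
    then show ?thesis using Suc.prems
      by (intro exI[of _ Q] exI[of _ 0] exI[of _ "\<lambda>_. 0"]) (auto intro: family_mono)
  qed
qed

text \<open>The Nullstellensatz in one variable: q vanishes at all roots of p iff p divides a power
  of q, and the exponent n suffices because no root has multiplicity above the degree. This turns a
  quantifier into a divisibility, hence into a condition on a remainder.\<close>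

lemma exists_root_nonroot:
  fixes p q :: "complex poly"
  assumes "p \<noteq> 0" "degree p \<le> n"
  shows "(\<exists>t. poly p t = 0 \<and> poly q t \<noteq> 0) \<longleftrightarrow> \<not> p dvd q ^ n"
proof
  assume "\<exists>t. poly p t = 0 \<and> poly q t \<noteq> 0"
  then show "\<not> p dvd q ^ n" by (auto simp: dvd_def) (metis mult_zero_left poly_mult poly_power power_eq_0_iff)
next
  assume *: "\<not> p dvd q ^ n"
  show "\<exists>t. poly p t = 0 \<and> poly q t \<noteq> 0"
  proof (rule ccontr)
    assume "\<not> ?thesis"
    then have r: "\<forall>t. poly p t = 0 \<longrightarrow> poly q t = 0" by auto
    have "p dvd q ^ degree p"
    proof (cases "degree p = 0")
      case True
      then obtain c where "p = [:c:]" by (metis degree_0_id)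
      then show ?thesis using assms(1) by (simp add: const_poly_dvd_iff dvd_field_iff)
    next
      case False
      then show ?thesis using nullstellensatz_univariate[of p q] r assms(1) by blast
    qed
    then have "p dvd q ^ n" using assms(2) by (meson dvd_trans le_imp_power_dvd)
    then show False using * by simp
  qed
qed

text \<open>Where the formal leading coefficient of P vanishes, P is truncated and the induction
  applies. Elsewhere the degree of P is n, and by \<open>exists_root_nonroot\<close> the condition
  is that the pseudo-remainder of Q^n is nonzero.\<close>

lemma project_one:
  assumes P: "family k n P" and Q: "family k m Q"
  shows "{x. \<exists>t. poly (P x) t = 0 \<and> poly (Q x) t \<noteq> 0} \<in> constructible"
  using P
proof (induction n arbitrary: P)
  case 0
  then have "P x = 0" for x by (simp add: family_def poly_eq_iff)
  then have "{x. \<exists>t. poly (P x) t = 0 \<and> poly (Q x) t \<noteq> 0} = - {x. Q x = 0}"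
    using poly_all_0_iff_0 by fastforce
  then show ?case using constructible.Compl[OF constructible_family_zero[OF Q]] by simp
next
  case (Suc n)
  let ?f = "\<lambda>x. coeff (P x) n"
  have fk: "?f \<in> coeffs_in k" using Suc.prems by (simp add: family_def)
  have "family k 1 (\<lambda>_. 1)" using family_const[OF coeffs_in_intros(1), of k 1] by (simp add: one_pCons)
  then have "\<exists>l. family k l (\<lambda>x. Q x ^ j)" for j
  proof (induction j)
    case (Suc j)
    then show ?case using family_mult[OF Q] by auto
  qed auto
  then obtain l where "family k l (\<lambda>x. Q x ^ n)" by blast
  from pseudo_remainder[OF Suc.prems this] obtain R e G where
    R: "family k n R" "\<And>x. smult (?f x ^ e) (Q x ^ n) = G x * P x + R x" by blast
  have main: "(\<exists>t. poly (P x) t = 0 \<and> poly (Q x) t \<noteq> 0) \<longleftrightarrow> R x \<noteq> 0" if f: "?f x \<noteq> 0" for x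
  proof -
    have "coeff (P x) i = 0" if "n < i" for i using Suc.prems that by (simp add: family_def)
    then have d: "degree (P x) = n" using f by (intro antisym degree_le le_degree) auto
    have p: "P x \<noteq> 0" using f by auto
    have "P x dvd Q x ^ n \<longleftrightarrow> P x dvd smult (?f x ^ e) (Q x ^ n)" using f by (simp add: dvd_smult_iff)
    also have "\<dots> \<longleftrightarrow> P x dvd R x" unfolding R(2) by (simp add: dvd_add_right_iff)
    also have "\<dots> \<longleftrightarrow> R x = 0"
    proof
      assume *: "P x dvd R x"
      show "R x = 0"
      proof (rule ccontr)
        assume "R x \<noteq> 0"
        then have "n \<le> degree (R x)" using dvd_imp_degree_le[OF *] d by simp
        moreover have "coeff (R x) (degree (R x)) \<noteq> 0" using \<open>R x \<noteq> 0\<close> by simp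
        moreover have "coeff (R x) i = 0" if "n \<le> i" for i using R(1) that by (simp add: family_def)
        ultimately show False by blast
      qed
    qed simp
    finally show ?thesis using exists_root_nonroot[OF p, of n "Q x"] d by simp
  qed
  let ?T = "\<lambda>x. P x - monom (?f x) n"
  have "(\<exists>t. poly (P x) t = 0 \<and> poly (Q x) t \<noteq> 0) \<longleftrightarrow>
     ?f x = 0 \<and> (\<exists>t. poly (?T x) t = 0 \<and> poly (Q x) t \<noteq> 0) \<or> ?f x \<noteq> 0 \<and> R x \<noteq> 0" for x
  proof (cases "?f x = 0")
    case True
    then have "?T x = P x" by simp
    then show ?thesis using True by (simp only: simp_thms)
  next
    case False
    then show ?thesis by (simp only: main simp_thms not_False_eq_True)
  qed
  then have "{x. \<exists>t. poly (P x) t = 0 \<and> poly (Q x) t \<noteq> 0} =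
     ({x. ?f x = 0} \<inter> {x. \<exists>t. poly (?T x) t = 0 \<and> poly (Q x) t \<noteq> 0}) \<union> (- {x. ?f x = 0} \<inter> - {x. R x = 0})"
    by blast
  then show ?case
    using Suc.IH[OF family_truncate[OF Suc.prems]] constructible_coeff_zero[OF fk] constructible_family_zero[OF R(1)]
    by (simp add: constructible_Int constructible.Un constructible.Compl)
qed

text \<open>Euclid's algorithm on the equations: the measure is the total number of coefficients.\<close>

lemma project_family:
  assumes "finite I" "\<And>i. i \<in> I \<Longrightarrow> family k (n i) (P i)" and Q: "family k m Q"
  shows "{x. \<exists>t. (\<forall>i\<in>I. poly (P i x) t = 0) \<and> poly (Q x) t \<noteq> 0} \<in> constructible"
  using assms(1,2)
proof (induction "(\<Sum>i\<in>I. n i) + card I" arbitrary: I n P rule: less_induct)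
  case less
  consider "I = {}" | i where "I = {i}" | i j where "i \<in> I" "j \<in> I" "i \<noteq> j" "n i \<le> n j"
    by (metis insertI1 is_singletonI' is_singleton_def linear)
  then show ?case
  proof cases
    case 1
    have "{x. \<exists>t. poly (Q x) t \<noteq> 0} = - {x. Q x = 0}" using poly_all_0_iff_0 by fastforce
    then show ?thesis using 1 constructible.Compl[OF constructible_family_zero[OF Q]] by simp
  next
    case (2 i)
    then show ?thesis using project_one[OF _ Q, of "n i" "P i"] less by simp
  next
    case (3 i j)
    have Pi: "family k (n i) (P i)" and Pj: "family k (n j) (P j)" using less 3 by auto
    have I: "I = insert i (I - {i})" "I = insert j (I - {j})" using 3 by auto
    have sum: "(\<Sum>l\<in>I. f l) = f a + (\<Sum>l\<in>I - {a}. f l)" if "a \<in> I" for a and f :: "_ \<Rightarrow> nat"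
      using that less.prems(1) by (rule sum.remove[rotated])
    show ?thesis
    proof (cases "n i")
      case 0
      then have z: "P i x = 0" for x using Pi by (simp add: family_def poly_eq_iff)
      \<comment> \<open>Dropping an equation of length zero leaves the sum of the lengths unchanged;
        the summand \<open>card I\<close> of the measure accounts for this step.\<close>
      have "(\<Sum>l\<in>I - {i}. n l) + card (I - {i}) < (\<Sum>l\<in>I. n l) + card I"
        using sum[of i n] card_Diff1_less[OF less.prems(1), of i] 3 by linarith
      then have "{x. \<exists>t. (\<forall>l\<in>I - {i}. poly (P l x) t = 0) \<and> poly (Q x) t \<noteq> 0} \<in> constructible"
        using less by (intro less.hyps) auto
      moreover have "(\<forall>l\<in>I. poly (P l x) t = 0) \<longleftrightarrow> (\<forall>l\<in>I - {i}. poly (P l x) t = 0)" for x t using z by auto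
      ultimately show ?thesis by simp
    next
      case (Suc a)
      then obtain b where b: "n j = Suc b" "a \<le> b" using 3(4) by (cases "n j") auto
      let ?f = "\<lambda>x. coeff (P i x) a"
      have fk: "?f \<in> coeffs_in k" using Pi by (simp add: family_def)
      \<comment> \<open>P1 applies where the leading coefficient of the shorter equation vanishes,
        P2 where it does not; each shortens one equation by one coefficient and keeps the common
        roots.\<close>
      define P1 where "P1 = P(i := (\<lambda>x. P i x - monom (?f x) a))"
      define P2 where "P2 = P(j := (\<lambda>x. smult (?f x) (P j x) - monom (coeff (P j x) b) (b - a) * P i x))"
      have "(\<Sum>l\<in>I. (n(i := a)) l) + card I < (\<Sum>l\<in>I. n l) + card I"
        using 3 Suc sum[of i "n(i := a)"] sum[of i n] by simp
      then have c1: "{x. \<exists>t. (\<forall>l\<in>I. poly (P1 l x) t = 0) \<and> poly (Q x) t \<noteq> 0} \<in> constructible"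
        using less.prems Pi Suc by (intro less.hyps[of "n(i := a)"]) (auto simp: P1_def intro: family_truncate)
      have "(\<Sum>l\<in>I. (n(j := b)) l) + card I < (\<Sum>l\<in>I. n l) + card I"
        using 3 b sum[of j "n(j := b)"] sum[of j n] by simp
      then have c2: "{x. \<exists>t. (\<forall>l\<in>I. poly (P2 l x) t = 0) \<and> poly (Q x) t \<noteq> 0} \<in> constructible"
        using less.prems Pi Pj Suc b by (intro less.hyps[of "n(j := b)"]) (auto simp: P2_def intro: family_reduce)
      have e1: "(\<forall>l\<in>I. poly (P1 l x) t = 0) \<longleftrightarrow> (\<forall>l\<in>I. poly (P l x) t = 0)" if "?f x = 0" for x t
      proof -
        have "P1 l x = P l x" for l using that by (simp add: P1_def)
        then show ?thesis by simp
      qed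
      have e2: "(\<forall>l\<in>I. poly (P2 l x) t = 0) \<longleftrightarrow> (\<forall>l\<in>I. poly (P l x) t = 0)" if "?f x \<noteq> 0" for x t
      proof -
        have 1: "(poly (P i x) t = 0 \<and> poly (P2 j x) t = 0) \<longleftrightarrow> (poly (P i x) t = 0 \<and> poly (P j x) t = 0)"
          using that by (auto simp: P2_def)
        have 2: "(\<forall>l\<in>I. poly (R l x) t = 0) \<longleftrightarrow>
           (poly (R i x) t = 0 \<and> poly (R j x) t = 0) \<and> (\<forall>l\<in>I - {i, j}. poly (R l x) t = 0)" for R
          using 3 by auto
        have 4: "P2 i = P i" using 3 by (simp add: P2_def)
        have 5: "(\<forall>l\<in>I - {i, j}. poly (P2 l x) t = 0) \<longleftrightarrow> (\<forall>l\<in>I - {i, j}. poly (P l x) t = 0)"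
          by (rule ball_cong) (auto simp: P2_def)
        show ?thesis unfolding 2[of P2] 2[of P] 4 5 1 ..
      qed
      have "{x. \<exists>t. (\<forall>l\<in>I. poly (P l x) t = 0) \<and> poly (Q x) t \<noteq> 0} =
         ({x. ?f x = 0} \<inter> {x. \<exists>t. (\<forall>l\<in>I. poly (P1 l x) t = 0) \<and> poly (Q x) t \<noteq> 0}) \<union>
         (- {x. ?f x = 0} \<inter> {x. \<exists>t. (\<forall>l\<in>I. poly (P2 l x) t = 0) \<and> poly (Q x) t \<noteq> 0})"
        using e1 e2 by blast
      then show ?thesis using c1 c2 constructible_coeff_zero[OF fk]
        by (simp add: constructible_Int constructible.Un constructible.Compl)
    qed
  qed
qed

text \<open>Chevalley's theorem for one coordinate: the projection commutes with finite unions, and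
  a basic set consists of equations and one inequation in the variable k over the remaining
  ones.\<close>

theorem constructible_project:
  assumes "A \<in> constructible"
  shows "{x. \<exists>t. x(k := t) \<in> A} \<in> constructible"
proof -
  obtain F where F: "A = \<Union>F" "finite F" "F \<subseteq> basic"
    by (rule basic_unionsE[OF constructible_union_basic[OF assms]])
  have "{x. \<exists>t. x(k := t) \<in> B} \<in> constructible" if BF: "B \<in> F" for B
  proof -
    obtain P q where B: "B = {x. (\<forall>p\<in>P. p x = 0) \<and> q x \<noteq> 0}" "finite P" "P \<subseteq> coord_polys" "q \<in> coord_polys"
      by (rule basicE[OF subsetD[OF F(3) BF]])
    have "\<forall>p\<in>P. \<exists>n R. family k n R \<and> (\<forall>x t. p (x(k := t)) = poly (R x) t)"
      by (intro ballI poly_as_family subsetD[OF B(3)])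
    then obtain n where "\<forall>p\<in>P. \<exists>R. family k (n p) R \<and> (\<forall>x t. p (x(k := t)) = poly (R x) t)"
      by (rule bchoice[THEN exE])
    then obtain R where R: "\<forall>p\<in>P. family k (n p) (R p) \<and> (\<forall>x t. p (x(k := t)) = poly (R p x) t)"
      by (rule bchoice[THEN exE])
    obtain m S where S: "family k m S" "\<forall>x t. q (x(k := t)) = poly (S x) t"
      using poly_as_family[OF B(4), of k] by (elim exE conjE) (rule that)
    have "{x. \<exists>t. x(k := t) \<in> B} = {x. \<exists>t. (\<forall>p\<in>P. poly (R p x) t = 0) \<and> poly (S x) t \<noteq> 0}"
      using R S by (simp add: B(1))
    then show ?thesis using project_family[OF B(2), of k n R m S] R S by simp
  qed
  note c = this
  have "{x. \<exists>t. x(k := t) \<in> A} = (\<Union>B\<in>F. {x. \<exists>t. x(k := t) \<in> B})" using F by auto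
  also have "\<dots> \<in> constructible" by (rule constructible_UN[OF F(2) c])
  finally show ?thesis .
qed

lemma constructible_project_finite:
  assumes "finite K" "A \<in> constructible"
  shows "{x. \<exists>y. (\<forall>k. k \<notin> K \<longrightarrow> y k = x k) \<and> y \<in> A} \<in> constructible"
  using assms
proof (induction K arbitrary: A rule: finite_induct)
  case empty
  have "{x. \<exists>y. (\<forall>k. k \<notin> {} \<longrightarrow> y k = x k) \<and> y \<in> A} = A" by (auto simp: fun_eq_iff[symmetric])
  then show ?case using empty by simp
next
  case (insert a K)
  have "{x. \<exists>y. (\<forall>k. k \<notin> insert a K \<longrightarrow> y k = x k) \<and> y \<in> A} =
     {x. \<exists>y. (\<forall>k. k \<notin> K \<longrightarrow> y k = x k) \<and> y \<in> {x. \<exists>t. x(a := t) \<in> A}}"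
  proof (intro Collect_cong iffI)
    fix x assume "\<exists>y. (\<forall>k. k \<notin> insert a K \<longrightarrow> y k = x k) \<and> y \<in> A"
    then obtain y where y: "\<forall>k. k \<notin> insert a K \<longrightarrow> y k = x k" "y \<in> A" by blast
    then show "\<exists>y. (\<forall>k. k \<notin> K \<longrightarrow> y k = x k) \<and> y \<in> {x. \<exists>t. x(a := t) \<in> A}"
      by (intro exI[of _ "y(a := x a)"]) (auto intro!: exI[of _ "y a"])
  next
    fix x assume "\<exists>y. (\<forall>k. k \<notin> K \<longrightarrow> y k = x k) \<and> y \<in> {x. \<exists>t. x(a := t) \<in> A}"
    then obtain y t where "\<forall>k. k \<notin> K \<longrightarrow> y k = x k" "y(a := t) \<in> A" by blast
    then show "\<exists>y. (\<forall>k. k \<notin> insert a K \<longrightarrow> y k = x k) \<and> y \<in> A"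
      by (intro exI[of _ "y(a := t)"]) auto
  qed
  then show ?case using insert.IH[OF constructible_project[OF insert.prems]] by simp
qed

section \<open>Polynomials that do not vanish identically on 4-vectors\<close>

lemma univariate_poly_function:
  assumes "f \<in> poly_functions {\<lambda>t. t}"
  shows "\<exists>q. f = poly q"
  using assms
proof induction
  case (const c)
  have "(\<lambda>_. c) = poly [:c:]" by (simp add: fun_eq_iff)
  then show ?case ..
next
  case (coord f)
  then have "f = poly [:0, 1:]" by (simp add: fun_eq_iff)
  then show ?case ..
next
  case (add f g)
  then obtain p q where "f = poly p" "g = poly q" by blast
  then have "(\<lambda>x. f x + g x) = poly (p + q)" by (simp add: fun_eq_iff)
  then show ?case ..
next
  case (mult f g)
  then obtain p q where "f = poly p" "g = poly q" by blast
  then have "(\<lambda>x. f x * g x) = poly (p * q)" by (simp add: fun_eq_iff)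
  then show ?case ..
qed

abbreviation ext_polys :: "(ext8 \<Rightarrow> complex) set" where
  "ext_polys \<equiv> poly_functions {\<lambda>w. w $ I | I. True}"

lemma ext_poly_line:
  assumes "h \<in> ext_polys"
  obtains q where "\<And>t. h (v + t *s (w - v)) = poly q t"
proof -
  have "(\<lambda>t. h (v + t *s (w - v))) \<in> poly_functions {\<lambda>t. t}"
    using assms
  proof induction
    case (coord f)
    then obtain I where f: "f = (\<lambda>w. w $ I)" by auto
    have "(\<lambda>t. v $ I + t * (w $ I - v $ I)) \<in> poly_functions {\<lambda>t. t}"
      by (intro poly_functions.intros) simp
    then show ?case
      unfolding f by (simp only: vector_add_component vector_smult_component vector_minus_component)
  qed (auto intro: poly_functions.intros)
  then obtain q where "(\<lambda>t. h (v + t *s (w - v))) = poly q" using univariate_poly_function by blast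
  then show ?thesis using that by (metis (no_types))
qed

lemma ext_power_line: "v \<in> ext_power k \<Longrightarrow> w \<in> ext_power k \<Longrightarrow> v + t *s (w - v) \<in> ext_power k"
  by (simp add: ext_power_def)

definition generic_nonzero :: "(ext8 \<Rightarrow> complex) \<Rightarrow> bool" where
  "generic_nonzero h \<longleftrightarrow> (\<exists>v\<in>ext_power 4. h v \<noteq> 0)"

text \<open>The space of 4-vectors is irreducible: on the line joining a non-zero of f to a non-zero
  of g, both restrict to nonzero polynomials in one variable, and so does their product.\<close>

lemma generic_nonzero_mult:
  assumes "f \<in> ext_polys" "g \<in> ext_polys" "generic_nonzero f" "generic_nonzero g"
  shows "generic_nonzero (\<lambda>v. f v * g v)"
proof -
  obtain v w where v: "v \<in> ext_power 4" "f v \<noteq> 0" and w: "w \<in> ext_power 4" "g w \<noteq> 0"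
    using assms by (auto simp: generic_nonzero_def)
  obtain p where p: "\<And>t. f (v + t *s (w - v)) = poly p t" using ext_poly_line[OF assms(1)] by metis
  obtain q where q: "\<And>t. g (v + t *s (w - v)) = poly q t" using ext_poly_line[OF assms(2)] by metis
  have "poly p 0 \<noteq> 0" "poly q 1 \<noteq> 0" using p[of 0] q[of 1] v w by simp_all
  then have "p * q \<noteq> 0" by auto
  then obtain t where "poly (p * q) t \<noteq> 0" using poly_all_0_iff_0 by blast
  then have "f (v + t *s (w - v)) * g (v + t *s (w - v)) \<noteq> 0" unfolding p q by simp
  then show ?thesis using ext_power_line[OF v(1) w(1), of t] unfolding generic_nonzero_def by blast
qed

lemma generic_nonzero_prod:
  assumes "finite H" "H \<subseteq> ext_polys" "\<And>h. h \<in> H \<Longrightarrow> generic_nonzero h"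
  shows "generic_nonzero (\<lambda>v. \<Prod>h\<in>H. h v)"
  using assms
proof (induction H rule: finite_induct)
  case empty
  have "0 \<in> ext_power 4" by (simp add: ext_power_def)
  then show ?case by (auto simp: generic_nonzero_def)
next
  case (insert h H)
  have "(\<lambda>v. \<Prod>h\<in>H. h v) \<in> ext_polys" using insert.prems by (intro poly_prod) auto
  then have "generic_nonzero (\<lambda>v. h v * (\<Prod>h\<in>H. h v))"
    using insert by (intro generic_nonzero_mult) auto
  then show ?case using insert by simp
qed

text \<open>On the line from v to a point where h is nonzero, h has only finitely many zeros, and
  infinitely many points of the line are close to v.\<close>

lemma generic_nonzero_near:
  assumes h: "h \<in> ext_polys" "generic_nonzero h" and v: "v \<in> ext_power 4" and e: "e > 0"
  shows "\<exists>w\<in>ext_power 4. dist w v < e \<and> h w \<noteq> 0"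
proof -
  obtain w where w: "w \<in> ext_power 4" "h w \<noteq> 0" using h(2) by (auto simp: generic_nonzero_def)
  obtain q where q: "\<And>t. h (v + t *s (w - v)) = poly q t" using ext_poly_line[OF h(1)] by metis
  have "poly q 1 \<noteq> 0" using q[of 1] w by simp
  then have fin: "finite {t. poly q t = 0}" by (intro poly_roots_finite) auto
  have "((\<lambda>t :: complex. v + t *s (w - v)) \<longlongrightarrow> v + 0 *s (w - v)) (at 0)"
    by (intro tendsto_vec_lambda[of "\<lambda>t. _ t", THEN tendsto_eq_rhs] vec_tendstoI) (auto intro!: tendsto_eq_intros)
  then have "\<forall>\<^sub>F t in at (0::complex). dist (v + t *s (w - v)) v < e"
    using e by (auto dest: tendstoD)
  then obtain d where d: "d > 0" "\<And>t. t \<noteq> 0 \<Longrightarrow> dist t 0 < d \<Longrightarrow> dist (v + t *s (w - v)) v < e"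
    unfolding eventually_at by auto
  have "infinite {t :: complex. dist t 0 < d \<and> t \<noteq> 0}"
  proof -
    have "ball 0 d - {0} \<subseteq> {t :: complex. dist t 0 < d \<and> t \<noteq> 0}" by (auto simp: dist_commute)
    moreover have "infinite (ball (0 :: complex) d - {0})"
      using d(1) by (simp add: uncountable_infinite uncountable_ball)
    ultimately show ?thesis using finite_subset by blast
  qed
  then obtain t where "dist t 0 < d" "t \<noteq> 0" "poly q t \<noteq> 0"
    using fin by (metis (mono_tags, lifting) finite_subset mem_Collect_eq subsetI)
  then show ?thesis using d(2)[of t] q[of t] ext_power_line[OF v w(1), of t] by (intro bexI[of _ "v + t *s (w - v)"]) auto
qed

lemma ext_poly_compose:
  assumes "p \<in> coord_polys" "\<And>k. (\<lambda>v. e v k) \<in> ext_polys"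
  shows "(\<lambda>v. p (e v)) \<in> ext_polys"
  using assms(1) unfolding coord_polys_def
  by induction (use assms(2) in \<open>auto intro: poly_functions.intros\<close>)

text \<open>If some locally closed piece has equations that vanish identically on 4-vectors and an
  inequation q that does not, then q is the wanted polynomial. Otherwise each piece lies in a proper
  hypersurface; the product of their equations would vanish on a ball, which
  \<open>generic_nonzero_near\<close> excludes.\<close>

theorem constructible_generic:
  fixes G :: "('k \<Rightarrow> complex) set" and e :: "ext8 \<Rightarrow> 'k \<Rightarrow> complex"
  assumes G: "G \<in> constructible" and e: "\<And>k. (\<lambda>v. e v k) \<in> ext_polys"
    and v0: "v0 \<in> ext_power 4" "\<epsilon> > 0" "\<And>v. v \<in> ext_power 4 \<Longrightarrow> dist v v0 < \<epsilon> \<Longrightarrow> e v \<in> G"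
  obtains g where "g \<in> ext_polys" "generic_nonzero g" "\<And>v. v \<in> ext_power 4 \<Longrightarrow> g v \<noteq> 0 \<Longrightarrow> e v \<in> G"
proof (rule ccontr)
  assume none: "\<not> thesis"
  note result = that
  obtain F where F: "G = \<Union>F" "finite F" "F \<subseteq> basic"
    by (rule basic_unionsE[OF constructible_union_basic[OF G]])
  have thin: "\<exists>h. h \<in> ext_polys \<and> generic_nonzero h \<and> (\<forall>v\<in>ext_power 4. e v \<in> B \<longrightarrow> h v = 0)" if BF: "B \<in> F" for B
  proof -
    obtain P q where B: "B = {x. (\<forall>p\<in>P. p x = 0) \<and> q x \<noteq> 0}" "finite P" "P \<subseteq> coord_polys" "q \<in> coord_polys"
      by (rule basicE[OF subsetD[OF F(3) BF]])
    show ?thesis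
    proof (cases "\<exists>p\<in>P. generic_nonzero (\<lambda>v. p (e v))")
      case True
      then obtain p where p: "p \<in> P" "generic_nonzero (\<lambda>v. p (e v))" by blast
      have "(\<lambda>v. p (e v)) \<in> ext_polys" using p B by (intro ext_poly_compose[OF _ e]) auto
      moreover have "\<forall>v\<in>ext_power 4. e v \<in> B \<longrightarrow> p (e v) = 0" using p(1) by (simp add: B(1))
      ultimately show ?thesis using p(2) by (intro exI[of _ "\<lambda>v. p (e v)"]) simp
    next
      case False
      then have P: "\<And>p v. p \<in> P \<Longrightarrow> v \<in> ext_power 4 \<Longrightarrow> p (e v) = 0" by (auto simp: generic_nonzero_def)
      have qe: "(\<lambda>v. q (e v)) \<in> ext_polys" using B by (intro ext_poly_compose[OF _ e]) auto
      have "\<not> generic_nonzero (\<lambda>v. q (e v))"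
      proof
        assume gq: "generic_nonzero (\<lambda>v. q (e v))"
        have "e v \<in> G" if "v \<in> ext_power 4" "q (e v) \<noteq> 0" for v
          using that P BF unfolding F(1) by (intro UnionI[of B]) (auto simp: B(1))
        from result[OF qe gq this] none show False by blast
      qed
      then have "\<forall>v\<in>ext_power 4. e v \<in> B \<longrightarrow> (1 :: complex) = 0" by (auto simp: B(1) generic_nonzero_def)
      moreover have "generic_nonzero (\<lambda>_. 1)" using v0(1) by (auto simp: generic_nonzero_def)
      ultimately show ?thesis using poly_functions.const[of 1] by blast
    qed
  qed
  then have "\<forall>B\<in>F. \<exists>h. h \<in> ext_polys \<and> generic_nonzero h \<and> (\<forall>v\<in>ext_power 4. e v \<in> B \<longrightarrow> h v = 0)" by blast
  then obtain h where h: "\<forall>B\<in>F. h B \<in> ext_polys \<and> generic_nonzero (h B) \<and> (\<forall>v\<in>ext_power 4. e v \<in> B \<longrightarrow> h B v = 0)"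
    by (rule bchoice[THEN exE])
  have "generic_nonzero (\<lambda>v. \<Prod>f\<in>h ` F. f v)" using h F by (intro generic_nonzero_prod) auto
  moreover have "(\<lambda>v. \<Prod>f\<in>h ` F. f v) \<in> ext_polys" using h by (intro poly_prod) auto
  ultimately obtain w where w: "w \<in> ext_power 4" "dist w v0 < \<epsilon>" "(\<Prod>f\<in>h ` F. f w) \<noteq> 0"
    using generic_nonzero_near[OF _ _ v0(1,2)] by blast
  then obtain B where "B \<in> F" "e w \<in> B" using v0(3) F(1) by blast
  then have "h B w = 0" using h w(1) by blast
  then show False using w(3) F(2) \<open>B \<in> F\<close> by auto
qed

section \<open>A special 4-vector and its degenerate frames\<close>

lemma UNIV_8: "(UNIV :: 8 set) = {0, 1, 2, 3, 4, 5, 6, 7}"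
  using card_subset_eq[of "UNIV :: 8 set" "{0, 1, 2, 3, 4, 5, 6, 7}"] by simp

lemma UNIV_6: "(UNIV :: 6 set) = {0, 1, 2, 3, 4, 5}"
  using card_subset_eq[of "UNIV :: 6 set" "{0, 1, 2, 3, 4, 5}"] by simp

lemma all_8: "(\<forall>i :: 8. P i) \<longleftrightarrow> P 0 \<and> P 1 \<and> P 2 \<and> P 3 \<and> P 4 \<and> P 5 \<and> P 6 \<and> P 7"
proof -
  have "(\<forall>i :: 8. P i) \<longleftrightarrow> (\<forall>i\<in>UNIV. P i)" by simp
  then show ?thesis unfolding UNIV_8 by simp
qed

lemma sum_8: "sum f (UNIV :: 8 set) = f 0 + f 1 + f 2 + f 3 + f 4 + f 5 + f 6 + f 7"
  unfolding UNIV_8 by (simp add: add.assoc)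

text \<open>The obstruction to rank two of a form \<open>f\<close>: the Pfaffians of its \<open>4 \<times> 4\<close> submatrices containing the
  pivot at the indices 2, 3.\<close>

definition defect :: "(V8 \<Rightarrow> V8 \<Rightarrow> complex) \<Rightarrow> V8 \<Rightarrow> V8 \<Rightarrow> complex" where
  "defect f x y = f (e8 2) (e8 3) * f x y - f (e8 2) x * f (e8 3) y + f (e8 2) y * f (e8 3) x"

definition std_chart :: "frame \<Rightarrow> bool" where
  "std_chart M \<longleftrightarrow> M $ 1 $ 0 = 1 \<and> M $ 1 $ 1 = 0 \<and> M $ 2 $ 0 = 0 \<and> M $ 2 $ 1 = 1"

text \<open>Polynomial conditions for an open part of \<open>D_Z6 v\<close>, with one frame for each
  point. Given the pivot, six equations remain, as many as the codimension of rank at most two among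
  skew forms on a 6-dimensional space.\<close>

definition degenerate :: "ext8 \<Rightarrow> frame \<Rightarrow> bool" where
  "degenerate v M \<longleftrightarrow> std_chart M \<and> psi v M (e8 2) (e8 3) \<noteq> 0 \<and>
    (\<forall>k\<in>{4, 5, 6, 7}. \<forall>l\<in>{4, 5, 6, 7}. k < l \<longrightarrow> defect (psi v M) (e8 k) (e8 l) = 0)"

lemma row_eq: "row i M = M $ i" by (simp add: row_def)

lemma skew_bilinear_defect:
  assumes "skew_bilinear f"
  shows "skew_bilinear (defect f)"
proof -
  note D = skew_bilinearD(1,2,4,5)[OF assms]
  show ?thesis
    unfolding skew_bilinear_def
  proof (intro conjI allI)
    fix x y z c
    show "defect f y x = - defect f x y"
      using skew_bilinearD(3)[OF assms, of x y] by (simp add: defect_def algebra_simps)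
  qed (simp_all add: defect_def D algebra_simps)
qed

lemma std_chart_rank: "std_chart M \<Longrightarrow> rank M = 2"
  unfolding rank_2_pl std_chart_def pl_def by (intro exI[of _ 0] exI[of _ 1]) simp

text \<open>The defect is itself a skew form that annihilates e_2, e_3 and the rows of the frame. By
  the shape of the chart these span, with e_4, ..., e_7, the whole space, so the six equations
  suffice.\<close>

lemma defect_zero:
  assumes "degenerate v M"
  shows "defect (psi v M) x y = 0"
proof -
  let ?f = "psi v M" and ?F = "defect (psi v M)"
  note f = skew_bilinear_psi[of v M]
  note F = skew_bilinear_defect[OF f]
  have M: "M $ 1 $ 0 = 1" "M $ 1 $ 1 = 0" "M $ 2 $ 0 = 0" "M $ 2 $ 1 = 1"
    using assms by (auto simp: degenerate_def std_chart_def)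
  have rows: "?F (M $ 1) y = 0" "?F (M $ 2) y = 0" for y
  proof -
    have "?f (M $ 1) z = 0" "?f (M $ 2) z = 0" for z using psi_row[of v M] by (simp_all add: row_eq)
    moreover from this have "?f z (M $ 1) = 0" "?f z (M $ 2) = 0" for z
      using skew_bilinearD(3)[OF f, of z "M $ 1"] skew_bilinearD(3)[OF f, of z "M $ 2"] by simp_all
    ultimately show "?F (M $ 1) y = 0" "?F (M $ 2) y = 0" for y by (simp_all add: defect_def)
  qed
  have F23: "?F (e8 2) y = 0" "?F (e8 3) y = 0" for y
    using skew_bilinearD(3)[OF f, of "e8 2" "e8 3"] by (simp_all add: defect_def skew_bilinearD(6)[OF f])
  have swap: "?F x y = 0" if "?F y x = 0" for x y using skew_bilinearD(3)[OF F, of y x] that by simp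
  have up: "?F (e8 k) (e8 l) = 0" if "k \<in> {4, 5, 6, 7}" "l \<in> {4, 5, 6, 7}" "k < l" for k l
    using assms that unfolding degenerate_def by blast
  have lt: "?F (e8 k) (e8 l) = 0" if kl: "k \<in> {4, 5, 6, 7}" "l \<in> {4, 5, 6, 7}" for k l
  proof (cases k l rule: linorder_cases)
    case less
    with kl show ?thesis by (rule up)
  next
    case equal
    then show ?thesis by (simp only: skew_bilinearD(6)[OF F])
  next
    case greater
    show ?thesis by (rule swap[OF up[OF kl(2,1) greater]])
  qed
  have hi: "?F (e8 k) (e8 l) = 0" if kl: "k \<in> {2, 3, 4, 5, 6, 7}" "l \<in> {2, 3, 4, 5, 6, 7}" for k l
  proof -
    consider "k = 2" | "k = 3" | "l = 2" | "l = 3" | "k \<in> {4, 5, 6, 7}" "l \<in> {4, 5, 6, 7}" using kl by blast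
    then show ?thesis
    proof cases
      case 5
      then show ?thesis by (rule lt)
    qed (simp_all only: F23 swap[OF F23(1)] swap[OF F23(2)])
  qed
  have exp: "?F x y = (\<Sum>i\<in>UNIV. x $ i * ?F (e8 i) y)" for x y
    using skew_bilinear_sum_left[OF F, of x y] by (simp only: e8_def)
  \<comment> \<open>In the standard chart e_0 and e_1 are the rows of M minus combinations of the
    later coordinate vectors.\<close>
  have lo: "?F (e8 0) y = 0 \<and> ?F (e8 1) y = 0" if "\<And>k. k \<in> {2, 3, 4, 5, 6, 7} \<Longrightarrow> ?F (e8 k) y = 0" for y
    using rows[of y] unfolding exp[of "M $ 1"] exp[of "M $ 2"] sum_8 by (simp add: M that)
  have k: "?F (e8 k) y = 0" if k: "k \<in> {2, 3, 4, 5, 6, 7}" for k y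
  proof -
    have "?F (e8 l) (e8 k) = 0" for l
    proof (cases "l = 0 \<or> l = 1")
      case True
      then show ?thesis using lo[OF hi[OF _ k]] by auto
    next
      case False
      then have "l \<in> {2, 3, 4, 5, 6, 7}" using UNIV_8 UNIV_I[of l] by auto
      then show ?thesis by (rule hi[OF _ k])
    qed
    then have "?F y (e8 k) = 0" unfolding exp[of y] by simp
    then show ?thesis by (rule swap)
  qed
  have "?F (e8 i) y = 0" for i
  proof (cases "i = 0 \<or> i = 1")
    case True
    then show ?thesis using lo[OF k] by auto
  next
    case False
    then have "i \<in> {2, 3, 4, 5, 6, 7}" using UNIV_8 UNIV_I[of i] by auto
    then show ?thesis by (rule k)
  qed
  then show ?thesis unfolding exp[of x] by simp
qed

text \<open>Vanishing of the defect expresses the form by f(e_2, .) and f(e_3, .), with the pivot as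
  denominator; a base change A only multiplies it by det A.\<close>

lemma degenerate_rank:
  assumes d: "degenerate v M"
  shows "rank (psi_matrix v (A ** M)) \<le> 2"
proof (rule rank_matrix_le)
  let ?f = "psi v M"
  let ?c = "det A / ?f (e8 2) (e8 3)"
  have nz: "?f (e8 2) (e8 3) \<noteq> 0" using d by (simp add: degenerate_def)
  have eq: "?f x y = (?f (e8 2) x * ?f (e8 3) y - ?f (e8 2) y * ?f (e8 3) x) / ?f (e8 2) (e8 3)" for x y
    using defect_zero[OF d, of x y] nz by (simp add: defect_def field_simps)
  show "row i (psi_matrix v (A ** M)) = (\<Sum>k<2. (if k = 0 then ?c * ?f (e8 2) (e8 i) else - ?c * ?f (e8 3) (e8 i)) *s
      (\<chi> j. if k = (0 :: nat) then ?f (e8 3) (e8 j) else ?f (e8 2) (e8 j)))" for i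
  proof -
    have "psi v (A ** M) (e8 i) (e8 j) = ?c * ?f (e8 2) (e8 i) * ?f (e8 3) (e8 j) - ?c * ?f (e8 3) (e8 i) * ?f (e8 2) (e8 j)" for j
      unfolding psi_mult by (subst eq) (simp add: diff_divide_distrib algebra_simps)
    then show ?thesis
      by (simp add: vec_eq_iff row_def psi_matrix_def numeral_2_eq_2 flip: e8_def)
  qed
qed

lemma degenerate_in_D_Z6:
  assumes d: "degenerate v M"
  shows "vec.span (rows M) \<in> D_Z6 v" "is_basis_of M (vec.span (rows M))"
proof -
  have r: "rank M = 2" using d by (simp add: degenerate_def std_chart_rank)
  then show "is_basis_of M (vec.span (rows M))" by (simp add: is_basis_of_def)
  have rows: "rows N = {row 1 N, row 2 N}" for N :: frame
    by (auto simp: rows_def) (metis exhaust_2)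
  have "vec.span (rows M) \<in> grassmannian"
    using r by (simp add: grassmannian_def vec.subspace_span row_rank_def_gen)
  moreover have "rank (psi_matrix v N) \<le> 2" if N: "is_basis_of N (vec.span (rows M))" for N
  proof -
    have "row i N \<in> vec.span {row 1 M, row 2 M}" for i
      using N vec.span_base[of "row i N" "rows N"] by (auto simp: is_basis_of_def rows_def[of N] rows[of M, symmetric])
    then have "\<exists>a b. row i N = a *s row 1 M + b *s row 2 M" for i
      by (auto simp: vec.span_insert vec.span_singleton algebra_simps)
    then obtain a b where ab: "\<And>i. row i N = a i *s row 1 M + b i *s row 2 M" by metis
    \<comment> \<open>Membership in the locus concerns every basis of the row space; each one arises
      from M by such an A.\<close>
    define A :: "complex ^ 2 ^ 2" where "A = (\<chi> i j. if j = 1 then a i else b i)"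
    have "N = A ** M"
      using ab by (simp add: vec_eq_iff row_eq matrix_matrix_mult_def UNIV_2 A_def)
    then show ?thesis using degenerate_rank[OF d] by simp
  qed
  ultimately show "vec.span (rows M) \<in> D_Z6 v" by (simp add: D_Z6_def degeneracy_locus_def)
qed

text \<open>For a frame u, w in the standard chart, the form on the span of e_2, ..., e_7 is e23
  plus the contraction of e245 + e346 + e567 with w minus the contraction of e247 + e356 with u,
  where eij... denotes the product of dual coordinates. Every block but the first contains just one
  of 0, 1, so it enters linearly in one row; none but the first contains both 2 and 3, so the pivot
  is constantly 1.\<close>

definition base_blocks :: "8 set set" where
  "base_blocks = {{0, 1, 2, 3}, {0, 2, 4, 5}, {0, 3, 4, 6}, {0, 5, 6, 7}, {1, 2, 4, 7}, {1, 3, 5, 6}}"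

text \<open>The sign makes the 4-form of \<open>base_point\<close> the sum of the \<open>4 \<times> 4\<close> minors with columns in the blocks.\<close>

definition base_point :: ext8 where
  "base_point = (\<chi> I. if - I \<in> base_blocks then wsign I else 0)"

lemma base_point_ext_power: "base_point \<in> ext_power 4"
proof -
  have "card I = 4" if "- I \<in> base_blocks" for I :: "8 set"
  proof -
    have "card (- I) = 4" using that by (auto simp: base_blocks_def)
    moreover have "card (- I) = 8 - card I" by (simp add: Compl_eq_Diff_UNIV card_Diff_subset)
    moreover have "card I \<le> 8" using card_mono[of UNIV I] by simp
    ultimately show ?thesis by linarith
  qed
  then show ?thesis by (auto simp: ext_power_def base_point_def)
qed

text \<open>The sign built into \<open>base_point\<close> cancels against the sign of the
  complementary pairing.\<close>

lemma psi_base_point: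
  "psi base_point M x y = (\<Sum>J\<in>base_blocks. wedges [M $ 1, M $ 2, x, y] $ J)"
proof -
  let ?W = "wedges [M $ 1, M $ 2, x, y]"
  have "psi base_point M x y = (\<Sum>I\<in>UNIV. if - I \<in> base_blocks then ?W $ (- I) else 0)"
    unfolding psi_def top_coeff_wedge row_eq
    by (rule sum.cong) (simp_all add: base_point_def mult.assoc[symmetric])
  also have "\<dots> = (\<Sum>J\<in>UNIV. if J \<in> base_blocks then ?W $ J else 0)"
    by (rule sum.reindex_bij_witness[of _ uminus uminus]) auto
  also have "\<dots> = (\<Sum>J\<in>base_blocks. ?W $ J)" by (simp add: sum.If_cases)
  finally show ?thesis .
qed

lemma psi_base_point_minors:
  "psi base_point M x y = wedges [M $ 1, M $ 2, x, y] $ {0, 1, 2, 3} + wedges [M $ 1, M $ 2, x, y] $ {0, 2, 4, 5}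
    + wedges [M $ 1, M $ 2, x, y] $ {0, 3, 4, 6} + wedges [M $ 1, M $ 2, x, y] $ {0, 5, 6, 7}
    + wedges [M $ 1, M $ 2, x, y] $ {1, 2, 4, 7} + wedges [M $ 1, M $ 2, x, y] $ {1, 3, 5, 6}"
proof -
  have n: "{0, 1, 2, 3} \<notin> {{0, 2, 4, 5}, {0, 3, 4, 6}, {0, 5, 6, 7}, {1, 2, 4, 7}, {1, 3, 5, 6 :: 8}}"
    "{0, 2, 4, 5} \<notin> {{0, 3, 4, 6}, {0, 5, 6, 7}, {1, 2, 4, 7}, {1, 3, 5, 6 :: 8}}"
    "{0, 3, 4, 6} \<notin> {{0, 5, 6, 7}, {1, 2, 4, 7}, {1, 3, 5, 6 :: 8}}"
    "{0, 5, 6, 7} \<notin> {{1, 2, 4, 7}, {1, 3, 5, 6 :: 8}}"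
    "{1, 2, 4, 7} \<notin> {{1, 3, 5, 6 :: 8}}"
    by (auto simp: set_eq_iff all_8)
  show ?thesis unfolding psi_base_point base_blocks_def
    by (subst sum.insert, simp, rule n, subst sum.insert, simp, rule n, subst sum.insert, simp, rule n,
        subst sum.insert, simp, rule n, subst sum.insert, simp, rule n) (simp add: add.assoc)
qed

lemma less_8 [simp]: "(0 :: 8) < 1" "(0 :: 8) < 2" "(0 :: 8) < 3" "(0 :: 8) < 5" "(1 :: 8) < 2" "(1 :: 8) < 3"
  "(2 :: 8) < 3" "(2 :: 8) < 4" "(3 :: 8) < 4" "(3 :: 8) < 5" "(4 :: 8) < 5" "(4 :: 8) < 6" "(4 :: 8) < 7"
  "(5 :: 8) < 6" "(5 :: 8) < 7" "(6 :: 8) < 7"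
  by (simp_all add: less_bit0_def bit0.Rep_numeral bit0.Rep_0 bit0.Rep_1)

text \<open>Near the point spanned by \<open>e\<^sub>0, e\<^sub>1\<close>, the coordinates of the Grassmannian are six free ones
  \<open>a, c, d, e, f, g\<close> and the six values \<open>h\<close> of the defects of the form of \<open>base_point\<close>.\<close>

definition graph_frame :: "complex \<Rightarrow> complex \<Rightarrow> complex \<Rightarrow> complex \<Rightarrow> complex \<Rightarrow> complex \<Rightarrow> complex ^ 6 \<Rightarrow> frame" where
  "graph_frame a c d e f g h =
    (let y5 = h $ 5 + a * g; y6 = - a * c - h $ 4 in
     frame_of
      (\<chi> i. if i = 0 then 1 else if i = 1 then 0 else if i = 2 then a * y6 - h $ 2 else if i = 3 then f - e * g - h $ 3
         else if i = 4 then a else if i = 5 then e - g else if i = 6 then c else d)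
      (\<chi> i. if i = 0 then 0 else if i = 1 then 1 else if i = 2 then h $ 0 + c * d - c * y5 + e * y6
         else if i = 3 then h $ 1 + d * g - g * y5 else if i = 4 then e else if i = 5 then y5 else if i = 6 then y6 else f))"

lemma std_chart_graph_frame: "std_chart (graph_frame a c d e f g h)"
  by (simp add: std_chart_def graph_frame_def Let_def)

lemma psi_base_point_graph_frame:
  "psi base_point (graph_frame a c d e f g h) (e8 2) (e8 3) = 1"
  unfolding psi_base_point_minors
  by (simp add: wedges4) (simp add: graph_frame_def Let_def)

text \<open>The entries of the form at 45, 46, 47, 56, 57, 67 are w_2, w_3, -u_2, w_7 - u_3, -w_6,
  w_5, and each defect is its entry plus a quadratic correction. The resulting system is triangular,
  and \<open>graph_frame\<close> is its solution, with y5 and y6 computed before the coordinates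
  that depend on them.\<close>

lemma defect_base_point:
  fixes a c d e f g :: complex and h :: "complex ^ 6"
  defines "F \<equiv> defect (psi base_point (graph_frame a c d e f g h))"
  shows "F (e8 4) (e8 5) = h $ 0" "F (e8 4) (e8 6) = h $ 1" "F (e8 4) (e8 7) = h $ 2" "F (e8 5) (e8 6) = h $ 3"
    "F (e8 5) (e8 7) = h $ 4" "F (e8 6) (e8 7) = h $ 5"
  unfolding F_def defect_def psi_base_point_graph_frame unfolding psi_base_point_minors
  by (simp_all add: wedges4) (simp_all add: graph_frame_def Let_def algebra_simps)

definition defects :: "ext8 \<Rightarrow> frame \<Rightarrow> complex ^ 6" where
  "defects v M = (\<chi> i. let F = defect (psi v M) in
     if i = 0 then F (e8 4) (e8 5) else if i = 1 then F (e8 4) (e8 6) else if i = 2 then F (e8 4) (e8 7)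
     else if i = 3 then F (e8 5) (e8 6) else if i = 4 then F (e8 5) (e8 7) else F (e8 6) (e8 7))"

lemma all_6: "(\<forall>i :: 6. P i) \<longleftrightarrow> P 0 \<and> P 1 \<and> P 2 \<and> P 3 \<and> P 4 \<and> P 5"
proof -
  have "(\<forall>i :: 6. P i) \<longleftrightarrow> (\<forall>i\<in>UNIV. P i)" by simp
  then show ?thesis unfolding UNIV_6 by simp
qed

lemma defects_base_point: "defects base_point (graph_frame a c d e f g h) = h"
  by (simp add: vec_eq_iff all_6 defects_def Let_def defect_base_point)

lemma degenerate_if_defects:
  assumes "std_chart M" "psi v M (e8 2) (e8 3) \<noteq> 0" "defects v M = 0"
  shows "degenerate v M"
proof -
  have "\<forall>i. defects v M $ i = 0" using assms(3) by simp
  then have F: "defect (psi v M) (e8 4) (e8 5) = 0" "defect (psi v M) (e8 4) (e8 6) = 0" "defect (psi v M) (e8 4) (e8 7) = 0"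
    "defect (psi v M) (e8 5) (e8 6) = 0" "defect (psi v M) (e8 5) (e8 7) = 0" "defect (psi v M) (e8 6) (e8 7) = 0"
    unfolding all_6 defects_def Let_def by simp_all
  have n: "\<not> (5::8) < 4" "\<not> (6::8) < 4" "\<not> (7::8) < 4" "\<not> (6::8) < 5" "\<not> (7::8) < 5" "\<not> (7::8) < 6"
    by (simp_all add: not_less less_imp_le)
  show ?thesis
    using assms(1,2) F n by (simp add: degenerate_def)
qed

section \<open>Deformation of degenerate frames\<close>

lemma continuous_psi:
  assumes "\<And>I. continuous_on S (\<lambda>p. v p $ I)" "\<And>k l. continuous_on S (\<lambda>p. M p $ k $ l)"
  shows "continuous_on S (\<lambda>p. psi (v p) (M p) x y)"
proof -
  have *: "continuous_on S (\<lambda>p. wedges (map (\<lambda>f. f p) fs) $ K)"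
    if "\<And>f i. f \<in> set fs \<Longrightarrow> continuous_on S (\<lambda>p. f p $ i)" for fs K
    using that
  proof (induction fs arbitrary: K)
    case (Cons f fs)
    show ?case
      unfolding list.map wedges_Cons wedge_ext_vec
      by (intro continuous_on_sum continuous_on_mult continuous_on_const Cons.IH Cons.prems) auto
  qed simp
  have "continuous_on S (\<lambda>p. wedges (map (\<lambda>f. f p) [\<lambda>p. row 1 (M p), \<lambda>p. row 2 (M p), \<lambda>p. x, \<lambda>p. y]) $ K)" for K
    by (rule *) (auto simp: row_def assms)
  then show ?thesis
    unfolding psi_def top_coeff_wedge
    by (intro continuous_on_sum continuous_on_mult continuous_on_const assms(1)) simp
qed

lemma continuous_on_if_const:
  "(P \<Longrightarrow> continuous_on S f) \<Longrightarrow> (\<not> P \<Longrightarrow> continuous_on S g) \<Longrightarrow> continuous_on S (\<lambda>x. if P then f x else g x)"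
  by (cases P) simp_all

lemma continuous_graph_frame:
  "continuous_on S (\<lambda>h. graph_frame a c d e f g h $ k $ l)"
proof -
  have u: "continuous_on S (\<lambda>h. graph_frame a c d e f g h $ 1 $ l)"
    unfolding graph_frame_def Let_def frame_of_nth vec_lambda_beta
    by (intro continuous_on_if_const continuous_intros)
  have w: "continuous_on S (\<lambda>h. graph_frame a c d e f g h $ 2 $ l)"
    unfolding graph_frame_def Let_def frame_of_nth vec_lambda_beta
    by (intro continuous_on_if_const continuous_intros)
  show ?thesis using exhaust_2[of k] u w by auto
qed

text \<open>A fixed point of the map that sends h to h - F h is a zero of F. Continuity and a
  uniform bound enter, but no derivative.\<close>

lemma zero_of_perturbed_identity:
  fixes F :: "'a :: euclidean_space \<Rightarrow> 'a"
  assumes "0 \<le> \<epsilon>" "continuous_on (cball 0 \<epsilon>) F" "\<And>h. norm h \<le> \<epsilon> \<Longrightarrow> norm (h - F h) \<le> \<epsilon>"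
  obtains h where "norm h \<le> \<epsilon>" "F h = 0"
proof -
  have "continuous_on (cball 0 \<epsilon>) (\<lambda>h. h - F h)"
    by (rule continuous_on_diff[OF continuous_on_id assms(2)])
  moreover have "(\<lambda>h. h - F h) \<in> cball 0 \<epsilon> \<rightarrow> cball 0 \<epsilon>" using assms(3) by simp
  ultimately obtain h where "h \<in> cball 0 \<epsilon>" "h - F h = h"
    using brouwer[of "cball 0 \<epsilon>" "\<lambda>h. h - F h"] assms(1) by auto
  then show thesis using that[of h] by simp
qed

text \<open>The family \<open>h \<mapsto> graph_frame a c d e f g h\<close> is transversal to the degeneracy locus of
  \<open>base_point\<close>; by Brouwer's theorem, applied to \<open>h \<mapsto> h - defects v h\<close>, the degenerate frame \<open>h = 0\<close> deforms
  along with the 4-vector.\<close>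

lemma degenerate_near_base_point:
  fixes a c d e f g :: complex
  assumes "\<epsilon> > 0"
  obtains \<delta> where "\<delta> > 0" "\<And>v. dist v base_point < \<delta> \<Longrightarrow> \<exists>h. norm h \<le> \<epsilon> \<and> degenerate v (graph_frame a c d e f g h)"
proof -
  let ?M = "graph_frame a c d e f g"
  let ?K = "cball (0 :: complex ^ 6) \<epsilon>"
  let ?S = "UNIV :: (ext8 \<times> (complex ^ 6)) set"
  have M: "continuous_on ?S (\<lambda>p. ?M (snd p) $ k $ l)" for k l
    by (rule continuous_on_compose2[OF continuous_graph_frame[of UNIV]]) (auto intro: continuous_intros)
  have psi: "continuous_on ?S (\<lambda>p. psi (fst p) (?M (snd p)) x y)" for x y
    by (rule continuous_psi[OF _ M]) (intro continuous_intros)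
  have D: "continuous_on ?S (\<lambda>p. defects (fst p) (?M (snd p)))"
    unfolding defects_def Let_def defect_def
    by (intro continuous_on_vec_lambda continuous_on_if_const continuous_intros psi)
  \<comment> \<open>The two open conditions needed for each h: the bound for Brouwer's theorem and a
    nonzero pivot. They hold over \<open>base_point\<close>, where the defects are h, and the tube
    lemma makes the neighbourhood uniform over the compact ball.\<close>
  define W where "W = {p. norm (snd p - defects (fst p) (?M (snd p))) < \<epsilon>} \<inter> {p. psi (fst p) (?M (snd p)) (e8 2) (e8 3) \<noteq> 0}"
  have "open W"
    unfolding W_def by (intro open_Int open_Collect_less open_Collect_neq continuous_intros D psi)
  moreover have "{base_point} \<times> ?K \<subseteq> W"
    using assms by (auto simp: W_def defects_base_point psi_base_point_graph_frame)
  ultimately obtain X where X: "base_point \<in> X" "open X" "X \<times> ?K \<subseteq> W"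
    using Elementary_Topology.tube_lemma[OF compact_cball] by metis
  then obtain \<delta> where \<delta>: "\<delta> > 0" "\<And>v. dist v base_point < \<delta> \<Longrightarrow> v \<in> X" unfolding open_dist by metis
  have "\<exists>h. norm h \<le> \<epsilon> \<and> degenerate v (?M h)" if d: "dist v base_point < \<delta>" for v
  proof -
    have vW: "(v, h) \<in> W" if "h \<in> ?K" for h
      by (rule subsetD[OF X(3)], rule SigmaI[OF \<delta>(2)[OF d] that])
    have "continuous_on ?K (\<lambda>h. psi v (?M h) x y)" for x y
      by (rule continuous_psi[OF continuous_on_const continuous_graph_frame])
    then have "continuous_on ?K (\<lambda>h. defects v (?M h))"
      unfolding defects_def Let_def defect_def
      by (intro continuous_on_vec_lambda continuous_on_if_const continuous_intros)
    moreover have "norm (h - defects v (?M h)) \<le> \<epsilon>" if "norm h \<le> \<epsilon>" for h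
      using vW[of h] that unfolding W_def by simp
    ultimately obtain h where h: "norm h \<le> \<epsilon>" "defects v (?M h) = 0"
      using assms by (elim zero_of_perturbed_identity[rotated]) simp_all
    then have "degenerate v (?M h)"
      using vW[of h] unfolding W_def by (intro degenerate_if_defects std_chart_graph_frame) simp_all
    then show ?thesis using h(1) by auto
  qed
  then show ?thesis using \<delta>(1) that by blast
qed

section \<open>Tensors singular along the degenerate frames of the special 4-vector\<close>

text \<open>A vector whose entries are polynomials in \<open>t\<close> is recorded as the list of its monomials
  \<open>c t\<^sup>n e\<^sub>i\<close>, written \<open>(n, c, i)\<close>.\<close>

definition curve :: "(nat \<times> complex \<times> nat) list \<Rightarrow> complex \<Rightarrow> V8" where
  "curve L t = (\<Sum>(n, c, i)\<leftarrow>L. (c * t ^ n) *s e8 (of_nat i))"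

lemma curve_Nil [simp]: "curve [] t = 0" by (simp add: curve_def)

lemma curve_Cons [simp]: "curve ((n, c, i) # L) t = (c * t ^ n) *s e8 (of_nat i) + curve L t"
  by (simp add: curve_def)

lemma contract_0: "contract r 0 y z w = 0" "contract r x 0 z w = 0" "contract r x y 0 w = 0"
  by (simp_all add: contract_def)

lemma contract_e8: "contract r (e8 i) (e8 j) (e8 k) (e8 l) = r i j k l"
proof -
  have *: "(\<Sum>j\<in>UNIV. g j * (if j = i then 1 else 0)) = g i" for g :: "8 \<Rightarrow> complex" and i
    by (simp add: if_distrib cong: if_cong)
  show ?thesis
    unfolding contract_def e8_nth
    by (simp only: mult.assoc[symmetric] * sum_distrib_right[symmetric])
qed

lemma contract_curve:
  "contract r (curve U t) (curve W t) (curve Z t) (e8 l) = (\<Sum>(n, c, i)\<leftarrow>U. \<Sum>(n', c', j)\<leftarrow>W. \<Sum>(n'', c'', k)\<leftarrow>Z.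
    c * c' * c'' * r (of_nat i) (of_nat j) (of_nat k) l * t ^ (n + n' + n''))"
proof -
  let ?e = "\<lambda>i. e8 (of_nat i)"
  have 1: "contract r (curve U t) y z w = (\<Sum>(n, c, i)\<leftarrow>U. c * t ^ n * contract r (?e i) y z w)" for y z w
    by (induction U) (auto simp: contract_linear contract_0)
  have 2: "contract r x (curve W t) z w = (\<Sum>(n, c, i)\<leftarrow>W. c * t ^ n * contract r x (?e i) z w)" for x z w
    by (induction W) (auto simp: contract_linear contract_0)
  have 3: "contract r x y (curve Z t) w = (\<Sum>(n, c, i)\<leftarrow>Z. c * t ^ n * contract r x y (?e i) w)" for x y w
    by (induction Z) (auto simp: contract_linear contract_0)
  show ?thesis
    unfolding 1 unfolding 2 unfolding 3 unfolding contract_e8 split_def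
    by (simp add: sum_list_const_mult[symmetric] power_add ac_simps)
qed

lemma poly_sum_list: "poly (sum_list (map f xs)) t = (\<Sum>x\<leftarrow>xs. poly (f x) t)"
  by (induction xs) simp_all

lemma coeff_sum_list_map: "coeff (sum_list (map f xs)) N = (\<Sum>x\<leftarrow>xs. coeff (f x) N)"
  by (induction xs) simp_all

text \<open>A polynomial in t that vanishes everywhere has zero coefficients, so each exponent N and
  each index l give one linear equation for the components of r.\<close>

lemma curve_equation:
  assumes "\<And>t. contract r (curve U t) (curve W t) (curve Z t) (e8 l) = 0"
  shows "(\<Sum>(n, c, i)\<leftarrow>U. \<Sum>(n', c', j)\<leftarrow>W. \<Sum>(n'', c'', k)\<leftarrow>Z.
    if n + n' + n'' = N then c * c' * c'' * r (of_nat i) (of_nat j) (of_nat k) l else 0) = 0"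
proof -
  let ?p = "\<Sum>(n, c, i)\<leftarrow>U. \<Sum>(n', c', j)\<leftarrow>W. \<Sum>(n'', c'', k)\<leftarrow>Z.
    monom (c * c' * c'' * r (of_nat i) (of_nat j) (of_nat k) l) (n + n' + n'')"
  have "poly ?p t = 0" for t
    using assms[of t] unfolding contract_curve by (simp add: poly_sum_list poly_monom split_def)
  then have "?p = 0" by (simp add: poly_eq_poly_eq_iff[symmetric] fun_eq_iff)
  then have "coeff ?p N = 0" by simp
  then show ?thesis by (simp add: coeff_sum_list_map split_def)
qed

lemma combine_zero: "x = 0 \<Longrightarrow> y = 0 \<Longrightarrow> a * x + b * y = (0 :: complex)" by simp

lemmas expand_simps = list.map sum_list.Cons sum_list.Nil prod.case arith_simps add_0_left add_0_right
  mult_1_left mult_1_right mult_minus_left mult_minus_right minus_minus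

lemmas coefficient_simps = num.inject num.distinct eq_numeral_simps zero_neq_numeral numeral_eq_iff semiring_norm
  if_True if_False simp_thms add_0_left add_0_right

text \<open>The exponents and the order of the steps in the elimination come from a computer search: each step
  isolates one component by means of one or two of the coefficients of \<open>t\<^sup>N\<close>.\<close>

definition curve_u :: "(nat \<times> complex \<times> nat) list" where
  "curve_u = [(0, 1, 0), (37, - 1, 2), (23, 1, 3), (45, - 1, 3), (4, 1, 4), (25, 1, 5), (20, - 1, 5), (29, 1, 6), (19, 1, 7)]"

definition curve_w :: "(nat \<times> complex \<times> nat) list" where
  "curve_w = [(0, 1, 1), (48, 1, 2), (53, - 1, 2), (58, - 1, 2), (39, 1, 3), (44, - 1, 3), (25, 1, 4), (24, 1, 5), (33, - 1, 6), (23, 1, 7)]"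

text \<open>The indices are natural numbers so that simp decides their comparisons. The laws bring a
  component to i < j, k < l with (i, j) at most (k, l) lexicographically, and remove the nested case
  i < k < l < j by the Bianchi identity. Each component found to be zero joins the simp set and
  simplifies the later equations.\<close>

lemma curvature_nat_zero:
  fixes R :: "nat \<Rightarrow> nat \<Rightarrow> nat \<Rightarrow> nat \<Rightarrow> complex"
  assumes skew: "\<And>i j k l. R j i k l = - R i j k l" and pair: "\<And>i j k l. R k l i j = R i j k l"
    and bianchi: "\<And>i j k l. R i j k l + R j k i l + R k i j l = 0" and ref: "R 1 2 1 3 = 0"
    and eqU: "\<And>N k. (\<Sum>(n, c, i)\<leftarrow>curve_u. \<Sum>(n', c', j)\<leftarrow>curve_w. \<Sum>(n'', c'', m)\<leftarrow>curve_u.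
      if n + n' + n'' = N then c * c' * c'' * R i j m k else 0) = 0"
    and eqW: "\<And>N k. (\<Sum>(n, c, i)\<leftarrow>curve_u. \<Sum>(n', c', j)\<leftarrow>curve_w. \<Sum>(n'', c'', m)\<leftarrow>curve_w.
      if n + n' + n'' = N then c * c' * c'' * R i j m k else 0) = 0"
    and le: "i \<le> 7" "j \<le> 7" "k \<le> 7" "l \<le> 7"
  shows "R i j k l = 0"
proof -
  note U = eqU[unfolded curve_u_def curve_w_def, unfolded expand_simps]
  note W = eqW[unfolded curve_u_def curve_w_def, unfolded expand_simps]
  \<comment> \<open>The double negations keep simp from treating these laws as permutative.\<close>
  have laws: "i < j \<Longrightarrow> R j i k l = - R i j k l" "k < l \<Longrightarrow> R i j l k = - R i j k l"
    "i < k \<Longrightarrow> R k l i j = - (- R i j k l)" "j < l \<Longrightarrow> R i l i j = - (- R i j i l)" "R i i k l = 0" "R k l i i = 0"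
    "i < k \<Longrightarrow> k < l \<Longrightarrow> l < j \<Longrightarrow> R i j k l = R i l k j - R i k l j" for i j k l
  proof -
    have skew': "R i j l k = - R i j k l" for i j k l
      using skew[of l k i j] pair[of l k i j] pair[of k l i j] by simp
    then show "R i j l k = - R i j k l" .
    show "R j i k l = - R i j k l" by (rule skew)
    show "R k l i j = - (- R i j k l)" "R i l i j = - (- R i j i l)" using pair by simp_all
    show "R i i k l = 0" "R k l i i = 0" using skew[of i i k l] skew'[of k l i i] by simp_all
    show "R i j k l = R i l k j - R i k l j"
      using bianchi[of i j k l] pair[of i l j k] skew'[of i l j k] skew[of k i j l] skew'[of i k j l] by algebra
  qed
  note [simp] = ref laws and [simp del] = One_nat_def
  \<comment> \<open>A typical step: the coefficient of t^4 is R 0 1 4 k + R 4 1 0 k, and for k = 0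
    the second term vanishes by skewness.\<close>
  note u4 = U[of 4, simplified coefficient_simps]
  have [simp]: "R 0 1 0 4 = 0" using u4[of 0] by (simp add: laws del: One_nat_def)
  note u25 = U[of 25, simplified coefficient_simps]
  have [simp]: "R 0 1 0 5 = 0" using u25[of 0] by (simp add: laws del: One_nat_def)
  note u19 = U[of 19, simplified coefficient_simps]
  have [simp]: "R 0 1 0 7 = 0" using u19[of 0] by (simp add: laws del: One_nat_def)
  note u59 = U[of 59, simplified coefficient_simps]
  have [simp]: "R 0 3 0 5 = 0" using u59[of 0] by (simp add: laws del: One_nat_def)
  note u28 = U[of 28, simplified coefficient_simps]
  have [simp]: "R 0 4 0 5 = 0" using u28[of 0] by (simp add: laws del: One_nat_def)
  note u8 = U[of 8, simplified coefficient_simps]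
  have [simp]: "R 0 4 1 4 = 0" using u8[of 0] by (simp add: laws del: One_nat_def)
  note u40 = U[of 40, simplified coefficient_simps]
  have [simp]: "R 0 5 1 5 = 0" using u40[of 0] by (simp add: laws del: One_nat_def)
  note u38 = U[of 38, simplified coefficient_simps]
  have [simp]: "R 0 7 1 7 = 0" using u38[of 0] by (simp add: laws del: One_nat_def)
  note u130 = U[of 130, simplified coefficient_simps]
  have [simp]: "R 0 2 2 3 = 0" using u130[of 0] by (simp add: laws del: One_nat_def)
  note u126 = U[of 126, simplified coefficient_simps]
  have [simp]: "R 0 3 2 3 = 0" using u126[of 0] by (simp add: laws del: One_nat_def)
  note u123 = U[of 123, simplified coefficient_simps]
  have [simp]: "R 0 3 3 6 = 0" using u123[of 0] by (simp add: laws del: One_nat_def)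
  note u120 = U[of 120, simplified coefficient_simps]
  have [simp]: "R 0 2 2 5 = 0" using u120[of 0] by (simp add: laws del: One_nat_def)
  note u119 = U[of 119, simplified coefficient_simps]
  have [simp]: "R 0 2 2 6 = 0" using u119[of 0] by (simp add: laws del: One_nat_def)
  note u111 = U[of 111, simplified coefficient_simps]
  have [simp]: "R 0 6 2 6 = 0" using u111[of 0] by (simp add: laws del: One_nat_def)
  note u32 = U[of 32, simplified coefficient_simps]
  have [simp]: "R 0 4 4 5 = 0" using u32[of 0] by (simp add: laws del: One_nat_def)
  note u31 = U[of 31, simplified coefficient_simps]
  have [simp]: "R 0 4 4 7 = 0" using u31[of 0] by (simp add: laws del: One_nat_def)
  note u0 = U[of 0, simplified coefficient_simps]
  have [simp]: "R 0 1 0 1 = 0" using u0[of 1] by (simp add: laws del: One_nat_def)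
  have [simp]: "R 0 1 1 4 = 0" using u4[of 1] by (simp add: laws del: One_nat_def)
  note u20 = U[of 20, simplified coefficient_simps]
  have [simp]: "R 0 1 1 5 = 0" using u20[of 1] by (simp add: laws del: One_nat_def)
  have [simp]: "R 0 1 1 7 = 0" using u19[of 1] by (simp add: laws del: One_nat_def)
  have [simp]: "R 1 4 1 4 = 0" using u8[of 1] by (simp add: laws del: One_nat_def)
  have [simp]: "R 1 5 1 5 = 0" using u40[of 1] by (simp add: laws del: One_nat_def)
  have [simp]: "R 1 7 1 7 = 0" using u38[of 1] by (simp add: laws del: One_nat_def)
  have [simp]: "R 1 2 2 3 = 0" using u130[of 1] by (simp add: laws del: One_nat_def)
  have [simp]: "R 1 3 2 3 = 0" using u126[of 1] by (simp add: laws del: One_nat_def)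
  have [simp]: "R 1 3 3 6 = 0" using u123[of 1] by (simp add: laws del: One_nat_def)
  have [simp]: "R 1 2 2 5 = 0" using u120[of 1] by (simp add: laws del: One_nat_def)
  have [simp]: "R 1 2 2 6 = 0" using u119[of 1] by (simp add: laws del: One_nat_def)
  have [simp]: "R 1 6 2 6 = 0" using u111[of 1] by (simp add: laws del: One_nat_def)
  have [simp]: "R 1 4 4 5 = 0" using u32[of 1] by (simp add: laws del: One_nat_def)
  have [simp]: "R 1 4 4 7 = 0" using u31[of 1] by (simp add: laws del: One_nat_def)
  have [simp]: "R 0 1 0 2 = 0" using u0[of 2] by (simp add: laws del: One_nat_def)
  have [simp]: "R 1 4 2 4 = 0" using u8[of 2] by (simp add: laws del: One_nat_def)
  have [simp]: "R 1 5 2 5 = 0" using u40[of 2] by (simp add: laws del: One_nat_def)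
  have [simp]: "R 1 7 2 7 = 0" using u38[of 2] by (simp add: laws del: One_nat_def)
  have [simp]: "R 2 3 2 3 = 0" using u126[of 2] by (simp add: laws del: One_nat_def)
  have [simp]: "R 2 3 3 6 = 0" using u123[of 2] by (simp add: laws del: One_nat_def)
  note u128 = U[of 128, simplified coefficient_simps]
  have [simp]: "R 2 3 2 5 = 0" using u128[of 2] by (simp add: laws del: One_nat_def)
  note u110 = U[of 110, simplified coefficient_simps]
  have [simp]: "R 2 3 2 6 = 0" using u110[of 2] by (simp add: laws del: One_nat_def)
  note u117 = U[of 117, simplified coefficient_simps]
  have [simp]: "R 2 3 2 7 = 0" using u117[of 2] by (simp add: laws del: One_nat_def)
  note u80 = U[of 80, simplified coefficient_simps]
  have [simp]: "R 2 3 2 4 = 0" using u80[of 2] by (simp add: laws del: One_nat_def)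
  have [simp]: "R 2 6 2 6 = 0" using u111[of 2] by (simp add: laws del: One_nat_def)
  note u109 = U[of 109, simplified coefficient_simps]
  have [simp]: "R 2 3 3 5 = 0" using u109[of 2] by (simp add: laws del: One_nat_def)
  have [simp]: "R 2 4 4 5 = 0" using u32[of 2] by (simp add: laws del: One_nat_def)
  have [simp]: "R 2 4 4 7 = 0" using u31[of 2] by (simp add: laws del: One_nat_def)
  have [simp]: "R 0 1 0 3 = 0" using u0[of 3] by (simp add: laws del: One_nat_def)
  have [simp]: "R 0 3 3 5 = 0" using u59[of 3] by (simp add: laws del: One_nat_def)
  have [simp]: "R 1 4 3 4 = 0" using u8[of 3] by (simp add: laws del: One_nat_def)
  have [simp]: "R 1 5 3 5 = 0" using u40[of 3] by (simp add: laws del: One_nat_def)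
  have [simp]: "R 1 7 3 7 = 0" using u38[of 3] by (simp add: laws del: One_nat_def)
  have [simp]: "R 2 3 3 7 = 0" using u117[of 3] by (simp add: laws del: One_nat_def)
  have [simp]: "R 2 6 3 6 = 0" using u111[of 3] by (simp add: laws del: One_nat_def)
  note u51 = U[of 51, simplified coefficient_simps]
  have [simp]: "R 3 4 3 5 = 0" using u51[of 3] by (simp add: laws del: One_nat_def)
  have [simp]: "R 3 4 4 5 = 0" using u32[of 3] by (simp add: laws del: One_nat_def)
  have [simp]: "R 3 4 4 7 = 0" using u31[of 3] by (simp add: laws del: One_nat_def)
  have [simp]: "R 1 5 4 5 = 0" using u40[of 4] by (simp add: laws del: One_nat_def)
  have [simp]: "R 1 7 4 7 = 0" using u38[of 4] by (simp add: laws del: One_nat_def)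
  have [simp]: "R 2 3 3 4 = 0" using u126[of 4] by (simp add: laws del: One_nat_def)
  have [simp]: "R 3 4 3 6 = 0" using u123[of 4] by (simp add: laws del: One_nat_def)
  have [simp]: "R 2 4 2 5 = 0" using u120[of 4] by (simp add: laws del: One_nat_def)
  have [simp]: "R 2 4 2 6 = 0" using u119[of 4] by (simp add: laws del: One_nat_def)
  have [simp]: "R 2 6 4 6 = 0" using u111[of 4] by (simp add: laws del: One_nat_def)
  have [simp]: "R 0 5 4 5 = 0" using u28[of 5] by (simp add: laws del: One_nat_def)
  have [simp]: "R 1 7 5 7 = 0" using u38[of 5] by (simp add: laws del: One_nat_def)
  have [simp]: "R 2 5 2 5 = 0" using u120[of 5] by (simp add: laws del: One_nat_def)
  have [simp]: "R 2 5 3 5 = 0" using u128[of 5] by (simp add: laws del: One_nat_def)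
  have [simp]: "R 2 5 2 6 = 0" using u119[of 5] by (simp add: laws del: One_nat_def)
  have [simp]: "R 2 6 5 6 = 0" using u111[of 5] by (simp add: laws del: One_nat_def)
  have [simp]: "R 0 5 3 5 = 0" using u59[of 5] by (simp add: laws del: One_nat_def)
  have [simp]: "R 3 5 4 5 = 0" using u51[of 5] by (simp add: laws del: One_nat_def)
  have [simp]: "R 3 5 3 6 = 0" using u123[of 5] by (simp add: laws del: One_nat_def)
  have [simp]: "R 4 5 4 5 = 0" using u32[of 5] by (simp add: laws del: One_nat_def)
  have [simp]: "R 4 5 4 7 = 0" using u31[of 5] by (simp add: laws del: One_nat_def)
  have [simp]: "R 0 1 0 6 = 0" using u0[of 6] by (simp add: laws del: One_nat_def)
  have [simp]: "R 1 4 4 6 = 0" using u8[of 6] by (simp add: laws del: One_nat_def)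
  have [simp]: "R 1 5 5 6 = 0" using u40[of 6] by (simp add: laws del: One_nat_def)
  have [simp]: "R 1 7 6 7 = 0" using u38[of 6] by (simp add: laws del: One_nat_def)
  have [simp]: "R 3 6 3 6 = 0" using u123[of 6] by (simp add: laws del: One_nat_def)
  have [simp]: "R 4 5 4 6 = 0" using u32[of 6] by (simp add: laws del: One_nat_def)
  note u99 = U[of 99, simplified coefficient_simps]
  have [simp]: "R 3 6 4 6 = 0" using u99[of 6] by (simp add: laws del: One_nat_def)
  have [simp]: "R 4 6 4 7 = 0" using u31[of 6] by (simp add: laws del: One_nat_def)
  have [simp]: "R 1 5 5 7 = 0" using u40[of 7] by (simp add: laws del: One_nat_def)
  have [simp]: "R 3 6 3 7 = 0" using u123[of 7] by (simp add: laws del: One_nat_def)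
  have [simp]: "R 2 5 2 7 = 0" using u120[of 7] by (simp add: laws del: One_nat_def)
  have [simp]: "R 2 6 2 7 = 0" using u119[of 7] by (simp add: laws del: One_nat_def)
  have [simp]: "R 2 6 6 7 = 0" using u111[of 7] by (simp add: laws del: One_nat_def)
  have [simp]: "R 2 7 3 7 = 0" using u117[of 7] by (simp add: laws del: One_nat_def)
  have [simp]: "R 4 7 4 7 = 0" using u31[of 7] by (simp add: laws del: One_nat_def)
  note w117 = W[of 117, simplified coefficient_simps]
  have [simp]: "R 0 3 2 5 = 0" using w117[of 0] by (simp add: laws del: One_nat_def)
  note w113 = W[of 113, simplified coefficient_simps]
  have [simp]: "R 0 2 2 7 = 0" using w113[of 0] by (simp add: laws del: One_nat_def)
  note w39 = W[of 39, simplified coefficient_simps]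
  have [simp]: "R 0 1 1 3 = 0" using w39[of 1] by (simp add: laws del: One_nat_def)
  note w33 = W[of 33, simplified coefficient_simps]
  have [simp]: "R 0 1 1 6 = 0" using w33[of 1] by (simp add: laws del: One_nat_def)
  note w43 = W[of 43, simplified coefficient_simps]
  have [simp]: "R 1 3 1 4 = 0" using w43[of 1] by (simp add: laws del: One_nat_def)
  note w28 = W[of 28, simplified coefficient_simps]
  have [simp]: "R 1 4 1 5 = 0" using w28[of 1] by (simp add: laws del: One_nat_def)
  note w37 = W[of 37, simplified coefficient_simps]
  have [simp]: "R 1 4 1 6 = 0" using w37[of 1] by (simp add: laws del: One_nat_def)
  note w27 = W[of 27, simplified coefficient_simps]
  have [simp]: "R 1 4 1 7 = 0" using w27[of 1] by (simp add: laws del: One_nat_def)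
  note w59 = W[of 59, simplified coefficient_simps]
  have [simp]: "R 1 3 1 5 = 0" using w59[of 1] by (simp add: laws del: One_nat_def)
  have [simp]: "R 1 3 2 5 = 0" using w117[of 1] by (simp add: laws del: One_nat_def)
  have [simp]: "R 1 2 2 7 = 0" using w113[of 1] by (simp add: laws del: One_nat_def)
  note w0 = W[of 0, simplified coefficient_simps]
  have [simp]: "R 0 1 1 2 = 0" using w0[of 2] by (simp add: laws del: One_nat_def)
  note w4 = W[of 4, simplified coefficient_simps]
  have [simp]: "R 1 2 1 4 = 0" using w4[of 2] by (simp add: laws del: One_nat_def)
  note w20 = W[of 20, simplified coefficient_simps]
  have [simp]: "R 1 2 1 5 = 0" using w20[of 2] by (simp add: laws del: One_nat_def)
  note w19 = W[of 19, simplified coefficient_simps]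
  have [simp]: "R 1 2 1 7 = 0" using w19[of 2] by (simp add: laws del: One_nat_def)
  note w74 = W[of 74, simplified coefficient_simps]
  have [simp]: "R 2 5 4 5 = 0" using w74[of 2] by (simp add: laws del: One_nat_def)
  have [simp]: "R 0 3 1 3 = 0" using w39[of 3] by (simp add: laws del: One_nat_def)
  have [simp]: "R 1 3 1 7 = 0" using w19[of 3] by (simp add: laws del: One_nat_def)
  have [simp]: "R 1 3 3 5 = 0" using w59[of 3] by (simp add: laws del: One_nat_def)
  have [simp]: "R 2 4 2 7 = 0" using w113[of 4] by (simp add: laws del: One_nat_def)
  have [simp]: "R 1 5 1 7 = 0" using w19[of 5] by (simp add: laws del: One_nat_def)
  note w51 = W[of 51, simplified coefficient_simps]
  have [simp]: "R 4 5 5 7 = 0" using w51[of 5] by (simp add: laws del: One_nat_def)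
  have [simp]: "R 0 6 1 6 = 0" using w33[of 6] by (simp add: laws del: One_nat_def)
  have [simp]: "R 1 5 1 6 = 0" using w20[of 6] by (simp add: laws del: One_nat_def)
  note w54 = W[of 54, simplified coefficient_simps]
  have [simp]: "R 1 6 4 6 = 0" using w54[of 6] by (simp add: laws del: One_nat_def)
  have [simp]: "R 1 6 1 7 = 0" using w19[of 6] by (simp add: laws del: One_nat_def)
  have [simp]: "R 2 5 3 6 = 0" using w117[of 6] by (simp add: laws del: One_nat_def)
  have [simp]: "R 4 5 5 6 = 0" using w74[of 6] by (simp add: laws del: One_nat_def)
  have [simp]: "R 2 5 3 7 = 0" using w117[of 7] by (simp add: laws del: One_nat_def)
  have [simp]: "R 2 7 2 7 = 0" using w113[of 7] by (simp add: laws del: One_nat_def)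
  have [simp]: "R 4 7 5 7 = 0" using w51[of 7] by (simp add: laws del: One_nat_def)
  note u37 = U[of 37, simplified coefficient_simps]
  have [simp]: "R 0 4 0 6 = 0" using u37[of 0] by (simp add: laws del: One_nat_def)
  note u53 = U[of 53, simplified coefficient_simps]
  have [simp]: "R 0 5 0 6 = 0" using u53[of 0] by (simp add: laws del: One_nat_def)
  note u94 = U[of 94, simplified coefficient_simps]
  have [simp]: "R 0 2 2 4 = 0" using u94[of 0] by (simp add: laws del: One_nat_def)
  have [simp]: "R 0 2 3 5 = 0" using u128[of 0] by (simp add: laws del: One_nat_def)
  have [simp]: "R 1 2 2 4 = 0" using u94[of 1] by (simp add: laws del: One_nat_def)
  have [simp]: "R 1 2 3 5 = 0" using u128[of 1] by (simp add: laws del: One_nat_def)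
  note u41 = U[of 41, simplified coefficient_simps]
  have [simp]: "R 2 4 4 6 = 0" using u41[of 2] by (simp add: laws del: One_nat_def)
  note u61 = U[of 61, simplified coefficient_simps]
  have [simp]: "R 2 4 2 4 = 0" using u61[of 2] by (simp add: laws del: One_nat_def)
  have [simp]: "R 2 3 5 7 = 0" using u80[of 3] by (simp add: laws del: One_nat_def)
  note u84 = U[of 84, simplified coefficient_simps]
  have [simp]: "R 3 5 3 5 = 0" using u84[of 3] by (simp add: laws del: One_nat_def)
  have [simp]: "R 2 3 4 6 = 0" using u110[of 4] by (simp add: laws del: One_nat_def)
  note u127 = U[of 127, simplified coefficient_simps]
  have [simp]: "R 2 4 3 6 = 0" using u127[of 4] by (simp add: laws del: One_nat_def)
  have [simp]: "R 3 4 4 6 = 0" using u99[of 4] by (simp add: laws del: One_nat_def)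
  note u24 = U[of 24, simplified coefficient_simps]
  have [simp]: "R 0 5 0 5 = 0" using u24[of 5] by (simp add: laws del: One_nat_def)
  have [simp]: "R 0 5 2 5 = 0" using u61[of 5] by (simp add: laws del: One_nat_def)
  note u108 = U[of 108, simplified coefficient_simps]
  have [simp]: "R 3 5 3 7 = 0" using u108[of 5] by (simp add: laws del: One_nat_def)
  have [simp]: "R 2 3 5 6 = 0" using u110[of 5] by (simp add: laws del: One_nat_def)
  note u33 = U[of 33, simplified coefficient_simps]
  have [simp]: "R 0 6 0 6 = 0" using u33[of 6] by (simp add: laws del: One_nat_def)
  note u100 = U[of 100, simplified coefficient_simps]
  have [simp]: "R 2 3 6 7 = 0" using u100[of 6] by (simp add: laws del: One_nat_def)
  have [simp]: "R 2 6 3 7 = 0" using u117[of 6] by (simp add: laws del: One_nat_def)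
  note u39 = U[of 39, simplified coefficient_simps]
  have [simp]: "R 0 3 0 7 = 0" using u39[of 7] by (simp add: laws del: One_nat_def)
  note w131 = W[of 131, simplified coefficient_simps]
  have [simp]: "R 0 2 3 6 = 0" using w131[of 0] by (simp add: laws del: One_nat_def)
  have [simp]: "R 1 2 3 6 = 0" using w131[of 1] by (simp add: laws del: One_nat_def)
  note w29 = W[of 29, simplified coefficient_simps]
  have [simp]: "R 1 2 1 6 = 0" using w29[of 2] by (simp add: laws del: One_nat_def)
  note w64 = W[of 64, simplified coefficient_simps]
  have [simp]: "R 0 3 3 4 = 0" using w64[of 3] by (simp add: laws del: One_nat_def)
  note w63 = W[of 63, simplified coefficient_simps]
  have [simp]: "R 1 3 3 7 = 0" using w63[of 3] by (simp add: laws del: One_nat_def)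
  note w46 = W[of 46, simplified coefficient_simps]
  have [simp]: "R 0 7 3 7 = 0" using w46[of 3] by (simp add: laws del: One_nat_def)
  have [simp]: "R 1 3 1 6 = 0" using w29[of 3] by (simp add: laws del: One_nat_def)
  note w88 = W[of 88, simplified coefficient_simps]
  have [simp]: "R 3 4 3 7 = 0" using w88[of 3] by (simp add: laws del: One_nat_def)
  have [simp]: "R 1 4 5 7 = 0" using w43[of 4] by (simp add: laws del: One_nat_def)
  note w122 = W[of 122, simplified coefficient_simps]
  have [simp]: "R 2 4 3 5 = 0" using w122[of 4] by (simp add: laws del: One_nat_def)
  note w127 = W[of 127, simplified coefficient_simps]
  have [simp]: "R 2 3 4 5 = 0" using w127[of 4] by (simp add: laws del: One_nat_def)
  note w75 = W[of 75, simplified coefficient_simps]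
  have [simp]: "R 4 7 6 7 = 0" using w75[of 4] by (simp add: laws del: One_nat_def)
  note w123 = W[of 123, simplified coefficient_simps]
  have [simp]: "R 2 4 3 4 = 0" using w123[of 4] by (simp add: laws del: One_nat_def)
  note w47 = W[of 47, simplified coefficient_simps]
  have [simp]: "R 0 5 5 7 = 0" using w47[of 5] by (simp add: laws del: One_nat_def)
  have [simp]: "R 1 5 4 7 = 0" using w27[of 5] by (simp add: laws del: One_nat_def)
  note w105 = W[of 105, simplified coefficient_simps]
  have [simp]: "R 2 5 6 7 = 0" using w105[of 5] by (simp add: laws del: One_nat_def)
  have [simp]: "R 1 6 1 6 = 0" using w29[of 6] by (simp add: laws del: One_nat_def)
  note w79 = W[of 79, simplified coefficient_simps]
  have [simp]: "R 3 7 6 7 = 0" using w79[of 7] by (simp add: laws del: One_nat_def)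
  have [simp]: "R 2 7 4 7 = 0" using w75[of 7] by (simp add: laws del: One_nat_def)
  note u98 = U[of 98, simplified coefficient_simps]
  have [simp]: "R 0 2 0 3 = 0" using u98[of 0] by (simp add: laws del: One_nat_def)
  note u46 = U[of 46, simplified coefficient_simps]
  have [simp]: "R 0 7 4 7 = 0" using u46[of 0] by (simp add: laws del: One_nat_def)
  have [simp]: "R 0 3 3 7 = 0" using u108[of 0] by (simp add: laws del: One_nat_def)
  have [simp]: "R 0 3 2 6 = 0" using u110[of 0] by (simp add: laws del: One_nat_def)
  have [simp]: "R 1 3 2 6 = 0" using u110[of 1] by (simp add: laws del: One_nat_def)
  note u115 = U[of 115, simplified coefficient_simps]
  have [simp]: "R 1 3 3 4 = 0" using u115[of 1] by (simp add: laws del: One_nat_def)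
  note u78 = U[of 78, simplified coefficient_simps]
  have [simp]: "R 3 5 5 6 = 0" using u78[of 3] by (simp add: laws del: One_nat_def)
  note u43 = U[of 43, simplified coefficient_simps]
  have [simp]: "R 0 3 5 7 = 0" using u43[of 3] by (simp add: laws del: One_nat_def)
  have [simp]: "R 0 3 0 4 = 0" using u39[of 4] by (simp add: laws del: One_nat_def)
  have [simp]: "R 2 3 4 7 = 0" using u100[of 4] by (simp add: laws del: One_nat_def)
  note u75 = U[of 75, simplified coefficient_simps]
  have [simp]: "R 3 4 6 7 = 0" using u75[of 4] by (simp add: laws del: One_nat_def)
  have [simp]: "R 3 4 3 4 = 0" using u115[of 4] by (simp add: laws del: One_nat_def)
  note u65 = U[of 65, simplified coefficient_simps]
  have [simp]: "R 3 7 5 7 = 0" using u65[of 5] by (simp add: laws del: One_nat_def)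
  have [simp]: "R 3 5 6 7 = 0" using u75[of 5] by (simp add: laws del: One_nat_def)
  note u112 = U[of 112, simplified coefficient_simps]
  have [simp]: "R 2 5 5 6 = 0" using u112[of 5] by (simp add: laws del: One_nat_def)
  have [simp]: "R 2 5 5 7 = 0" using u80[of 5] by (simp add: laws del: One_nat_def)
  note u79 = U[of 79, simplified coefficient_simps]
  have [simp]: "R 2 7 5 7 = 0" using u79[of 5] by (simp add: laws del: One_nat_def)
  note u88 = U[of 88, simplified coefficient_simps]
  have [simp]: "R 3 5 5 7 = 0" using u88[of 5] by (simp add: laws del: One_nat_def)
  note u66 = U[of 66, simplified coefficient_simps]
  have [simp]: "R 3 6 5 7 = 0" using u66[of 6] by (simp add: laws del: One_nat_def)
  have [simp]: "R 2 6 5 7 = 0" using u80[of 6] by (simp add: laws del: One_nat_def)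
  note u67 = U[of 67, simplified coefficient_simps]
  have [simp]: "R 0 7 2 7 = 0" using u67[of 7] by (simp add: laws del: One_nat_def)
  have [simp]: "R 0 5 0 7 = 0" using u24[of 7] by (simp add: laws del: One_nat_def)
  have [simp]: "R 3 7 3 7 = 0" using u108[of 7] by (simp add: laws del: One_nat_def)
  note u96 = U[of 96, simplified coefficient_simps]
  have [simp]: "R 2 7 6 7 = 0" using u96[of 7] by (simp add: laws del: One_nat_def)
  have [simp]: "R 2 4 3 7 = 0" using u80[of 7] by (simp add: laws del: One_nat_def)
  have [simp]: "R 3 6 4 7 = 0" using u99[of 7] by (simp add: laws del: One_nat_def)
  note w110 = W[of 110, simplified coefficient_simps]
  have [simp]: "R 0 2 6 7 = 0" using w110[of 0] by (simp add: laws del: One_nat_def)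
  have [simp]: "R 1 2 6 7 = 0" using w110[of 1] by (simp add: laws del: One_nat_def)
  have [simp]: "R 0 5 3 7 = 0" using w47[of 3] by (simp add: laws del: One_nat_def)
  note w66 = W[of 66, simplified coefficient_simps]
  have [simp]: "R 0 6 3 6 = 0" using w66[of 3] by (simp add: laws del: One_nat_def)
  have [simp]: "R 0 6 4 6 = 0" using w66[of 4] by (simp add: laws del: One_nat_def)
  note w52 = W[of 52, simplified coefficient_simps]
  have [simp]: "R 1 4 6 7 = 0" using w52[of 4] by (simp add: laws del: One_nat_def)
  have [simp]: "R 2 4 6 7 = 0" using w110[of 4] by (simp add: laws del: One_nat_def)
  note w89 = W[of 89, simplified coefficient_simps]
  have [simp]: "R 3 6 5 6 = 0" using w89[of 5] by (simp add: laws del: One_nat_def)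
  note w80 = W[of 80, simplified coefficient_simps]
  have [simp]: "R 2 6 4 7 = 0" using w80[of 6] by (simp add: laws del: One_nat_def)
  have [simp]: "R 5 7 6 7 = 0" using w66[of 6] by (simp add: laws del: One_nat_def)
  have [simp]: "R 3 7 4 7 = 0" using w88[of 7] by (simp add: laws del: One_nat_def)
  have [simp]: "R 1 6 4 7 = 0" using w37[of 7] by (simp add: laws del: One_nat_def)
  have [simp]: "R 0 3 0 3 = 0" using u84[of 0] by (simp add: laws del: One_nat_def)
  note u58 = U[of 58, simplified coefficient_simps]
  have [simp]: "R 0 4 4 6 = 0" using u58[of 0] by (simp add: laws del: One_nat_def)
  have [simp]: "R 1 3 5 7 = 0" using u66[of 1] by (simp add: laws del: One_nat_def)
  note u47 = U[of 47, simplified coefficient_simps]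
  have [simp]: "R 2 4 5 7 = 0" using u47[of 2] by (simp add: laws del: One_nat_def)
  have [simp]: "R 5 6 5 6 = 0" using u78[of 6] by (simp add: laws del: One_nat_def)
  have [simp]: "R 3 6 6 7 = 0" using u75[of 6] by (simp add: laws del: One_nat_def)
  have [simp]: "R 4 6 5 6 = 0" using u79[of 6] by (simp add: laws del: One_nat_def)
  note w56 = W[of 56, simplified coefficient_simps]
  have [simp]: "R 0 6 2 7 = 0" using w56[of 2] by (simp add: laws del: One_nat_def)
  note w97 = W[of 97, simplified coefficient_simps]
  have [simp]: "R 3 5 4 6 = 0" using w97[of 4] by (simp add: laws del: One_nat_def)
  note w84 = W[of 84, simplified coefficient_simps]
  have [simp]: "R 2 5 4 7 = 0" using w84[of 4] by (simp add: laws del: One_nat_def)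
  have [simp]: "R 6 7 6 7 = 0" using w75[of 6] by (simp add: laws del: One_nat_def)
  note u106 = U[of 106, simplified coefficient_simps]
  have [simp]: "R 1 6 2 7 = 0" using u106[of 1] by (simp add: laws del: One_nat_def)
  note u56 = U[of 56, simplified coefficient_simps]
  have [simp]: "R 4 6 6 7 = 0" using u56[of 6] by (simp add: laws del: One_nat_def)
  note u74 = U[of 74, simplified coefficient_simps]
  have [simp]: "R 1 6 3 6 = 0" using u74[of 6] by (simp add: laws del: One_nat_def)
  have [simp]: "R 1 5 3 7 = 0" using u65[of 7] by (simp add: laws del: One_nat_def)
  have [simp]: "R 3 4 5 6 = 0" using w84[of 6] by (simp add: laws del: One_nat_def)
  note w68 = W[of 68, simplified coefficient_simps]
  have [simp]: "R 3 4 5 7 = 0" using w68[of 3] by (simp add: laws del: One_nat_def)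
  note u87 = U[of 87, simplified coefficient_simps]
  have [simp]: "R 5 6 6 7 = 0" using u87[of 7] by (simp add: laws del: One_nat_def)
  note w106 = W[of 106, simplified coefficient_simps]
  have [simp]: "R 2 5 4 6 = 0" using w106[of 4] by (simp add: laws del: One_nat_def)
  note w116 = W[of 116, simplified coefficient_simps]
  have [simp]: "R 2 4 5 6 = 0" using w116[of 4] by (simp add: laws del: One_nat_def)
  note w93 = W[of 93, simplified coefficient_simps]
  have [simp]: "R 3 5 4 7 = 0" using w93[of 5] by (simp add: laws del: One_nat_def)
  have [simp]: "R 0 6 6 7 = 0" using w56[of 6] by (simp add: laws del: One_nat_def)
  have [simp]: "R 4 6 4 6 = 0" using w79[of 6] by (simp add: laws del: One_nat_def)
  note u42 = U[of 42, simplified coefficient_simps]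
  have [simp]: "R 0 7 5 7 = 0" using u42[of 5] by (simp add: laws del: One_nat_def)
  note u54 = U[of 54, simplified coefficient_simps]
  have [simp]: "R 1 6 5 6 = 0" using u54[of 6] by (simp add: laws del: One_nat_def)
  have [simp]: "R 0 6 0 7 = 0" using u33[of 7] by (simp add: laws del: One_nat_def)
  note u63 = U[of 63, simplified coefficient_simps]
  have [simp]: "R 5 7 5 7 = 0" using u63[of 7] by (simp add: laws del: One_nat_def)
  have [simp]: "R 0 6 5 6 = 0" using w66[of 5] by (simp add: laws del: One_nat_def)
  have [simp]: "R 0 2 0 6 = 0" using u53[of 6] by (simp add: laws del: One_nat_def)
  \<comment> \<open>Four distinct indices carry two independent components, here R 0 1 4 5 and R 0 4
    1 5. A combination of two equations isolates the second one; a single equation then gives the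
    first.\<close>
  have [simp]: "R 0 4 1 5 = 0" using combine_zero[OF u28[of 1] u24[of 0], of "1" "-2"] by (simp add: laws algebra_simps del: One_nat_def)
  have [simp]: "R 0 1 4 5 = 0" using u24[of 0] by (simp add: laws del: One_nat_def)
  have [simp]: "R 0 4 0 4 = 0" using u25[of 4] by (simp add: laws del: One_nat_def)
  have [simp]: "R 0 4 3 5 = 0" using combine_zero[OF u28[of 3] u51[of 0], of "-1" "-2"] by (simp add: laws algebra_simps del: One_nat_def)
  have [simp]: "R 0 3 4 5 = 0" using u51[of 0] by (simp add: laws del: One_nat_def)
  have [simp]: "R 0 4 2 5 = 0" using combine_zero[OF u61[of 4] u28[of 2], of "-2" "1"] by (simp add: laws algebra_simps del: One_nat_def)
  have [simp]: "R 0 2 4 5 = 0" using u28[of 2] by (simp add: laws del: One_nat_def)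
  have [simp]: "R 0 5 1 7 = 0" using combine_zero[OF u19[of 5] u39[of 0], of "-1" "-1"] by (simp add: laws algebra_simps del: One_nat_def)
  have [simp]: "R 0 1 5 7 = 0" using u39[of 0] by (simp add: laws del: One_nat_def)
  have [simp]: "R 0 4 0 7 = 0" using u25[of 7] by (simp add: laws del: One_nat_def)
  note w48 = W[of 48, simplified coefficient_simps]
  have [simp]: "R 0 1 3 4 = 0" using w48[of 0] by (simp add: laws del: One_nat_def)
  note w69 = W[of 69, simplified coefficient_simps]
  have [simp]: "R 0 3 1 4 = 0" using w69[of 1] by (simp add: laws del: One_nat_def)
  have [simp]: "R 0 4 1 6 = 0" using combine_zero[OF u4[of 6] u33[of 0], of "1" "2"] by (simp add: laws algebra_simps del: One_nat_def)
  have [simp]: "R 0 1 4 6 = 0" using u33[of 0] by (simp add: laws del: One_nat_def)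
  have [simp]: "R 0 4 1 7 = 0" using combine_zero[OF u4[of 7] u19[of 4], of "-1" "-2"] by (simp add: laws algebra_simps del: One_nat_def)
  have [simp]: "R 0 1 4 7 = 0" using u19[of 4] by (simp add: laws del: One_nat_def)
  note w99 = W[of 99, simplified coefficient_simps]
  have [simp]: "R 0 3 2 7 = 0" using combine_zero[OF w99[of 0] u117[of 0], of "1" "1"] by (simp add: laws algebra_simps del: One_nat_def)
  have [simp]: "R 0 2 3 7 = 0" using u117[of 0] by (simp add: laws del: One_nat_def)
  have [simp]: "R 1 3 2 7 = 0" using combine_zero[OF w99[of 1] u117[of 1], of "1" "1"] by (simp add: laws algebra_simps del: One_nat_def)
  have [simp]: "R 1 2 3 7 = 0" using u117[of 1] by (simp add: laws del: One_nat_def)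
  note w24 = W[of 24, simplified coefficient_simps]
  have [simp]: "R 0 2 1 5 = 0" using combine_zero[OF w24[of 2] u20[of 2], of "1" "2"] by (simp add: laws algebra_simps del: One_nat_def)
  have [simp]: "R 0 1 2 5 = 0" using u20[of 2] by (simp add: laws del: One_nat_def)
  have [simp]: "R 0 2 0 4 = 0" using u25[of 2] by (simp add: laws del: One_nat_def)
  have [simp]: "R 0 3 1 5 = 0" using combine_zero[OF w24[of 3] u59[of 1], of "1" "2"] by (simp add: laws algebra_simps del: One_nat_def)
  have [simp]: "R 0 1 3 5 = 0" using u59[of 1] by (simp add: laws del: One_nat_def)
  have [simp]: "R 1 4 3 5 = 0" using combine_zero[OF w59[of 4] u51[of 1], of "1" "-1"] by (simp add: laws algebra_simps del: One_nat_def)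
  have [simp]: "R 1 3 4 5 = 0" using u51[of 1] by (simp add: laws del: One_nat_def)
  note w45 = W[of 45, simplified coefficient_simps]
  have [simp]: "R 1 3 1 3 = 0" using w45[of 3] by (simp add: laws del: One_nat_def)
  have [simp]: "R 0 4 3 4 = 0" using w64[of 4] by (simp add: laws del: One_nat_def)
  have [simp]: "R 0 4 5 7 = 0" using u43[of 4] by (simp add: laws del: One_nat_def)
  note u44 = U[of 44, simplified coefficient_simps]
  have [simp]: "R 0 5 4 7 = 0" using u44[of 5] by (simp add: laws del: One_nat_def)
  have [simp]: "R 0 3 1 6 = 0" using combine_zero[OF w39[of 6] w33[of 3], of "2" "-1"] by (simp add: laws algebra_simps del: One_nat_def)
  have [simp]: "R 0 1 3 6 = 0" using w33[of 3] by (simp add: laws del: One_nat_def)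
  have [simp]: "R 0 5 1 6 = 0" using combine_zero[OF w24[of 6] u20[of 6], of "2" "1"] by (simp add: laws algebra_simps del: One_nat_def)
  have [simp]: "R 0 1 5 6 = 0" using u20[of 6] by (simp add: laws del: One_nat_def)
  have [simp]: "R 1 5 4 6 = 0" using combine_zero[OF w28[of 6] w54[of 5], of "-1" "-2"] by (simp add: laws algebra_simps del: One_nat_def)
  have [simp]: "R 1 4 5 6 = 0" using w54[of 5] by (simp add: laws del: One_nat_def)
  have [simp]: "R 0 2 1 4 = 0" using combine_zero[OF u41[of 0] u4[of 2], of "-1" "-1"] by (simp add: laws algebra_simps del: One_nat_def)
  have [simp]: "R 0 1 2 4 = 0" using u4[of 2] by (simp add: laws del: One_nat_def)
  have [simp]: "R 0 1 6 7 = 0" using w52[of 0] by (simp add: laws del: One_nat_def)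
  note u48 = U[of 48, simplified coefficient_simps]
  have [simp]: "R 0 6 1 7 = 0" using u48[of 0] by (simp add: laws del: One_nat_def)
  have [simp]: "R 1 4 2 6 = 0" using combine_zero[OF u33[of 2] w54[of 2], of "2" "-1"] by (simp add: laws algebra_simps del: One_nat_def)
  have [simp]: "R 1 2 4 6 = 0" using w54[of 2] by (simp add: laws del: One_nat_def)
  have [simp]: "R 1 2 1 2 = 0" using w37[of 2] by (simp add: laws del: One_nat_def)
  have [simp]: "R 1 6 6 7 = 0" using w52[of 6] by (simp add: laws del: One_nat_def)
  have [simp]: "R 1 4 3 7 = 0" using combine_zero[OF u42[of 4] w27[of 3], of "-1" "2"] by (simp add: laws algebra_simps del: One_nat_def)
  have [simp]: "R 1 3 4 7 = 0" using w27[of 3] by (simp add: laws del: One_nat_def)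
  have [simp]: "R 0 5 3 6 = 0" using combine_zero[OF u78[of 5] u59[of 6], of "2" "-1"] by (simp add: laws algebra_simps del: One_nat_def)
  have [simp]: "R 0 3 5 6 = 0" using u59[of 6] by (simp add: laws del: One_nat_def)
  have [simp]: "R 4 6 5 7 = 0" using u47[of 6] by (simp add: laws del: One_nat_def)
  have [simp]: "R 4 5 6 7 = 0" using u79[of 7] by (simp add: laws del: One_nat_def)
  note w23 = W[of 23, simplified coefficient_simps]
  have [simp]: "R 0 2 1 7 = 0" using combine_zero[OF w23[of 2] u19[of 2], of "1" "-2"] by (simp add: laws algebra_simps del: One_nat_def)
  have [simp]: "R 0 1 2 7 = 0" using u19[of 2] by (simp add: laws del: One_nat_def)
  have [simp]: "R 1 4 2 5 = 0" using combine_zero[OF w45[of 2] w28[of 2], of "-1" "2"] by (simp add: laws algebra_simps del: One_nat_def)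
  have [simp]: "R 1 2 4 5 = 0" using w28[of 2] by (simp add: laws del: One_nat_def)
  have [simp]: "R 0 2 0 5 = 0" using u24[of 2] by (simp add: laws del: One_nat_def)
  note w57 = W[of 57, simplified coefficient_simps]
  have [simp]: "R 0 5 5 6 = 0" using w57[of 5] by (simp add: laws del: One_nat_def)
  have [simp]: "R 0 3 0 6 = 0" using u78[of 0] by (simp add: laws del: One_nat_def)
  note u57 = U[of 57, simplified coefficient_simps]
  have [simp]: "R 0 4 2 4 = 0" using u57[of 4] by (simp add: laws del: One_nat_def)
  have [simp]: "R 1 5 6 7 = 0" using w52[of 5] by (simp add: laws del: One_nat_def)
  have [simp]: "R 0 4 6 7 = 0" using u56[of 0] by (simp add: laws del: One_nat_def)
  note w53 = W[of 53, simplified coefficient_simps]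
  have [simp]: "R 1 6 5 7 = 0" using w53[of 7] by (simp add: laws del: One_nat_def)
  have [simp]: "R 0 6 4 7 = 0" using u44[of 6] by (simp add: laws del: One_nat_def)
  have [simp]: "R 1 4 3 6 = 0" using combine_zero[OF u33[of 3] w54[of 3], of "2" "-1"] by (simp add: laws algebra_simps del: One_nat_def)
  have [simp]: "R 1 3 4 6 = 0" using w54[of 3] by (simp add: laws del: One_nat_def)
  have [simp]: "R 0 3 1 7 = 0" using combine_zero[OF w23[of 3] u19[of 3], of "1" "-2"] by (simp add: laws algebra_simps del: One_nat_def)
  have [simp]: "R 0 1 3 7 = 0" using u19[of 3] by (simp add: laws del: One_nat_def)
  have [simp]: "R 0 7 0 7 = 0" using u42[of 0] by (simp add: laws del: One_nat_def)
  note w49 = W[of 49, simplified coefficient_simps]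
  have [simp]: "R 0 5 4 6 = 0" using combine_zero[OF w49[of 6] u28[of 6], of "1" "1"] by (simp add: laws algebra_simps del: One_nat_def)
  have [simp]: "R 0 4 5 6 = 0" using u28[of 6] by (simp add: laws del: One_nat_def)
  note u50 = U[of 50, simplified coefficient_simps]
  note u27 = U[of 27, simplified coefficient_simps]
  have [simp]: "R 0 4 3 7 = 0" using combine_zero[OF u50[of 0] u27[of 3], of "-2" "-1"] by (simp add: laws algebra_simps del: One_nat_def)
  have [simp]: "R 0 3 4 7 = 0" using u27[of 3] by (simp add: laws del: One_nat_def)
  have [simp]: "R 0 2 0 7 = 0" using u67[of 0] by (simp add: laws del: One_nat_def)
  have [simp]: "R 0 2 1 3 = 0" using combine_zero[OF u98[of 1] w39[of 2], of "-2" "1"] by (simp add: laws algebra_simps del: One_nat_def)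
  have [simp]: "R 0 1 2 3 = 0" using w39[of 2] by (simp add: laws del: One_nat_def)
  note w61 = W[of 61, simplified coefficient_simps]
  have [simp]: "R 1 5 2 6 = 0" using combine_zero[OF u112[of 1] w61[of 6], of "-2" "1"] by (simp add: laws algebra_simps del: One_nat_def)
  have [simp]: "R 1 2 5 6 = 0" using w61[of 6] by (simp add: laws del: One_nat_def)
  have [simp]: "R 0 2 1 2 = 0" using w53[of 2] by (simp add: laws del: One_nat_def)
  have [simp]: "R 1 4 2 7 = 0" using combine_zero[OF w75[of 1] w27[of 2], of "1" "2"] by (simp add: laws algebra_simps del: One_nat_def)
  have [simp]: "R 1 2 4 7 = 0" using w27[of 2] by (simp add: laws del: One_nat_def)
  have [simp]: "R 0 4 3 6 = 0" using combine_zero[OF u56[of 4] u99[of 0], of "-2" "-1"] by (simp add: laws algebra_simps del: One_nat_def)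
  have [simp]: "R 0 3 4 6 = 0" using u99[of 0] by (simp add: laws del: One_nat_def)
  note u77 = U[of 77, simplified coefficient_simps]
  have [simp]: "R 0 5 6 7 = 0" using u77[of 0] by (simp add: laws del: One_nat_def)
  note w76 = W[of 76, simplified coefficient_simps]
  have [simp]: "R 0 6 5 7 = 0" using w76[of 0] by (simp add: laws del: One_nat_def)
  have [simp]: "R 0 3 2 4 = 0" using combine_zero[OF w64[of 2] w123[of 0], of "-2" "-1"] by (simp add: laws algebra_simps del: One_nat_def)
  have [simp]: "R 0 2 3 4 = 0" using w123[of 0] by (simp add: laws del: One_nat_def)
  have [simp]: "R 0 3 6 7 = 0" using u75[of 0] by (simp add: laws del: One_nat_def)
  have [simp]: "R 0 6 3 7 = 0" using u46[of 6] by (simp add: laws del: One_nat_def)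
  have [simp]: "R 5 6 5 7 = 0" using u78[of 7] by (simp add: laws del: One_nat_def)
  have [simp]: "R 0 2 5 7 = 0" using u43[of 2] by (simp add: laws del: One_nat_def)
  have [simp]: "R 0 5 2 7 = 0" using u67[of 5] by (simp add: laws del: One_nat_def)
  note u85 = U[of 85, simplified coefficient_simps]
  have [simp]: "R 0 2 0 2 = 0" using u85[of 0] by (simp add: laws del: One_nat_def)
  have [simp]: "R 1 3 2 4 = 0" using combine_zero[OF w57[of 3] u41[of 3], of "2" "-1"] by (simp add: laws algebra_simps del: One_nat_def)
  have [simp]: "R 1 2 3 4 = 0" using u41[of 3] by (simp add: laws del: One_nat_def)
  have [simp]: "R 1 2 5 7 = 0" using w43[of 2] by (simp add: laws del: One_nat_def)
  have [simp]: "R 1 3 6 7 = 0" using u75[of 1] by (simp add: laws del: One_nat_def)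
  note w60 = W[of 60, simplified coefficient_simps]
  have [simp]: "R 1 5 2 7 = 0" using w60[of 5] by (simp add: laws del: One_nat_def)
  have [simp]: "R 1 6 3 7 = 0" using w63[of 6] by (simp add: laws del: One_nat_def)
  have [simp]: "R 0 7 6 7 = 0" using u42[of 6] by (simp add: laws del: One_nat_def)
  have [simp]: "R 1 5 3 6 = 0" using combine_zero[OF w56[of 5] w59[of 6], of "-1" "1"] by (simp add: laws algebra_simps del: One_nat_def)
  have [simp]: "R 1 3 5 6 = 0" using w59[of 6] by (simp add: laws del: One_nat_def)
  have [simp]: "R 0 2 1 6 = 0" using combine_zero[OF w53[of 6] w33[of 2], of "-2" "-1"] by (simp add: laws algebra_simps del: One_nat_def)
  have [simp]: "R 0 1 2 6 = 0" using w33[of 2] by (simp add: laws del: One_nat_def)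
  note u76 = U[of 76, simplified coefficient_simps]
  have [simp]: "R 0 4 2 7 = 0" using combine_zero[OF u76[of 0] u27[of 2], of "-2" "1"] by (simp add: laws algebra_simps del: One_nat_def)
  have [simp]: "R 0 2 4 7 = 0" using u27[of 2] by (simp add: laws del: One_nat_def)
  note u86 = U[of 86, simplified coefficient_simps]
  have [simp]: "R 0 4 2 6 = 0" using combine_zero[OF u86[of 0] u37[of 2], of "-2" "-1"] by (simp add: laws algebra_simps del: One_nat_def)
  have [simp]: "R 0 2 4 6 = 0" using u37[of 2] by (simp add: laws del: One_nat_def)
  note w86 = W[of 86, simplified coefficient_simps]
  have [simp]: "R 0 5 2 6 = 0" using combine_zero[OF w86[of 5] u61[of 6], of "-1" "-2"] by (simp add: laws algebra_simps del: One_nat_def)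
  have [simp]: "R 0 2 5 6 = 0" using u61[of 6] by (simp add: laws del: One_nat_def)
  \<comment> \<open>The 28 increasing pairs; the symmetries reduce every component to one indexed by
    two of them.\<close>
  let ?P = "{(0, 1), (0, 2), (0, 3), (0, 4), (0, 5), (0, 6), (0, 7), (1, 2), (1, 3), (1, 4), (1, 5), (1, 6), (1, 7), (2, 3),
    (2, 4), (2, 5), (2, 6), (2, 7), (3, 4), (3, 5), (3, 6), (3, 7), (4, 5), (4, 6), (4, 7), (5, 6), (5, 7), (6, 7)} :: (nat \<times> nat) set"
  have "\<forall>p\<in>?P. \<forall>q\<in>?P. R (fst p) (snd p) (fst q) (snd q) = 0"
    unfolding ball_simps fst_conv snd_conv by (intro conjI TrueI; simp)
  moreover have "(i, j) \<in> ?P" if "i < j" "j \<le> 7" for i j :: nat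
  proof -
    have "j \<in> {1, 2, 3, 4, 5, 6, 7}" using that by auto
    then show ?thesis using that(1) by (elim insertE emptyE; simp; arith)
  qed
  ultimately have z: "R i j k l = 0" if "i < j" "j \<le> 7" "k < l" "l \<le> 7" for i j k l
    using that by (metis fst_conv snd_conv)
  show ?thesis
  proof (cases i j rule: linorder_cases)
    case less
    then show ?thesis using z[of i j] laws(2,6) le by (cases k l rule: linorder_cases) simp_all
  next
    case equal
    then show ?thesis using laws(5) by simp
  next
    case greater
    then show ?thesis using z[of j i] laws(1,2,6) le by (cases k l rule: linorder_cases) simp_all
  qed
qed

text \<open>The six free coordinates are monomials in t, and the solved coordinates follow from
  them: for instance y5 = a g has exponent 4 + 20 = 24, and the three terms c d, -c y5, e y6 of w_2
  have exponents 48, 53, 58.\<close>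

lemma curve_frame:
  "graph_frame (t ^ 4) (t ^ 29) (t ^ 19) (t ^ 25) (t ^ 23) (t ^ 20) 0 = frame_of (curve curve_u t) (curve curve_w t)"
  by (rule frame_eqI; unfold graph_frame_def Let_def frame_of_nth vec_eq_iff all_8;
      simp add: curve_u_def curve_w_def algebra_simps flip: power_add)

lemma of_nat_8: "\<exists>n\<le>7. (i :: 8) = of_nat n"
proof -
  have "(of_nat ` {..7}) = (UNIV :: 8 set)"
    unfolding UNIV_8 by (simp add: atMost_nat_numeral atMost_Suc eval_nat_numeral insert_commute)
  then show ?thesis by (metis UNIV_I atMost_iff imageE)
qed

lemma curvature_zero_if_singular_at_graph_frames:
  assumes r: "curvature r" and ref: "r 1 2 1 3 = 0"
    and sing: "\<And>a c d e f g. singular_tensor r (graph_frame a c d e f g 0)"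
  shows "\<forall>i j k l. r i j k l = 0"
proof -
  let ?R = "\<lambda>i j k l. r (of_nat i) (of_nat j) (of_nat k) (of_nat l)"
  have s: "contract r (curve curve_u t) (curve curve_w t) (curve curve_u t) (e8 l) = 0"
    "contract r (curve curve_u t) (curve curve_w t) (curve curve_w t) (e8 l) = 0" for t l
    using sing[of "t ^ 4" "t ^ 29" "t ^ 19" "t ^ 25" "t ^ 23" "t ^ 20"]
    unfolding curve_frame singular_tensor_def by simp_all
  have z: "?R i j k l = 0" if "i \<le> 7" "j \<le> 7" "k \<le> 7" "l \<le> 7" for i j k l
    by (rule curvature_nat_zero[of ?R, OF curvatureD(1)[OF r] curvatureD(2)[OF r] curvatureD(3)[OF r] _
        curve_equation[OF s(1)] curve_equation[OF s(2)] that]) (simp add: ref)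
  show ?thesis
  proof (intro allI)
    fix i j k l
    show "r i j k l = 0" using z of_nat_8[of i] of_nat_8[of j] of_nat_8[of k] of_nat_8[of l] by auto
  qed
qed

text \<open>The linear form of uniqueness. Singularity is tested only at the frames of
  \<open>degenerate\<close>, which are described by polynomials, so that the condition on v is
  constructible.\<close>

definition good :: "ext8 \<Rightarrow> bool" where
  "good v \<longleftrightarrow> (\<forall>r. curvature r \<and> r 1 2 1 3 = 0 \<and> (\<forall>M. degenerate v M \<longrightarrow> singular_tensor r M) \<longrightarrow> (\<forall>i j k l. r i j k l = 0))"

text \<open>Counterexamples for 4-vectors tending to \<open>base_point\<close>, scaled to norm one,
  accumulate at a nonzero tensor. Since degenerate frames deform, this limit is singular at all
  frames with h = 0 and therefore zero, a contradiction.\<close>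

lemma good_near_base_point:
  obtains \<delta> where "\<delta> > 0" "\<And>v. dist v base_point < \<delta> \<Longrightarrow> good v"
proof (rule ccontr)
  assume none: "\<not> thesis"
  \<comment> \<open>Tensors are stored as nested vectors here, to have a norm and a compact unit
    sphere.\<close>
  let ?T = "\<lambda>(R :: complex ^ 8 ^ 8 ^ 8 ^ 8) i j k l. R $ i $ j $ k $ l"
  have "\<exists>v R. dist v base_point < inverse (real (Suc n)) \<and> norm R = 1 \<and> curvature (?T R) \<and> ?T R 1 2 1 3 = 0 \<and>
      (\<forall>M. degenerate v M \<longrightarrow> singular_tensor (?T R) M)" for n
  proof -
    have "\<exists>v. dist v base_point < inverse (real (Suc n)) \<and> \<not> good v"
      using none that[of "inverse (real (Suc n))"] by auto
    then obtain v r where v: "dist v base_point < inverse (real (Suc n))" and r: "curvature r" "r 1 2 1 3 = 0"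
      "\<forall>M. degenerate v M \<longrightarrow> singular_tensor r M" "\<not> (\<forall>i j k l. r i j k l = 0)"
      unfolding good_def by blast
    define R where "R = (\<chi> i j k l. r i j k l)"
    have R: "?T R = r" by (simp add: R_def)
    have "R \<noteq> 0" using r(4) by (auto simp: R_def vec_eq_iff)
    define c where "c = complex_of_real (inverse (norm R))"
    have sc: "?T (inverse (norm R) *\<^sub>R R) = (\<lambda>i j k l. c * r i j k l)"
      unfolding fun_eq_iff vector_scaleR_component by (simp add: R_def c_def scaleR_conv_of_real)
    have "singular_tensor (\<lambda>i j k l. c * r i j k l) M" if "singular_tensor r M" for M
      using singular_tensor_combine[OF that that, of c 0] by simp
    moreover have "curvature (\<lambda>i j k l. c * r i j k l)"
      using curvature_combine[OF r(1) r(1), of c 0] by simp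
    moreover have "norm (inverse (norm R) *\<^sub>R R) = 1" using \<open>R \<noteq> 0\<close> by simp
    moreover have "R $ 1 $ 2 $ 1 $ 3 = 0" using r(2) by (simp add: R_def)
    ultimately show ?thesis using v r(2,3)
      by (intro exI[of _ v] exI[of _ "inverse (norm R) *\<^sub>R R"]) (simp only: sc, simp)
  qed
  then obtain v R where vR: "\<And>n. dist (v n) base_point < inverse (real (Suc n))" "\<And>n. norm (R n) = 1"
    "\<And>n. curvature (?T (R n))" "\<And>n. ?T (R n) 1 2 1 3 = 0"
    "\<And>n M. degenerate (v n) M \<Longrightarrow> singular_tensor (?T (R n)) M"
    by metis
  have "\<forall>n. R n \<in> sphere 0 1" using vR(2) by simp
  then obtain Q s where Q: "Q \<in> sphere 0 1" "strict_mono s" "(R \<circ> s) \<longlonglongrightarrow> Q"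
    using compact_sphere[of 0 1] unfolding compact_def by metis
  have nth: "(\<lambda>n. R (s n) $ i $ j $ k $ l) \<longlonglongrightarrow> Q $ i $ j $ k $ l" for i j k l
    using Q(3) by (intro tendsto_vec_nth) (simp add: comp_def)
  have curv: "curvature (?T Q)"
    unfolding curvature_def
  proof (intro allI conjI)
    fix i j k l
    have c: "R (s n) $ j $ i $ k $ l = - (R (s n) $ i $ j $ k $ l)" "R (s n) $ k $ l $ i $ j = R (s n) $ i $ j $ k $ l"
      "R (s n) $ i $ j $ k $ l + R (s n) $ j $ k $ i $ l + R (s n) $ k $ i $ j $ l = 0" for n
      by (rule curvatureD[OF vR(3)])+
    show "Q $ j $ i $ k $ l = - (Q $ i $ j $ k $ l)"
      using nth[of j i k l] tendsto_minus[OF nth[of i j k l]] unfolding c(1) by (rule LIMSEQ_unique)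
    show "Q $ k $ l $ i $ j = Q $ i $ j $ k $ l"
      using nth[of k l i j] nth[of i j k l] unfolding c(2) by (rule LIMSEQ_unique)
    have "(\<lambda>n. R (s n) $ i $ j $ k $ l + R (s n) $ j $ k $ i $ l + R (s n) $ k $ i $ j $ l) \<longlonglongrightarrow>
      Q $ i $ j $ k $ l + Q $ j $ k $ i $ l + Q $ k $ i $ j $ l"
      by (intro tendsto_add nth)
    then show "Q $ i $ j $ k $ l + Q $ j $ k $ i $ l + Q $ k $ i $ j $ l = 0"
      unfolding c(3) by (rule LIMSEQ_unique[OF tendsto_const, symmetric])
  qed
  have ref: "Q $ 1 $ 2 $ 1 $ 3 = 0"
    using nth[of 1 2 1 3] unfolding vR(4) by (rule LIMSEQ_unique[OF _ tendsto_const])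
  have "singular_tensor (?T Q) (graph_frame a c d e f g 0)" for a c d e f g
  proof -
    let ?M = "graph_frame a c d e f g"
    \<comment> \<open>If the limit value were nonzero, it would stay nonzero for tensors near Q and
      small h; but for large n the 4-vector v (s n) has a degenerate frame with such an h, where the
      value is zero.\<close>
    have lim: "contract (?T Q) (?M 0 $ p) (?M 0 $ q) (?M 0 $ r) (e8 k) = 0"
      if z: "\<And>n h. degenerate (v n) (?M h) \<Longrightarrow> contract (?T (R n)) (?M h $ p) (?M h $ q) (?M h $ r) (e8 k) = 0" for p q r k
    proof (rule ccontr)
      let ?C = "\<lambda>P. contract (?T (fst P)) (?M (snd P) $ p) (?M (snd P) $ q) (?M (snd P) $ r) (e8 k)"
      assume ne: "\<not> ?thesis"
      have M: "continuous_on UNIV (\<lambda>P :: _ \<times> (complex ^ 6). ?M (snd P) $ k $ l)" for k l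
        by (rule continuous_on_compose2[OF continuous_graph_frame[of UNIV]]) (auto intro: continuous_intros)
      have "continuous_on UNIV ?C"
        unfolding contract_def by (intro continuous_intros M)
      then have "open {P. ?C P \<noteq> 0}" by (intro open_Collect_neq continuous_on_const)
      moreover have "(Q, 0) \<in> {P. ?C P \<noteq> 0}" using ne by simp
      ultimately obtain A B where AB': "open A" "open B" "(Q, 0) \<in> A \<times> B" "A \<times> B \<subseteq> {P. ?C P \<noteq> 0}"
        by (rule open_prod_elim)
      then have AB: "open A" "open B" "Q \<in> A" "0 \<in> B" by simp_all
      obtain \<epsilon> where \<epsilon>: "\<epsilon> > 0" "cball 0 \<epsilon> \<subseteq> B" using AB(2,4) open_contains_cball by blast
      obtain \<delta> where \<delta>: "\<delta> > 0" "\<And>v. dist v base_point < \<delta> \<Longrightarrow> \<exists>h. norm h \<le> \<epsilon> \<and> degenerate v (?M h)"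
        using degenerate_near_base_point[OF \<epsilon>(1), of a c d e f g] by metis
      have "\<forall>\<^sub>F n in sequentially. R (s n) \<in> A"
        using topological_tendstoD[OF Q(3) AB(1,3)] by (simp add: comp_def)
      moreover have "\<forall>\<^sub>F n in sequentially. inverse (real (Suc n)) < \<delta>"
        using LIMSEQ_inverse_real_of_nat \<delta>(1) by (rule order_tendstoD)
      then have "\<forall>\<^sub>F n in sequentially. inverse (real (Suc (s n))) < \<delta>"
        using filterlim_subseq[OF Q(2)] by (rule eventually_compose_filterlim)
      ultimately have "\<forall>\<^sub>F n in sequentially. R (s n) \<in> A \<and> inverse (real (Suc (s n))) < \<delta>"
        by eventually_elim simp
      then obtain n where n: "R (s n) \<in> A" "inverse (real (Suc (s n))) < \<delta>"
        by (auto simp: eventually_sequentially)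
      then obtain h where h: "norm h \<le> \<epsilon>" "degenerate (v (s n)) (?M h)"
        using \<delta>(2)[of "v (s n)"] vR(1)[of "s n"] by fastforce
      have "(R (s n), h) \<in> A \<times> B" using n(1) h(1) \<epsilon>(2) by auto
      then have "?C (R (s n), h) \<noteq> 0" using AB'(4) by blast
      then show False using z[OF h(2)] by simp
    qed
    show ?thesis
      unfolding singular_tensor_def
      by (intro allI conjI lim) (use vR(5) in \<open>auto simp: singular_tensor_def\<close>)
  qed
  then have "\<forall>i j k l. Q $ i $ j $ k $ l = 0" using curvature_zero_if_singular_at_graph_frames[OF curv ref] by blast
  then have "Q = 0" by (simp add: vec_eq_iff)
  then show False using Q(1) by simp
qed

section \<open>General 4-vectors\<close>

lemma constructible_eq: "f \<in> coord_polys \<Longrightarrow> g \<in> coord_polys \<Longrightarrow> {x. f x = g x} \<in> constructible"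
  using constructible.zeros[OF coord_polys_intros(5), of f g] by simp

lemma constructible_not: "{x. P x} \<in> constructible \<Longrightarrow> {x. \<not> P x} \<in> constructible"
  using constructible.Compl[of "Collect P"] by (simp add: Collect_neg_eq)

lemma constructible_conj:
  "{x. P x} \<in> constructible \<Longrightarrow> {x. Q x} \<in> constructible \<Longrightarrow> {x. P x \<and> Q x} \<in> constructible"
  using constructible_Int[of "Collect P" "Collect Q"] by (simp add: Collect_conj_eq)

text \<open>For premises that do not involve the point, such as the comparison of indices in
  \<open>degenerate\<close>.\<close>

lemma constructible_if_const: "(P \<Longrightarrow> {x. Q x} \<in> constructible) \<Longrightarrow> {x. P \<longrightarrow> Q x} \<in> constructible"
  by (cases P) (use constructible_UNIV in simp_all)

lemmas constructible_Collect = constructible_eq constructible_not constructible_conj constructible_if_const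

lemma constructible_Ball:
  assumes "finite I" "\<And>i. i \<in> I \<Longrightarrow> {x. P i x} \<in> constructible"
  shows "{x. \<forall>i\<in>I. P i x} \<in> constructible"
  using constructible_INT[OF assms] by (simp add: Collect_ball_eq)

lemma constructible_All:
  fixes P :: "'i :: finite \<Rightarrow> ('k \<Rightarrow> complex) \<Rightarrow> bool"
  assumes "\<And>i. {x. P i x} \<in> constructible"
  shows "{x. \<forall>i. P i x} \<in> constructible"
  using constructible_Ball[of UNIV P] assms by simp

text \<open>The coordinates of a triple of 4-vector, tensor and frame in a single affine space;
  quantifying over a tensor or a frame is then a projection along finitely many coordinates.\<close>

type_synonym index = "8 set + ((8 \<times> 8 \<times> 8 \<times> 8) + (2 \<times> 8))"

definition tensor_part :: "(index \<Rightarrow> complex) \<Rightarrow> 8 \<Rightarrow> 8 \<Rightarrow> 8 \<Rightarrow> 8 \<Rightarrow> complex" where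
  "tensor_part x i j k l = x (Inr (Inl (i, j, k, l)))"

definition frame_part :: "(index \<Rightarrow> complex) \<Rightarrow> frame" where
  "frame_part x = (\<chi> p q. x (Inr (Inr (p, q))))"

definition ext_part :: "(index \<Rightarrow> complex) \<Rightarrow> ext8" where
  "ext_part x = (\<chi> I. x (Inl I))"

lemma coord_polys_parts:
  "(\<lambda>x. tensor_part x i j k l) \<in> coord_polys" "(\<lambda>x. frame_part x $ p $ q) \<in> coord_polys"
  "(\<lambda>x. ext_part x $ I) \<in> coord_polys"
  unfolding tensor_part_def frame_part_def ext_part_def vec_lambda_beta by (rule coord_polys_intros(2))+

lemma coord_polys_minus: "f \<in> coord_polys \<Longrightarrow> (\<lambda>x. - f x) \<in> coord_polys"
  using coord_polys_intros(5)[OF coord_polys_intros(1)[of 0], of f] by simp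

lemma coord_polys_sum: "(\<And>a. a \<in> A \<Longrightarrow> (\<lambda>x. f a x) \<in> coord_polys) \<Longrightarrow> (\<lambda>x. \<Sum>a\<in>A. f a x) \<in> coord_polys"
  unfolding coord_polys_def by (rule poly_sum)

lemma coord_polys_psi: "(\<lambda>x. psi (ext_part x) (frame_part x) y z) \<in> coord_polys"
  using coord_polys_parts(2,3) unfolding coord_polys_def
  by (intro poly_psi poly_functions.const)

lemma constructible_curvature: "{x. curvature (tensor_part x)} \<in> constructible"
  unfolding curvature_def
  by (intro constructible_All constructible_Collect coord_polys_intros coord_polys_minus coord_polys_parts)

lemma constructible_degenerate: "{x. degenerate (ext_part x) (frame_part x)} \<in> constructible"
  unfolding degenerate_def std_chart_def defect_def
  by (intro constructible_Ball constructible_Collect coord_polys_intros coord_polys_parts coord_polys_psi finite.intros)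

lemma constructible_singular: "{x. singular_tensor (tensor_part x) (frame_part x)} \<in> constructible"
  unfolding singular_tensor_def contract_def
  by (intro constructible_All constructible_Collect coord_polys_intros coord_polys_parts coord_polys_sum)

text \<open>The tensor and frame coordinates get the dummy value 0; the quantifiers project them
  away.\<close>

definition embed :: "ext8 \<Rightarrow> index \<Rightarrow> complex" where
  "embed v k = (case k of Inl I \<Rightarrow> v $ I | Inr _ \<Rightarrow> 0)"

text \<open>Two nested projections: \<open>?D\<close> collects the pairs of v and r with a
  degenerate frame at which r is not singular, \<open>?B\<close> the nonzero normalised tensors
  without such a frame, and \<open>?G\<close> the 4-vectors that admit no tensor of
  \<open>?B\<close>.\<close>

lemma constructible_good: "\<exists>G \<in> constructible. \<forall>v. embed v \<in> G \<longleftrightarrow> good v"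
proof -
  let ?F = "range (\<lambda>k. Inr (Inr k)) :: index set" and ?T = "range (\<lambda>k. Inr (Inl k)) :: index set"
  let ?E = "{x. degenerate (ext_part x) (frame_part x) \<and> \<not> singular_tensor (tensor_part x) (frame_part x)}"
  let ?D = "{x. \<exists>y. (\<forall>k. k \<notin> ?F \<longrightarrow> y k = x k) \<and> y \<in> ?E}"
  let ?B = "{x. (curvature (tensor_part x) \<and> tensor_part x 1 2 1 3 = 0 \<and> \<not> (\<forall>i j k l. tensor_part x i j k l = 0)) \<and> \<not> (x \<in> ?D)}"
  let ?G = "{x. \<not> (\<exists>y. (\<forall>k. k \<notin> ?T \<longrightarrow> y k = x k) \<and> y \<in> ?B)}"
  have fin: "finite ?F" "finite ?T" by simp_all
  have "?E \<in> constructible"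
    by (intro constructible_Collect constructible_degenerate constructible_singular)
  then have D: "?D \<in> constructible" by (rule constructible_project_finite[OF fin(1)])
  have "?B \<in> constructible"
    by (intro constructible_Collect(2,3) constructible_curvature constructible_All constructible_Collect(1)
        coord_polys_parts coord_polys_intros(1)) (use D in simp)
  then have G: "?G \<in> constructible"
    by (intro constructible_Collect(2) constructible_project_finite fin(2))
  have D_iff: "x \<in> ?D \<longleftrightarrow> (\<exists>M. degenerate (ext_part x) M \<and> \<not> singular_tensor (tensor_part x) M)" for x
  proof
    assume "x \<in> ?D"
    then obtain y where y: "\<And>k. k \<notin> ?F \<Longrightarrow> y k = x k" "y \<in> ?E" by blast
    have "ext_part y = ext_part x" "tensor_part y = tensor_part x"
      by (auto simp: ext_part_def tensor_part_def vec_eq_iff fun_eq_iff intro!: y(1))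
    with y(2) show "\<exists>M. degenerate (ext_part x) M \<and> \<not> singular_tensor (tensor_part x) M" by auto
  next
    assume "\<exists>M. degenerate (ext_part x) M \<and> \<not> singular_tensor (tensor_part x) M"
    then obtain M where M: "degenerate (ext_part x) M" "\<not> singular_tensor (tensor_part x) M" by blast
    define y where "y k = (case k of Inr (Inr (p, q)) \<Rightarrow> M $ p $ q | _ \<Rightarrow> x k)" for k
    have "ext_part y = ext_part x" "tensor_part y = tensor_part x" "frame_part y = M"
      by (auto simp: ext_part_def tensor_part_def frame_part_def vec_eq_iff fun_eq_iff y_def)
    moreover have "y k = x k" if "k \<notin> ?F" for k using that by (auto simp: y_def split: sum.split prod.split)
    ultimately show "x \<in> ?D" using M by (intro CollectI exI[of _ y]) simp
  qed
  have iff: "(\<exists>y. (\<forall>k. k \<notin> ?T \<longrightarrow> y k = embed v k) \<and> y \<in> ?B) \<longleftrightarrow> \<not> good v" for v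
  proof
    assume "\<exists>y. (\<forall>k. k \<notin> ?T \<longrightarrow> y k = embed v k) \<and> y \<in> ?B"
    then obtain y where y: "\<And>k. k \<notin> ?T \<Longrightarrow> y k = embed v k" "y \<in> ?B" by blast
    have "ext_part y $ I = v $ I" for I using y(1)[of "Inl I"] by (auto simp: ext_part_def embed_def)
    then have "ext_part y = v" by (simp add: vec_eq_iff)
    then show "\<not> good v"
      using y(2) D_iff[of y] unfolding good_def by (auto intro!: exI[of _ "tensor_part y"])
  next
    assume "\<not> good v"
    then obtain r where r: "curvature r" "r 1 2 1 3 = 0" "\<forall>M. degenerate v M \<longrightarrow> singular_tensor r M"
      "\<not> (\<forall>i j k l. r i j k l = 0)" unfolding good_def by blast
    define y where "y k = (case k of Inl I \<Rightarrow> v $ I | Inr (Inl (i, j, k, l)) \<Rightarrow> r i j k l | Inr (Inr _) \<Rightarrow> 0)" for k :: index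
    have p: "ext_part y = v" "tensor_part y = r"
      by (auto simp: ext_part_def tensor_part_def vec_eq_iff fun_eq_iff y_def)
    have "y \<notin> ?D" unfolding D_iff p using r(3) by simp
    then have "y \<in> ?B" using r(1,2,4) p by simp
    moreover have "y k = embed v k" if "k \<notin> ?T" for k
      using that by (auto simp: y_def embed_def split: sum.split)
    ultimately show "\<exists>y. (\<forall>k. k \<notin> ?T \<longrightarrow> y k = embed v k) \<and> y \<in> ?B" by blast
  qed
  have "embed v \<in> ?G \<longleftrightarrow> good v" for v
    by (subst mem_Collect_eq, subst iff, rule not_not)
  with G show ?thesis by (intro bexI[of _ ?G] allI)
qed

lemma good_generic:
  obtains g where "g \<in> ext_polys" "generic_nonzero g" "\<And>v. v \<in> ext_power 4 \<Longrightarrow> g v \<noteq> 0 \<Longrightarrow> good v"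
proof -
  obtain \<delta> where \<delta>: "\<delta> > 0" "\<And>v. dist v base_point < \<delta> \<Longrightarrow> good v" using good_near_base_point by blast
  obtain G where G: "G \<in> constructible" "\<And>v. embed v \<in> G \<longleftrightarrow> good v" using constructible_good by blast
  have e: "(\<lambda>v. embed v k) \<in> ext_polys" for k
    by (cases k) (auto simp: embed_def intro: poly_functions.intros)
  show thesis
  proof (rule constructible_generic[where e = embed, OF G(1) e base_point_ext_power \<delta>(1)])
    show "embed v \<in> G" if "dist v base_point < \<delta>" for v using that by (simp only: G(2) \<delta>(2))
  next
    fix g assume "g \<in> ext_polys" "generic_nonzero g" "\<And>v. v \<in> ext_power 4 \<Longrightarrow> g v \<noteq> 0 \<Longrightarrow> embed v \<in> G"
    then show thesis unfolding G(2) by (rule that)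
  qed
qed

text \<open>Here the form of \<open>base_point\<close> has, on e_2, ..., e_7, only the entries 23,
  24, 45, 67 above the diagonal, all equal to 1. Replacing e_4 by e_4 - e_3 in
  \<open>nondegenerate_basis\<close> makes it block diagonal.\<close>

definition nondegenerate_frame :: frame where
  "nondegenerate_frame = frame_of (e8 0) (e8 1 + e8 2 + e8 5)"

definition nondegenerate_basis :: "nat \<Rightarrow> V8" where
  "nondegenerate_basis a = [e8 2, e8 3, e8 4 - e8 3, e8 5, e8 6, e8 7] ! a"

lemma pfaffian_base_point:
  "pfaffian 3 (\<lambda>a b. psi base_point nondegenerate_frame (nondegenerate_basis a) (nondegenerate_basis b)) \<noteq> 0"
proof -
  let ?a = "\<lambda>a b. psi base_point nondegenerate_frame (nondegenerate_basis a) (nondegenerate_basis b)"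
  have x: "nondegenerate_basis 0 = e8 2" "nondegenerate_basis 1 = e8 3" "nondegenerate_basis 2 = e8 4 - e8 3"
    "nondegenerate_basis 3 = e8 5" "nondegenerate_basis 4 = e8 6" "nondegenerate_basis 5 = e8 7"
    by (simp_all add: nondegenerate_basis_def)
  have "pfaffian 3 ?a = ?a 0 1 * ?a 2 3 * ?a 4 5"
    by (rule pfaffian_3_block; (rule skew_bilinearD(3)[OF skew_bilinear_psi])?;
        unfold psi_base_point_minors x nondegenerate_frame_def frame_of_nth; simp add: wedges4)
  also have "\<dots> \<noteq> 0"
    unfolding psi_base_point_minors x nondegenerate_frame_def frame_of_nth by (simp add: wedges4)
  finally show ?thesis .
qed

lemma rank_nondegenerate_frame: "rank nondegenerate_frame = 2"
  unfolding rank_2_pl pl_def nondegenerate_frame_def by (intro exI[of _ 0] exI[of _ 1]) simp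

text \<open>A combination of the two tensors whose component 1 2 1 3 cancels is singular along the
  degenerate frames, so goodness makes it zero.\<close>

lemma good_unique:
  assumes good: "good v" and P: "M\<^sub>0 = nondegenerate_frame" "pfaffian_section v M\<^sub>0 \<noteq> 0"
    and s: "defines_quadratic_section s" "singular_along s (D_Z6 v)"
  shows "same_hypersurface s (pfaffian_section v)"
proof -
  let ?P = "pfaffian_section v"
  obtain p where p: "curvature p" "\<And>M. rank M = 2 \<Longrightarrow> ?P M = contract p (M $ 1) (M $ 2) (M $ 1) (M $ 2)"
    using section_curvature[OF pfaffian_section_is_section] by metis
  obtain r where r: "curvature r" "\<And>M. rank M = 2 \<Longrightarrow> s M = contract r (M $ 1) (M $ 2) (M $ 1) (M $ 2)"
    using section_curvature s(1) unfolding defines_quadratic_section_def by metis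
  have sing: "singular_tensor p M" "singular_tensor r M" if M: "degenerate v M" for M
  proof -
    note U = degenerate_in_D_Z6[OF M]
    show "singular_tensor p M"
      by (rule singular_at_tensor[OF _ U(2) p]) (use pfaffian_section_singular_along U(1) in \<open>auto simp: singular_along_def\<close>)
    show "singular_tensor r M"
      by (rule singular_at_tensor[OF _ U(2) r]) (use s(2) U(1) in \<open>auto simp: singular_along_def\<close>)
  qed
  have unique: "a * p i j k l + b * r i j k l = 0" if "a * p 1 2 1 3 + b * r 1 2 1 3 = 0" for a b i j k l
  proof -
    have "curvature (\<lambda>i j k l. a * p i j k l + b * r i j k l)" by (rule curvature_combine[OF p(1) r(1)])
    moreover have "\<forall>M. degenerate v M \<longrightarrow> singular_tensor (\<lambda>i j k l. a * p i j k l + b * r i j k l) M"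
      using sing singular_tensor_combine by blast
    ultimately show ?thesis
      using good[unfolded good_def, rule_format, of "\<lambda>i j k l. a * p i j k l + b * r i j k l" i j k l] that by simp
  qed
  have combine: "a * ?P M + b * s M = 0" if "a * p 1 2 1 3 + b * r 1 2 1 3 = 0" "rank M = 2" for a b M
    using unique[OF that(1)] contract_combine[of a p b r "M $ 1" "M $ 2" "M $ 1" "M $ 2"] that(2)
    by (simp add: p(2) r(2)) (simp add: contract_def)
  \<comment> \<open>If this component were zero, goodness would annihilate p itself, contrary to the
    nonzero Pfaffian at \<open>M\<^sub>0\<close>.\<close>
  have p0: "p 1 2 1 3 \<noteq> 0"
    using combine[of 1 0 M\<^sub>0] P rank_nondegenerate_frame by auto
  define c where "c = r 1 2 1 3 / p 1 2 1 3"
  have sc: "s M = c * ?P M" if "rank M = 2" for M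
    using combine[of c "-1" M] that p0 by (simp add: c_def)
  moreover have "c \<noteq> 0" using s(1) sc unfolding defines_quadratic_section_def by auto
  ultimately show ?thesis unfolding same_hypersurface_def by blast
qed

theorem theorem1p2:
  shows "\<exists>\<Omega>. zariski_open_ext_power 4 \<Omega> \<and> \<Omega> \<noteq> {} \<and>
    (\<forall>v\<in>\<Omega>.
       D_Z6 v \<subseteq> D_Z1 v \<and>
       D_Z1 v = zero_locus (pfaffian_section v) \<and>
       defines_quadratic_section (pfaffian_section v) \<and>
       singular_along (pfaffian_section v) (D_Z6 v) \<and>
       (\<forall>s. defines_quadratic_section s \<and> singular_along s (D_Z6 v)
            \<longrightarrow> same_hypersurface s (pfaffian_section v)))"
proof -
  let ?M = nondegenerate_frame
  obtain g where g: "g \<in> ext_polys" "generic_nonzero g" "\<And>v. v \<in> ext_power 4 \<Longrightarrow> g v \<noteq> 0 \<Longrightarrow> good v"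
    using good_generic by blast
  \<comment> \<open>Nonvanishing of h makes the Pfaffian section nonzero at a fixed frame; \<Omega>
    is the principal open set of the product of g and h.\<close>
  define h where "h v = pfaffian 3 (\<lambda>a b. psi v ?M (nondegenerate_basis a) (nondegenerate_basis b))" for v
  have "(\<lambda>v. h v) \<in> ext_polys"
    unfolding h_def by (intro poly_pfaffian poly_psi poly_functions.const poly_functions.coord) auto
  then have h: "h \<in> ext_polys" by simp
  have "generic_nonzero h"
    unfolding generic_nonzero_def h_def using pfaffian_base_point base_point_ext_power by blast
  then have gh: "generic_nonzero (\<lambda>v. g v * h v)" by (rule generic_nonzero_mult[OF g(1) h g(2)])
  define \<Omega> where "\<Omega> = {v \<in> ext_power 4. g v * h v \<noteq> 0}"
  have "\<Omega> = ext_power 4 - {v \<in> ext_power 4. \<forall>p\<in>{\<lambda>v. g v * h v}. p v = 0}" by (auto simp: \<Omega>_def)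
  moreover have "{\<lambda>v. g v * h v} \<subseteq> ext_polys" using poly_functions.mult[OF g(1) h] by simp
  ultimately have "zariski_open_ext_power 4 \<Omega>" unfolding zariski_open_ext_power_def by blast
  moreover have "\<Omega> \<noteq> {}" using gh by (auto simp: generic_nonzero_def \<Omega>_def)
  moreover have "defines_quadratic_section (pfaffian_section v) \<and>
      (\<forall>s. defines_quadratic_section s \<and> singular_along s (D_Z6 v) \<longrightarrow> same_hypersurface s (pfaffian_section v))"
    if v: "v \<in> \<Omega>" for v
  proof -
    have P: "pfaffian_section v ?M \<noteq> 0"
      using v pfaffian_eq[OF rank_nondegenerate_frame, of v nondegenerate_basis] by (auto simp: \<Omega>_def h_def)
    have good: "good v" using v g(3) by (simp add: \<Omega>_def)
    show ?thesis
      using P pfaffian_section_is_section rank_nondegenerate_frame good_unique[OF good refl P]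
      unfolding defines_quadratic_section_def by blast
  qed
  ultimately show ?thesis
    using D_Z6_subset_D_Z1 D_Z1_eq_zero_locus pfaffian_section_singular_along by (intro exI[of _ \<Omega>]) auto
qed

end
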